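(* Let $\psi\in\mathcal S(\Gamma)$ be such that $\|\psi\|_{L^2(\Gamma)}^2=1$. Suppose that $p_\psi\in\mathcal A$ satisfies the self-duality equation $(\overline\partial p_\psi)p_\psi=0$. Then $p_{\widehat\psi}\in\mathcal A^\circ$ satisfies the anti-self duality equation $(\partial p_{\widehat\psi})p_{\widehat\psi}=0$.
   Context: All abelian groups are written additively. $\Gamma$ is a second countable locally compact abelian group, elementary in the sense of Bruhat, so that Schwartz(–Bruhat) spaces are defined; $\widehat\Gamma$ is its Pontryagin dual with Haar measure chosen so that Plancherel's theorem holds for $\mathcal F(f)(\gamma)=\widehat f(\gamma)=\int_\Gamma f(s)\overline{\gamma(s)}\,ds$; $G=\widehat\Gamma\times\Gamma$ with product Haar measure $\mu_G$. Scalar products on $L^2$ spaces are linear in the first variable. On $L^2(\Gamma)$: $\pi(\gamma,t)\xi(s)=\gamma(s)\xi(s-t)$. On $L^2(\widehat\Gamma)$: $\pi^\circ\iota(\gamma,t)\xi(\delta)=\overline{(\delta-\gamma)(t)}\,\xi(\delta-\gamma)$. $\mathcal A$ (resp. $\mathcal A^\circ$) is the $*$-algebra of operators $\int_G a(g)\pi(g)\,d\mu_G$ (resp. $\int_G a(g)\,\pi^\circ\iota(g)\,d\mu_G$), $a\in\mathcal S(G)$. Hermitian products: ${}_{\mathcal A}\langle\xi,\eta\rangle=\int_G\langle\xi,\pi(g)\eta\rangle\pi(g)\,d\mu_G$ for $\xi,\eta\in\mathcal S(\Gamma)$ and ${}_{\mathcal A^\circ}\langle\xi',\eta'\rangle=\int_G\langle\xi',\pi^\circ\iota(g)\eta'\rangle\,\pi^\circ\iota(g)\,d\mu_G$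 for $\xi',\eta'\in\mathcal S(\widehat\Gamma)$. With these, $\mathcal S(\Gamma)$ is an equivalence bimodule between $\mathcal A$ and $\mathbb C$, and $\mathcal S(\widehat\Gamma)$ one between $\mathcal A^\circ$ and $\mathbb C$. Write $p_\psi={}_{\mathcal A}\langle\psi,\psi\rangle$ and $p_{\widehat\psi}={}_{\mathcal A^\circ}\langle\widehat\psi,\widehat\psi\rangle$; these are projections when $\|\psi\|=1$. Standing assumptions: there are $*$-derivations $\partial_1,\partial_2$ on $\mathcal A$ and on $\mathcal A^\circ$ (from an infinitesimal $\mathbb T^2$-action by automorphisms), under which the trace $\pi(k)\mapsto k(0)$, respectively $\pi^\circ\iota(k)\mapsto k(0)$, is invariant, i.e. vanishes on $\partial_jK$; and linear maps (covariant derivatives) $\nabla_1,\nabla_2$ on $\mathcal S(\Gamma)$ and on $\mathcal S(\widehat\Gamma)$ such that (on each of the two bimodules, with ${}_\bullet\langle\cdot,\cdot\rangle$ the corresponding left hermitian product) $\nabla_j(K\cdot\xi)=(\partial_jK)\cdot\xi+K\cdot(\nabla_j\xi)$, $\ \partial_j({}_\bullet\langle\xi,\eta\rangle)={}_\bullet\langle\nabla_j\xi,\eta\rangle+{}_\bullet\langle\xi,\nabla_j\eta\rangle$, and integration by parts holds: $\langle\nabla_j\xi,\eta\rangle_{L^2}=-\langle\xi,\nabla_j\eta\rangle_{L^2}$. Moreover $\mathcal F\circ\nabla_1=\nabla_2\circ\mathcal F$ and $\mathcal F\circ\nabla_2=\nabla_1\circ\mathcal F$ on $\mathcal S(\Gamma)$.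 Put $\overline\partial=\partial_1+i\partial_2$ and $\partial=\partial_1-i\partial_2$. *)

theory Defs
  imports "HOL-Analysis.Analysis"
begin

section \<open>The Pontryagin dual\<close>

text \<open>The dual group consists of the continuous homomorphisms into the unit circle; its group
  operation is written additively.\<close>

typedef (overloaded) 'a dual =
  "{c :: 'a::topological_ab_group_add \<Rightarrow> complex.
      continuous_on UNIV c \<and> (\<forall>s. norm (c s) = 1) \<and> (\<forall>s t. c (s + t) = c s * c t)}"
  morphisms char_of Dual
  by (intro exI[of _ "\<lambda>_. 1"]) auto

lemma char_of_cont: "continuous_on UNIV (char_of c)"
  and char_of_norm [simp]: "norm (char_of c s) = 1"
  and char_of_add: "char_of c (s + t) = char_of c s * char_of c t"
  using char_of[of c] by auto

lemma dual_eqI: "(\<And>s. char_of c s = char_of d s) \<Longrightarrow> c = d"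
  by (metis char_of_inject ext)

lemma char_of_nz [simp]: "char_of c s \<noteq> 0"
  by (metis char_of_norm norm_zero zero_neq_one)

instantiation dual :: (topological_ab_group_add) ab_group_add
begin

definition zero_dual :: "'a dual" where "0 = Dual (\<lambda>_. 1)"
definition plus_dual :: "'a dual \<Rightarrow> 'a dual \<Rightarrow> 'a dual"
  where "c + d = Dual (\<lambda>s. char_of c s * char_of d s)"
definition uminus_dual :: "'a dual \<Rightarrow> 'a dual"
  where "- c = Dual (\<lambda>s. cnj (char_of c s))"
definition minus_dual :: "'a dual \<Rightarrow> 'a dual \<Rightarrow> 'a dual"
  where "c - d = c + - (d :: 'a dual)"

lemma char_of_zero_dual [simp]: "char_of (0 :: 'a dual) s = 1"
  unfolding zero_dual_def by (subst Dual_inverse) auto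

lemma char_of_plus_dual [simp]: "char_of (c + d :: 'a dual) s = char_of c s * char_of d s"
  unfolding plus_dual_def
  by (subst Dual_inverse) (auto simp: norm_mult char_of_add intro!: continuous_intros char_of_cont)

lemma char_of_uminus_dual [simp]: "char_of (- c :: 'a dual) s = cnj (char_of c s)"
  unfolding uminus_dual_def
  by (subst Dual_inverse) (auto simp: char_of_add intro!: continuous_intros char_of_cont)

instance
proof
  fix a b c :: "'a dual"
  show "- a + a = 0"
    by (rule dual_eqI) (simp add: mult.commute[of "cnj _"] complex_norm_square[symmetric])
qed (auto intro!: dual_eqI simp: minus_dual_def mult_ac)

end

text \<open>Topology of uniform convergence on compact sets, i.e. the compact-open topology.\<close>

instantiation dual :: (topological_ab_group_add) topological_space
begin

definition open_dual :: "'a dual set \<Rightarrow> bool" where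
  "open U \<longleftrightarrow> (\<forall>c\<in>U. \<exists>K e. compact K \<and> e > 0 \<and>
      {d. \<forall>s\<in>K. dist (char_of d s) (char_of c s) < e} \<subseteq> U)"

instance
proof
  show "open (UNIV :: 'a dual set)"
    unfolding open_dual_def by (auto intro!: exI[of _ "{}"] exI[of _ "1::real"])
next
  fix S T :: "'a dual set"
  assume S: "open S" and T: "open T"
  show "open (S \<inter> T)"
    unfolding open_dual_def
  proof
    fix c assume c: "c \<in> S \<inter> T"
    obtain K e where 1: "compact K" "e > 0" "{d. \<forall>s\<in>K. dist (char_of d s) (char_of c s) < e} \<subseteq> S"
      using S c unfolding open_dual_def by (auto dest!: bspec)
    obtain L f where 2: "compact L" "f > 0" "{d. \<forall>s\<in>L. dist (char_of d s) (char_of c s) < f} \<subseteq> T"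
      using T c unfolding open_dual_def by (auto dest!: bspec)
    show "\<exists>K e. compact K \<and> e > 0 \<and>
        {d. \<forall>s\<in>K. dist (char_of d s) (char_of c s) < e} \<subseteq> S \<inter> T"
      using 1 2 by (intro exI[of _ "K \<union> L"] exI[of _ "min e f"]) (auto simp: subset_iff)
  qed
next
  fix \<U> :: "'a dual set set"
  assume U: "\<forall>S\<in>\<U>. open S"
  show "open (\<Union>\<U>)"
    unfolding open_dual_def
  proof
    fix c assume "c \<in> \<Union>\<U>"
    then obtain S where S: "S \<in> \<U>" "c \<in> S" by blast
    with U have "open S" by blast
    with S(2) obtain K e where "compact K" "e > 0"
      and sub: "{d. \<forall>s\<in>K. dist (char_of d s) (char_of c s) < e} \<subseteq> S"
      unfolding open_dual_def by (auto dest!: bspec)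
    moreover have "{d. \<forall>s\<in>K. dist (char_of d s) (char_of c s) < e} \<subseteq> \<Union>\<U>"
      using sub S(1) by (rule order_trans[OF _ Union_upper])
    ultimately show "\<exists>K e. compact K \<and> e > 0 \<and>
        {d. \<forall>s\<in>K. dist (char_of d s) (char_of c s) < e} \<subseteq> \<Union>\<U>"
      by (intro exI conjI)
  qed
qed

end

lemma eventually_nhds_dual:
  fixes c :: "'a::topological_ab_group_add dual"
  shows "eventually P (nhds c) \<longleftrightarrow>
    (\<exists>K e. compact K \<and> e > 0 \<and> (\<forall>d. (\<forall>s\<in>K. dist (char_of d s) (char_of c s) < e) \<longrightarrow> P d))"
proof
  assume "eventually P (nhds c)"
  then obtain U where "open U" "c \<in> U" and P: "\<forall>d\<in>U. P d"
    by (auto simp: eventually_nhds)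
  then obtain K e where K: "compact K" "e > 0"
    and sub: "{d. \<forall>s\<in>K. dist (char_of d s) (char_of c s) < e} \<subseteq> U"
    unfolding open_dual_def by (auto dest!: bspec)
  show "\<exists>K e. compact K \<and> e > 0 \<and> (\<forall>d. (\<forall>s\<in>K. dist (char_of d s) (char_of c s) < e) \<longrightarrow> P d)"
    using K sub P by (intro exI[of _ K] exI[of _ e] conjI) auto
next
  assume "\<exists>K e. compact K \<and> e > 0 \<and> (\<forall>d. (\<forall>s\<in>K. dist (char_of d s) (char_of c s) < e) \<longrightarrow> P d)"
  then obtain K e where K: "compact K" "e > 0"
    and P: "\<And>d. (\<forall>s\<in>K. dist (char_of d s) (char_of c s) < e) \<Longrightarrow> P d"
    by blast
  define W where "W = {d. \<exists>f<e. \<forall>s\<in>K. dist (char_of d s) (char_of c s) \<le> f}"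
  have "open W"
    unfolding open_dual_def
  proof
    fix d assume "d \<in> W"
    then obtain f where f: "f < e" "\<forall>s\<in>K. dist (char_of d s) (char_of c s) \<le> f"
      unfolding W_def by blast
    have "d' \<in> W" if d': "\<forall>s\<in>K. dist (char_of d' s) (char_of d s) < (e - f) / 2" for d'
    proof -
      have "\<forall>s\<in>K. dist (char_of d' s) (char_of c s) \<le> (e + f) / 2"
      proof
        fix s assume "s \<in> K"
        then have "dist (char_of d' s) (char_of d s) < (e - f) / 2"
          and "dist (char_of d s) (char_of c s) \<le> f"
          using d' f by auto
        then show "dist (char_of d' s) (char_of c s) \<le> (e + f) / 2"
          using dist_triangle[of "char_of d' s" "char_of c s" "char_of d s"] by argo
      qed
      moreover have "(e + f) / 2 < e" using f by simp
      ultimately show ?thesis unfolding W_def by blast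
    qed
    then show "\<exists>K e. compact K \<and> e > 0 \<and> {d'. \<forall>s\<in>K. dist (char_of d' s) (char_of d s) < e} \<subseteq> W"
      using K f by (intro exI[of _ K] exI[of _ "(e - f) / 2"]) auto
  qed
  moreover have "c \<in> W" using K unfolding W_def by (auto intro!: exI[of _ 0])
  moreover have "\<forall>d\<in>W. P d" using P unfolding W_def by (auto intro: le_less_trans)
  ultimately show "eventually P (nhds c)"
    unfolding eventually_nhds by blast
qed

instance dual :: (topological_ab_group_add) topological_ab_group_add
proof
  fix a b :: "'a dual"
  have key: "dist (x * y) (x' * y') \<le> dist x x' + dist y y'"
    if "norm y = 1" "norm x' = 1" for x y x' y' :: complex
  proof -
    have "x * y - x' * y' = (x - x') * y + x' * (y - y')" by (simp add: algebra_simps)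
    then have "norm (x * y - x' * y') \<le> norm ((x - x') * y) + norm (x' * (y - y'))"
      using norm_triangle_ineq by metis
    then show ?thesis using that by (simp add: norm_mult dist_norm)
  qed
  show "((\<lambda>x. fst x + snd x) \<longlongrightarrow> a + b) (nhds a \<times>\<^sub>F nhds b)"
    unfolding filterlim_iff
  proof (intro allI impI)
    fix P assume "eventually P (nhds (a + b))"
    then obtain K e where K: "compact K" "e > 0"
      and P: "\<And>d. (\<forall>s\<in>K. dist (char_of d s) (char_of (a + b) s) < e) \<Longrightarrow> P d"
      unfolding eventually_nhds_dual by blast
    have A: "\<forall>\<^sub>F d in nhds a. \<forall>s\<in>K. dist (char_of d s) (char_of a s) < e / 2"
      and B: "\<forall>\<^sub>F d in nhds b. \<forall>s\<in>K. dist (char_of d s) (char_of b s) < e / 2"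
      unfolding eventually_nhds_dual
      using K by (intro exI[of _ K] exI[of _ "e / 2"], simp)+
    show "\<forall>\<^sub>F x in nhds a \<times>\<^sub>F nhds b. P (fst x + snd x)"
    proof (rule eventually_prodI[OF A B, THEN eventually_mono])
      fix x :: "'a dual \<times> 'a dual"
      assume x: "(\<forall>s\<in>K. dist (char_of (fst x) s) (char_of a s) < e / 2) \<and>
        (\<forall>s\<in>K. dist (char_of (snd x) s) (char_of b s) < e / 2)"
      show "P (fst x + snd x)"
      proof (rule P, rule ballI)
        fix s assume "s \<in> K"
        with x have "dist (char_of (fst x) s) (char_of a s) < e / 2"
          and "dist (char_of (snd x) s) (char_of b s) < e / 2"
          by auto
        then show "dist (char_of (fst x + snd x) s) (char_of (a + b) s) < e"
          using key[of "char_of (snd x) s" "char_of a s" "char_of (fst x) s" "char_of b s"] by simp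
      qed
    qed
  qed
  show "(uminus \<longlongrightarrow> - a) (nhds a)"
    unfolding filterlim_iff
  proof (intro allI impI)
    fix P assume "eventually P (nhds (- a))"
    then obtain K e where K: "compact K" "e > 0"
      and P: "\<And>d. (\<forall>s\<in>K. dist (char_of d s) (char_of (- a) s) < e) \<Longrightarrow> P d"
      unfolding eventually_nhds_dual by blast
    have "dist (cnj x) (cnj y) = dist x y" for x y
      by (metis complex_cnj_diff complex_mod_cnj dist_norm)
    then show "\<forall>\<^sub>F x in nhds a. P (- x)"
      unfolding eventually_nhds_dual using K P by (intro exI[of _ K] exI[of _ e]) auto
  qed
qed

instance prod :: (topological_monoid_add, topological_monoid_add) topological_monoid_add
proof
  fix a b :: "'a \<times> 'b"
  have f: "(fst \<longlongrightarrow> fst c) (nhds c)" and s: "(snd \<longlongrightarrow> snd c) (nhds c)" for c :: "'a \<times> 'b"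
    by (auto intro!: tendsto_intros filterlim_ident)
  have a: "(fst \<longlongrightarrow> a) (nhds a \<times>\<^sub>F nhds b)" and b: "(snd \<longlongrightarrow> b) (nhds a \<times>\<^sub>F nhds b)"
    by (rule filterlim_fst filterlim_snd)+
  have "((\<lambda>x. (fst (fst x) + fst (snd x), snd (fst x) + snd (snd x))) \<longlongrightarrow>
      (fst a + fst b, snd a + snd b)) (nhds a \<times>\<^sub>F nhds b)"
    by (intro tendsto_Pair filterlim_compose[OF f a] filterlim_compose[OF f b]
        filterlim_compose[OF s a] filterlim_compose[OF s b] tendsto_add)
  then show "((\<lambda>x. fst x + snd x) \<longlongrightarrow> a + b) (nhds a \<times>\<^sub>F nhds b)"
    by (simp add: plus_prod_def)
qed

instance prod :: (topological_comm_monoid_add, topological_comm_monoid_add) topological_comm_monoid_add ..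

instance prod :: (topological_group_add, topological_group_add) topological_group_add
proof
  fix a :: "'a \<times> 'b"
  have f: "(fst \<longlongrightarrow> fst a) (nhds a)" and s: "(snd \<longlongrightarrow> snd a) (nhds a)"
    by (auto intro!: tendsto_intros filterlim_ident)
  have "((\<lambda>x. (- fst x, - snd x)) \<longlongrightarrow> (- fst a, - snd a)) (nhds a)"
    by (intro tendsto_Pair tendsto_minus f s)
  then show "(uminus \<longlongrightarrow> - a) (nhds a)"
    by (simp add: uminus_prod_def[abs_def])
qed

instance prod :: (topological_ab_group_add, topological_ab_group_add) topological_ab_group_add ..


section \<open>Elementary groups and Schwartz--Bruhat functions\<close>

text \<open>The group \<open>\<real>\<^sup>n \<times> \<T>\<^sup>p \<times> \<int>\<^sup>q \<times> F\<close>, vectors being sequences padded with the neutral element. In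
  \<open>elementary_group\<close> the finite factor is taken inside the given group, which is no loss of
  generality: an isomorphism onto the group maps an abstract finite factor to a finite subgroup.\<close>

definition elementary_model ::
    "nat \<Rightarrow> nat \<Rightarrow> nat \<Rightarrow> 'a set \<Rightarrow> ((nat \<Rightarrow> real) \<times> (nat \<Rightarrow> complex) \<times> (nat \<Rightarrow> int) \<times> 'a) set" where
  "elementary_model n p q F =
    {x. \<forall>i\<ge>n. x i = 0} \<times> {z. (\<forall>i. norm (z i) = 1) \<and> (\<forall>i\<ge>p. z i = 1)} \<times> {k. \<forall>i\<ge>q. k i = 0} \<times> F"

definition elementary_group :: "'a::topological_ab_group_add itself \<Rightarrow> bool" where
  "elementary_group (_ :: 'a itself) \<longleftrightarrow>
    (\<exists>n p q (F :: 'a set) (\<Phi> :: _ \<Rightarrow> 'a) \<Psi>.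
      finite F \<and> 0 \<in> F \<and> (\<forall>f\<in>F. \<forall>g\<in>F. f - g \<in> F) \<and>
      homeomorphism (elementary_model n p q F) UNIV \<Phi> \<Psi> \<and>
      (\<forall>(x, z, k, f) \<in> elementary_model n p q F. \<forall>(y, w, l, g) \<in> elementary_model n p q F.
        \<Phi> (\<lambda>i. x i + y i, \<lambda>i. z i * w i, \<lambda>i. k i + l i, f + g) = \<Phi> (x, z, k, f) + \<Phi> (y, w, l, g)))"

text \<open>Coordinate-free form of the usual definition. On \<open>\<real>\<^sup>n \<times> \<T>\<^sup>p \<times> \<int>\<^sup>q \<times> F\<close> the one-parameter
  subgroups are the lines of \<open>\<real>\<^sup>n \<times> \<T>\<^sup>p\<close>, so their derivatives generate the invariant differential
  operators; the continuous homomorphisms to the reals are the linear forms in the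
  \<open>\<real>\<^sup>n \<times> \<int>\<^sup>q\<close>-coordinates, so their products span the (non-constant) monomials. A
  Schwartz--Bruhat function is a smooth function all of whose derivatives remain bounded after
  multiplication by any polynomial.\<close>

definition one_param_subgroups :: "(real \<Rightarrow> 'a::topological_ab_group_add) set" where
  "one_param_subgroups = {\<phi>. continuous_on UNIV \<phi> \<and> (\<forall>r r'. \<phi> (r + r') = \<phi> r + \<phi> r')}"

definition real_homs :: "('a::topological_ab_group_add \<Rightarrow> real) set" where
  "real_homs = {h. continuous_on UNIV h \<and> (\<forall>s t. h (s + t) = h s + h t)}"

fun iter_deriv ::
    "(real \<Rightarrow> 'a::topological_ab_group_add) list \<Rightarrow> ('a \<Rightarrow> complex) \<Rightarrow> 'a \<Rightarrow> complex" where
  "iter_deriv [] f = f"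
| "iter_deriv (\<phi> # \<phi>s) f = (\<lambda>s. vector_derivative (\<lambda>r. iter_deriv \<phi>s f (s + \<phi> r)) (at 0))"

definition smooth_fun :: "('a::topological_ab_group_add \<Rightarrow> complex) \<Rightarrow> bool" where
  "smooth_fun f \<longleftrightarrow>
    (\<forall>\<phi>s \<in> lists one_param_subgroups.
      continuous_on UNIV (iter_deriv \<phi>s f) \<and>
      (\<forall>\<phi> \<in> one_param_subgroups. \<forall>s. (\<lambda>r. iter_deriv \<phi>s f (s + \<phi> r)) differentiable (at 0)))"

definition schwartz :: "('a::topological_ab_group_add \<Rightarrow> complex) set" where
  "schwartz = {f. smooth_fun f \<and>
    (\<forall>\<phi>s \<in> lists one_param_subgroups. \<forall>hs \<in> lists real_homs.
      bounded (range (\<lambda>s. of_real (\<Prod>h\<leftarrow>hs. h s) * iter_deriv \<phi>s f s)))}"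


section \<open>Haar measures and the Fourier transform\<close>

text \<open>On a second countable locally compact group such a measure is automatically Radon.\<close>

definition haar_measure :: "'a::topological_ab_group_add measure \<Rightarrow> bool" where
  "haar_measure M \<longleftrightarrow>
    sets M = sets borel \<and>
    (\<forall>a. distr M borel (\<lambda>x. a + x) = M) \<and>
    (\<forall>K. compact K \<longrightarrow> emeasure M K < \<infinity>) \<and>
    (\<forall>U. open U \<and> U \<noteq> {} \<longrightarrow> emeasure M U > 0)"

definition L2 :: "'a measure \<Rightarrow> ('a \<Rightarrow> complex) set" where
  "L2 M = {f \<in> borel_measurable M. integrable M (\<lambda>x. (norm (f x))\<^sup>2)}"

definition l2_inner :: "'a measure \<Rightarrow> ('a \<Rightarrow> complex) \<Rightarrow> ('a \<Rightarrow> complex) \<Rightarrow> complex" where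
  "l2_inner M f g = (LINT x|M. f x * cnj (g x))"

definition fourier ::
    "'a::topological_ab_group_add measure \<Rightarrow> ('a \<Rightarrow> complex) \<Rightarrow> 'a dual \<Rightarrow> complex" where
  "fourier M f c = (LINT s|M. f s * cnj (char_of c s))"

text \<open>Plancherel's theorem: on \<open>L\<^sup>1 \<inter> L\<^sup>2\<close> the Fourier transform is isometric with dense range, so that
  it extends to a unitary operator between the two \<open>L\<^sup>2\<close> spaces.\<close>

definition plancherel ::
    "'a::topological_ab_group_add measure \<Rightarrow> 'a dual measure \<Rightarrow> bool" where
  "plancherel M N \<longleftrightarrow>
    (\<forall>f. integrable M f \<and> f \<in> L2 M \<longrightarrow>
      fourier M f \<in> L2 N \<and> (LINT c|N. (norm (fourier M f c))\<^sup>2) = (LINT s|M. (norm (f s))\<^sup>2)) \<and>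
    (\<forall>h\<in>L2 N. \<forall>e>0. \<exists>f. integrable M f \<and> f \<in> L2 M \<and>
      (LINT c|N. (norm (h c - fourier M f c))\<^sup>2) < e)"


section \<open>The two algebras of operators\<close>

definition heis_rep :: "'a::topological_ab_group_add dual \<times> 'a \<Rightarrow> ('a \<Rightarrow> complex) \<Rightarrow> 'a \<Rightarrow> complex" where
  "heis_rep g \<xi> s = char_of (fst g) s * \<xi> (s - snd g)"

definition heis_rep_op ::
    "'a::topological_ab_group_add dual \<times> 'a \<Rightarrow> ('a dual \<Rightarrow> complex) \<Rightarrow> 'a dual \<Rightarrow> complex" where
  "heis_rep_op g \<xi> \<delta> = cnj (char_of (\<delta> - fst g) (snd g)) * \<xi> (\<delta> - fst g)"

text \<open>Operators on \<open>L\<^sup>2\<close> are functions on square-integrable functions, extensional outside \<open>L2 M\<close>.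
  No passage to classes modulo null sets is needed: for rapidly decreasing \<open>a\<close> the integral below
  converges at every point, depends on \<open>\<xi>\<close> only up to null sets and is continuous, so that it is
  the canonical representative, and two operators of this kind agree as operators on \<open>L\<^sup>2\<close> iff they
  are equal as functions.\<close>

type_synonym 'x operator = "('x \<Rightarrow> complex) \<Rightarrow> 'x \<Rightarrow> complex"

definition integrated ::
    "'g measure \<Rightarrow> 'x measure \<Rightarrow> ('g \<Rightarrow> 'x operator) \<Rightarrow> ('g \<Rightarrow> complex) \<Rightarrow> 'x operator" where
  "integrated N M \<rho> a = (\<lambda>\<xi>\<in>L2 M. \<lambda>s. LINT g|N. a g * \<rho> g \<xi> s)"

definition op_add :: "'x measure \<Rightarrow> 'x operator \<Rightarrow> 'x operator \<Rightarrow> 'x operator" where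
  "op_add M K L = (\<lambda>\<xi>\<in>L2 M. \<lambda>s. K \<xi> s + L \<xi> s)"

definition op_scale :: "'x measure \<Rightarrow> complex \<Rightarrow> 'x operator \<Rightarrow> 'x operator" where
  "op_scale M c K = (\<lambda>\<xi>\<in>L2 M. \<lambda>s. c * K \<xi> s)"

definition op_mult :: "'x measure \<Rightarrow> 'x operator \<Rightarrow> 'x operator \<Rightarrow> 'x operator" where
  "op_mult M K L = compose (L2 M) K L"

definition op_zero :: "'x measure \<Rightarrow> 'x operator" where
  "op_zero M = (\<lambda>\<xi>\<in>L2 M. \<lambda>s. 0)"

definition is_adjoint :: "'x measure \<Rightarrow> 'x operator \<Rightarrow> 'x operator \<Rightarrow> bool" where
  "is_adjoint M K L \<longleftrightarrow> (\<forall>\<xi>\<in>L2 M. \<forall>\<eta>\<in>L2 M. l2_inner M (K \<xi>) \<eta> = l2_inner M \<xi> (L \<eta>))"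

definition schwartz_algebra ::
    "'g::topological_ab_group_add measure \<Rightarrow> 'x measure \<Rightarrow> ('g \<Rightarrow> 'x operator) \<Rightarrow> 'x operator set" where
  "schwartz_algebra N M \<rho> = integrated N M \<rho> ` schwartz"

definition left_herm ::
    "'g measure \<Rightarrow> 'x measure \<Rightarrow> ('g \<Rightarrow> 'x operator) \<Rightarrow> ('x \<Rightarrow> complex) \<Rightarrow> ('x \<Rightarrow> complex) \<Rightarrow> 'x operator" where
  "left_herm N M \<rho> \<xi> \<eta> = integrated N M \<rho> (\<lambda>g. l2_inner M \<xi> (\<rho> g \<eta>))"


text \<open>\<open>alg\<close> and \<open>herm\<close> belong to \<open>\<pi>\<close>, and \<open>alg_op\<close> and \<open>herm_op\<close> to \<open>\<pi>\<degree>\<iota>\<close>; \<open>\<mu>\<close> and \<open>\<nu>\<close> are the Haar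
  measures of the group and of its dual.\<close>

abbreviation alg where
  "alg \<mu> \<nu> \<equiv> schwartz_algebra (\<nu> \<Otimes>\<^sub>M \<mu>) \<mu> heis_rep"
abbreviation alg_op where
  "alg_op \<mu> \<nu> \<equiv> schwartz_algebra (\<nu> \<Otimes>\<^sub>M \<mu>) \<nu> heis_rep_op"
abbreviation herm where
  "herm \<mu> \<nu> \<equiv> left_herm (\<nu> \<Otimes>\<^sub>M \<mu>) \<mu> heis_rep"
abbreviation herm_op where
  "herm_op \<mu> \<nu> \<equiv> left_herm (\<nu> \<Otimes>\<^sub>M \<mu>) \<nu> heis_rep_op"


section \<open>Derivations and covariant derivatives\<close>

definition star_derivation ::
    "'x measure \<Rightarrow> 'x operator set \<Rightarrow> ('x operator \<Rightarrow> 'x operator) \<Rightarrow> bool" where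
  "star_derivation M A D \<longleftrightarrow>
    (\<forall>K\<in>A. D K \<in> A) \<and>
    (\<forall>K\<in>A. \<forall>L\<in>A. D (op_add M K L) = op_add M (D K) (D L)) \<and>
    (\<forall>c. \<forall>K\<in>A. D (op_scale M c K) = op_scale M c (D K)) \<and>
    (\<forall>K\<in>A. \<forall>L\<in>A. D (op_mult M K L) = op_add M (op_mult M (D K) L) (op_mult M K (D L))) \<and>
    (\<forall>K\<in>A. \<forall>L\<in>A. is_adjoint M K L \<longrightarrow> is_adjoint M (D K) (D L))"

text \<open>An infinitesimal action of the torus is an action of its abelian Lie algebra, i.e. a pair of
  commuting derivations, here \<open>D 1\<close> and \<open>D 2\<close>.\<close>

definition infinitesimal_torus_action ::
    "'x measure \<Rightarrow> 'x operator set \<Rightarrow> (nat \<Rightarrow> 'x operator \<Rightarrow> 'x operator) \<Rightarrow> bool" where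
  "infinitesimal_torus_action M A D \<longleftrightarrow>
    (\<forall>j\<in>{1, 2}. star_derivation M A (D j)) \<and> (\<forall>K\<in>A. D 1 (D 2 K) = D 2 (D 1 K))"

text \<open>The trace sends \<open>integrated N M \<rho> k\<close> to \<open>k 0\<close>.\<close>

definition trace_invariant ::
    "'g::topological_ab_group_add measure \<Rightarrow> 'x measure \<Rightarrow> ('g \<Rightarrow> 'x operator) \<Rightarrow>
      ('x operator \<Rightarrow> 'x operator) \<Rightarrow> bool" where
  "trace_invariant N M \<rho> D \<longleftrightarrow>
    (\<forall>k\<in>schwartz. \<forall>l\<in>schwartz. D (integrated N M \<rho> k) = integrated N M \<rho> l \<longrightarrow> l 0 = 0)"

definition covariant_derivative ::
    "'g::topological_ab_group_add measure \<Rightarrow> 'x::topological_ab_group_add measure \<Rightarrow>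
      ('g \<Rightarrow> 'x operator) \<Rightarrow> ('x operator \<Rightarrow> 'x operator) \<Rightarrow>
      (('x \<Rightarrow> complex) \<Rightarrow> 'x \<Rightarrow> complex) \<Rightarrow> bool" where
  "covariant_derivative N M \<rho> D cov \<longleftrightarrow>
    (\<forall>\<xi>\<in>schwartz. cov \<xi> \<in> schwartz) \<and>
    (\<forall>\<xi>\<in>schwartz. \<forall>\<eta>\<in>schwartz. cov (\<lambda>s. \<xi> s + \<eta> s) = (\<lambda>s. cov \<xi> s + cov \<eta> s)) \<and>
    (\<forall>c. \<forall>\<xi>\<in>schwartz. cov (\<lambda>s. c * \<xi> s) = (\<lambda>s. c * cov \<xi> s)) \<and>
    (\<forall>K\<in>schwartz_algebra N M \<rho>. \<forall>\<xi>\<in>schwartz. cov (K \<xi>) = (\<lambda>s. D K \<xi> s + K (cov \<xi>) s)) \<and>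
    (\<forall>\<xi>\<in>schwartz. \<forall>\<eta>\<in>schwartz. D (left_herm N M \<rho> \<xi> \<eta>) =
      op_add M (left_herm N M \<rho> (cov \<xi>) \<eta>) (left_herm N M \<rho> \<xi> (cov \<eta>))) \<and>
    (\<forall>\<xi>\<in>schwartz. \<forall>\<eta>\<in>schwartz. l2_inner M (cov \<xi>) \<eta> = - l2_inner M \<xi> (cov \<eta>))"

definition holo_deriv ::
    "'x measure \<Rightarrow> (nat \<Rightarrow> 'x operator \<Rightarrow> 'x operator) \<Rightarrow> 'x operator \<Rightarrow> 'x operator" where
  "holo_deriv M D K = op_add M (D 1 K) (op_scale M (- \<i>) (D 2 K))"

definition antiholo_deriv ::
    "'x measure \<Rightarrow> (nat \<Rightarrow> 'x operator \<Rightarrow> 'x operator) \<Rightarrow> 'x operator \<Rightarrow> 'x operator" where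
  "antiholo_deriv M D K = op_add M (D 1 K) (op_scale M \<i> (D 2 K))"

end

theory Submission
  imports Defs
begin

text \<open>Write \<open>\<langle>f, g\<rangle>\<close> for the \<open>L\<^sup>2\<close> product. Both hermitian products are rank-one operators:
  \<open>herm \<xi> \<eta> \<zeta> = \<langle>\<zeta>, \<eta>\<rangle> \<xi>\<close> and, after a Fourier transform, \<open>herm_op \<xi>' \<eta>' \<zeta>' = \<langle>\<zeta>', \<eta>'\<rangle> \<xi>'\<close>. With
  \<open>Z j = cov j \<psi>\<close> and \<open>b j = \<langle>\<psi>, Z j\<rangle>\<close>, self-duality applied to \<open>\<psi>\<close> therefore reads
  \<open>(Z 1 + b 1 \<psi>) + \<i> (Z 2 + b 2 \<psi>) = 0\<close>. Since the Fourier transform is unitary and exchanges the two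
  covariant derivatives, the left-hand side of the anti-self-duality equation is \<open>- \<i>\<close> times the Fourier
  transform of this expression, applied to a rank-one projection.

  The analytic work lies in the two inputs. First, Fourier transforms and matrix coefficients
  \<open>g \<mapsto> \<langle>\<xi>, \<pi>(g) \<eta>\<rangle>\<close> of Schwartz--Bruhat functions are again Schwartz--Bruhat: one-parameter subgroups of
  the dual are exponentials of real homomorphisms of the group and vice versa, so derivatives turn into
  multiplications and back. Second, the matrix coefficients are integrable, which follows from the
  integrability of the weights \<open>\<Prod>i. 1 / (1 + h i\<^sup>2)\<close> for coordinate homomorphisms \<open>h i\<close>; then the integrals
  defining the hermitian products can be computed by Fubini's theorem.\<close>

section \<open>Characters, real homomorphisms and one-parameter subgroups\<close>

text \<open>The two sides are not symmetric. On the dual side the rank-one formula holds at every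
  point: integrating over the group variable first produces a product of Fourier transforms whose
  factor \<open>fourier \<mu> \<xi> \<delta>\<close> no longer depends on the remaining variable. On
  the group side the formula is obtained almost everywhere, by comparing Fourier transforms and
  appealing to Plancherel's theorem. Self-duality thus becomes an almost everywhere identity between
  functions on the group, and the Fourier integral turns it into one at every character.

  The other obstacle is that the dual comes without coordinates, a countable basis or
  sigma-finiteness. Its basis is built from relatively compact open sets of the group, its
  coordinates are the exponents of characters along one-parameter subgroups, and its unit box is
  measured by Plancherel's theorem instead of by compactness. Positive integrable weights then give
  sigma-finiteness of both Haar measures, and on the dual also a test function for reflection
  invariance.\<close>

lemma real_homsD:
  assumes "h \<in> real_homs"
  shows "continuous_on UNIV h" "h (s + t) = h s + h t" "h 0 = 0" "h (- s) = - h s" "h (s - t) = h s - h t"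
proof -
  have *: "h (s + t) = h s + h t" for s t using assms by (auto simp: real_homs_def)
  show "continuous_on UNIV h" "h (s + t) = h s + h t" using assms by (auto simp: real_homs_def)
  show 0: "h 0 = 0" using *[of 0 0] by simp
  show m: "h (- s) = - h s" for s using *[of s "- s"] 0 by simp
  show "h (s - t) = h s - h t" using *[of s "- t"] m by simp
qed

lemma one_paramD:
  assumes "\<phi> \<in> one_param_subgroups"
  shows "continuous_on UNIV \<phi>" "\<phi> (r + r') = \<phi> r + \<phi> r'" "\<phi> 0 = 0" "\<phi> (- r) = - \<phi> r"
    "\<phi> (r - r') = \<phi> r - \<phi> r'"
proof -
  have *: "\<phi> (r + r') = \<phi> r + \<phi> r'" for r r' using assms by (auto simp: one_param_subgroups_def)
  show "continuous_on UNIV \<phi>" "\<phi> (r + r') = \<phi> r + \<phi> r'"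
    using assms by (auto simp: one_param_subgroups_def)
  show 0: "\<phi> 0 = 0" using *[of 0 0] by simp
  show m: "\<phi> (- r) = - \<phi> r" for r using *[of r "- r"] 0 by (simp add: eq_neg_iff_add_eq_0 add.commute)
  show "\<phi> (r - r') = \<phi> r - \<phi> r'" using *[of r "- r'"] m by simp
qed

lemma char_of_0 [simp]: "char_of c (0 :: 'a::topological_ab_group_add) = 1"
  using char_of_add[of c 0 0] by simp

lemma char_of_uminus: "char_of c (- s :: 'a::topological_ab_group_add) = cnj (char_of c s)"
proof -
  have "char_of c s * char_of c (- s) = 1" using char_of_add[of c s "- s"] by simp
  moreover have "char_of c s * cnj (char_of c s) = 1"
    by (simp add: complex_norm_square[symmetric])
  ultimately show ?thesis by (metis char_of_nz mult_left_cancel)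
qed

lemma char_of_minus_dual [simp]: "char_of (c - d :: 'a::topological_ab_group_add dual) s = char_of c s * cnj (char_of d s)"
  unfolding minus_dual_def by (simp del: add_uminus_conv_diff)

lemma char_of_cnj_cancel [simp]: "char_of c s * cnj (char_of c s) = 1"
  by (simp add: complex_norm_square[symmetric])

lemma char_of_sum:
  "char_of c (sum f I :: 'a::topological_ab_group_add) = (\<Prod>i\<in>I. char_of c (f i))"
  by (induction I rule: infinite_finite_induct) (auto simp: char_of_add)

lemma char_of_sum_dual:
  "char_of (sum f I :: 'a::topological_ab_group_add dual) s = (\<Prod>i\<in>I. char_of (f i) s)"
  by (induction I rule: infinite_finite_induct) (auto simp: char_of_add)

lemma additive_of_int:
  fixes g :: "real \<Rightarrow> real"
  assumes add: "\<And>r s. g (r + s) = g r + g s"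
  shows "g (of_int k) = of_int k * g 1"
proof -
  have 0: "g 0 = 0" using add[of 0 0] by simp
  have m: "g (- r) = - g r" for r using add[of r "- r"] 0 by simp
  have n: "g (of_nat n) = of_nat n * g 1" for n
    by (induction n) (auto simp: 0 add algebra_simps)
  show ?thesis
    by (cases k rule: int_cases2) (auto simp: n m)
qed

text \<open>The defect \<open>d\<close> from linearity is additive and vanishes on the integers, so
  it has period 1 and is bounded by compactness of the unit interval. A bounded additive function is
  zero, since its value at \<open>n * r\<close> is \<open>n\<close> times that at
  \<open>r\<close>.\<close>

lemma continuous_additive_linear:
  fixes g :: "real \<Rightarrow> real"
  assumes cont: "continuous_on UNIV g" and add: "\<And>r s. g (r + s) = g r + g s"
  shows "g r = r * g 1"
proof -
  define d where "d r = g r - r * g 1" for r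
  have dadd: "d (r + s) = d r + d s" for r s by (simp add: d_def add algebra_simps)
  have "d (of_int k) = 0" for k by (simp add: d_def additive_of_int[OF add])
  then have per: "d r = d (frac r)" for r
    using dadd[of "frac r" "of_int \<lfloor>r\<rfloor>"] by (simp add: frac_def)
  have "continuous_on {0..1} d"
    unfolding d_def by (intro continuous_intros continuous_on_subset[OF cont]) auto
  then have "compact (d ` {0..1})" by (rule compact_continuous_image) simp
  then have "\<exists>B. \<forall>x\<in>{0..1}. \<bar>d x\<bar> \<le> B"
    by (auto dest!: compact_imp_bounded simp: bounded_iff)
  then obtain B where B: "\<And>x. x \<in> {0..1} \<Longrightarrow> \<bar>d x\<bar> \<le> B" by blast
  have bd: "\<bar>d r\<bar> \<le> B" for r
    using B[of "frac r"] per[of r] frac_lt_1[of r] by (simp add: less_imp_le)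
  have 0: "d 0 = 0" using dadd[of 0 0] by simp
  have n: "d (of_nat n * r) = of_nat n * d r" for n
    by (induction n) (auto simp: dadd algebra_simps 0)
  have "d r = 0"
  proof (rule ccontr)
    assume "d r \<noteq> 0"
    then obtain n where "real n * \<bar>d r\<bar> > B"
      using reals_Archimedean3[of "\<bar>d r\<bar>"] by auto
    then show False using bd[of "of_nat n * r"] n[of n] by (simp add: abs_mult)
  qed
  then show ?thesis by (simp add: d_def)
qed

text \<open>At \<open>r = pi / (a - b)\<close> the quotient of the two sides would be
  \<open>cis pi = - 1\<close>.\<close>

lemma cis_linear_unique:
  assumes "\<And>r. cis (r * a) = cis (r * b)"
  shows "a = b"
proof (rule ccontr)
  assume ne: "a \<noteq> b"
  have "pi / (a - b) * a - pi / (a - b) * b = pi / (a - b) * (a - b)"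
    by (simp only: right_diff_distrib)
  then have pi: "pi / (a - b) * a - pi / (a - b) * b = pi" using ne by simp
  have "cis (pi / (a - b) * a - pi / (a - b) * b) = 1"
    unfolding cis_divide[symmetric] by (simp only: assms) simp
  then show False unfolding pi by simp
qed

text \<open>The line is contractible, so \<open>f\<close> has a continuous logarithm. Its imaginary
  part, normalised to vanish at 0, is additive and therefore linear.\<close>

lemma continuous_circle_hom:
  fixes f :: "real \<Rightarrow> complex"
  assumes cont: "continuous_on UNIV f" and nf: "\<And>r. norm (f r) = 1"
    and mult: "\<And>r s. f (r + s) = f r * f s"
  obtains y where "\<And>r. f r = cis (r * y)"
proof -
  have "f z \<noteq> 0" for z using nf[of z] by auto
  then obtain g where g: "continuous_on UNIV g" "\<And>x. f x = exp (g x)"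
    using continuous_logarithm_on_contractible[OF cont] convex_imp_contractible[OF convex_UNIV] by auto
  define a where "a = (\<lambda>r. Im (g r))"
  have ca: "continuous_on UNIV a" unfolding a_def by (intro continuous_intros g)
  have fa: "f r = cis (a r)" for r
  proof -
    have "exp (Re (g r)) = 1" using nf[of r] unfolding g(2) by simp
    then show ?thesis unfolding g(2) exp_eq_polar a_def by simp
  qed
  have f0: "f 0 = 1" using mult[of 0 0] nf[of 0] by auto
  define A where "A r = a r - a 0" for r
  have cA: "continuous_on UNIV A" unfolding A_def by (intro continuous_intros ca)
  have fA: "f r = cis (A r)" for r
    using fa[of r] fa[of 0] f0 by (metis A_def cis_divide div_by_1)
  have add: "A (r + s) = A r + A s" for r s
  proof -
    \<comment> \<open>For fixed \<open>s\<close> the additivity defect of \<open>A\<close>, in units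
      of \<open>2 * pi\<close>, is continuous and integer-valued in \<open>r\<close>; hence it is
      constant, and it vanishes at 0.\<close>
    define D where "D r = (A (r + s) - A r - A s) / (2 * pi)" for r
    have "cis (A (r + s) - A r - A s) = 1" for r
      using mult[of r s] unfolding fA by (simp flip: cis_divide)
    then have D: "\<exists>k. D r = of_int k" for r
      using cos_one_2pi_int[of "A (r + s) - A r - A s"]
      by (auto simp: D_def complex_eq_iff field_simps)
    have "continuous_on UNIV D"
      unfolding D_def by (intro continuous_intros continuous_on_compose2[OF cA]) auto
    have "D constant_on UNIV"
    proof (rule continuous_discrete_range_constant[of UNIV D, OF connected_UNIV \<open>continuous_on UNIV D\<close>])
      fix x
      have "1 \<le> norm (D y - D x)" if "D y \<noteq> D x" for y
        using D[of x] D[of y] that by (auto simp flip: of_int_diff)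
      then show "\<exists>e>0. \<forall>y. y \<in> UNIV \<and> D y \<noteq> D x \<longrightarrow> e \<le> norm (D y - D x)"
        by (intro exI[of _ 1]) auto
    qed
    then have "D r = D 0" unfolding constant_on_def by auto
    then show ?thesis by (simp add: D_def A_def)
  qed
  show ?thesis
  proof (rule that)
    show "f r = cis (r * A 1)" for r
      unfolding fA by (rule arg_cong[OF continuous_additive_linear[OF cA add]])
  qed
qed

section \<open>Joint continuity and the compact-open topology\<close>

lemma continuous_on_compact_param:
  fixes f :: "'a::topological_space \<Rightarrow> 'b::topological_space \<Rightarrow> 'c::metric_space"
  assumes "continuous_on UNIV (\<lambda>(x, t). f x t)" "compact C" "e > 0"
  shows "\<exists>X. x0 \<in> X \<and> open X \<and> (\<forall>x\<in>X. \<forall>t\<in>C. dist (f x t) (f x0 t) \<le> e)"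
proof -
  have "continuous_on (UNIV \<times> C) (\<lambda>(x, t). f x t)"
    using assms(1) by (rule continuous_on_subset) auto
  then show ?thesis
  proof (rule continuous_on_prod_compactE[of UNIV C _ x0 e])
    fix X assume "x0 \<in> X" "open X"
      "\<forall>x\<in>X \<inter> UNIV. \<forall>t\<in>C. dist (case (x, t) of (x, t) \<Rightarrow> f x t) (case (x0, t) of (x, t) \<Rightarrow> f x t) \<le> e"
    then show ?thesis by (intro exI[of _ X]) simp
  qed (use assms in auto)
qed

text \<open>If \<open>a x\<close> differed from \<open>a x0\<close> by at least \<open>e\<close>,
  then at some time \<open>r\<close> in \<open>{0..pi / e}\<close> the values \<open>E x r\<close>
  and \<open>E x0 r\<close> would be antipodal, at distance 2. Closeness up to 1, uniform over this
  compact interval, excludes that.\<close>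

lemma continuous_exponent:
  fixes a :: "'a::topological_space \<Rightarrow> real"
  assumes cont: "continuous_on UNIV (\<lambda>(x, r). E x r)" and E: "\<And>x r. E x r = cis (r * a x)"
  shows "continuous_on UNIV a"
  unfolding continuous_on_def
proof (intro ballI tendstoI)
  fix x0 :: 'a and e :: real assume e: "e > 0"
  define R where "R = pi / e"
  obtain X0 where X0: "x0 \<in> X0" "open X0"
    and le: "\<And>x t. x \<in> X0 \<Longrightarrow> t \<in> {0..R} \<Longrightarrow> dist (E x t) (E x0 t) \<le> 1"
    using continuous_on_compact_param[OF cont compact_Icc, of 1 x0 0 R] by auto
  have "dist (a x) (a x0) < e" if "x \<in> X0" for x
  proof (rule ccontr)
    define b where "b = a x - a x0"
    assume "\<not> dist (a x) (a x0) < e"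
    then have b: "\<bar>b\<bar> \<ge> e" by (simp add: dist_real_def b_def)
    define r where "r = pi / \<bar>b\<bar>"
    have r: "r \<in> {0..R}" using b e by (auto simp: r_def R_def intro!: divide_left_mono)
    have "cis (r * a x) = cis (r * a x0) * cis (r * b)"
      by (simp add: cis_mult b_def algebra_simps)
    moreover have "cis (r * b) = -1"
    proof (cases "b \<ge> 0")
      case True
      then have "r * b = pi" using b e by (simp add: r_def)
      then show ?thesis by simp
    next
      case False
      then have "r * b = - pi" using b e by (simp add: r_def)
      then show ?thesis by (simp flip: cis_cnj)
    qed
    ultimately have "E x r - E x0 r = - 2 * cis (r * a x0)"
      unfolding E by (simp add: algebra_simps)
    then have "dist (E x r) (E x0 r) = norm (- 2 * cis (r * a x0))"
      unfolding dist_norm by simp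
    also have "\<dots> = 2" unfolding norm_mult by simp
    finally show False using le[OF that r] by simp
  qed
  then show "\<forall>\<^sub>F x in at x0 within UNIV. dist (a x) (a x0) < e"
    using X0 unfolding eventually_at_topological by blast
qed

text \<open>The topology of the dual controls characters uniformly on compact sets, so the point
  \<open>s0\<close> needs a compact neighbourhood on which \<open>c0\<close> varies by less than
  \<open>e / 2\<close>. This is where local compactness enters.\<close>

lemma continuous_on_char_of:
  assumes lc: "locally compact (UNIV :: 'g::{topological_ab_group_add} set)"
  shows "continuous_on UNIV (\<lambda>(c, s :: 'g). char_of c s)"
  unfolding continuous_on_def
proof (intro ballI tendstoI)
  fix x :: "'g dual \<times> 'g" and e :: real assume e: "e > 0"
  obtain c0 s0 where x: "x = (c0, s0)" by (cases x)
  define W where "W = char_of c0 -` ball (char_of c0 s0) (e / 2)"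
  have "open W" unfolding W_def using char_of_cont[of c0]
    by (intro open_vimage) auto
  moreover have "s0 \<in> W" using e by (simp add: W_def)
  ultimately obtain U K where U: "open U" "compact K" "s0 \<in> U" "U \<subseteq> K" "K \<subseteq> W"
    using locallyE[OF lc, of W s0] by auto
  have "\<forall>\<^sub>F c in nhds c0. \<forall>s\<in>K. dist (char_of c s) (char_of c0 s) < e / 2"
    unfolding eventually_nhds_dual using U e by (intro exI[of _ K] exI[of _ "e / 2"]) auto
  moreover have "\<forall>\<^sub>F s in nhds s0. s \<in> U" using U by (auto simp: eventually_nhds)
  ultimately have "\<forall>\<^sub>F p in nhds c0 \<times>\<^sub>F nhds s0. dist (char_of (fst p) (snd p)) (char_of c0 s0) < e"
  proof (rule eventually_prodI[THEN eventually_mono])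
    fix p :: "'g dual \<times> 'g"
    assume p: "(\<forall>s\<in>K. dist (char_of (fst p) s) (char_of c0 s) < e / 2) \<and> snd p \<in> U"
    then have "dist (char_of (fst p) (snd p)) (char_of c0 (snd p)) < e / 2" using U by auto
    moreover have "dist (char_of c0 (snd p)) (char_of c0 s0) < e / 2"
      using p U by (auto simp: W_def dist_commute)
    ultimately show "dist (char_of (fst p) (snd p)) (char_of c0 s0) < e"
      using dist_triangle[of "char_of (fst p) (snd p)" "char_of c0 s0" "char_of c0 (snd p)"] by argo
  qed
  then show "\<forall>\<^sub>F p in at x within UNIV. dist (case p of (c, s) \<Rightarrow> char_of c s)
      (case x of (c, s) \<Rightarrow> char_of c s) < e"
    unfolding x nhds_prod[symmetric] eventually_at_filter by (rule eventually_mono) auto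
qed

lemma continuous_on_char_of_compose:
  assumes "locally compact (UNIV :: 'g::topological_ab_group_add set)"
    and "continuous_on S f" "continuous_on S (g :: _ \<Rightarrow> 'g)"
  shows "continuous_on S (\<lambda>x. char_of (f x) (g x))"
  using continuous_on_compose2[OF continuous_on_char_of[OF assms(1)], of S "\<lambda>x. (f x, g x)"] assms
  by (auto intro!: continuous_intros)

text \<open>The compact-open topology asks for uniform closeness on compact sets, which joint
  continuity supplies.\<close>

lemma continuous_on_dualI:
  fixes Q :: "'x::topological_space \<Rightarrow> 'g::topological_ab_group_add dual"
  assumes "continuous_on UNIV (\<lambda>(x, s). char_of (Q x) s)"
  shows "continuous_on UNIV Q"
  unfolding continuous_on_def
proof (intro ballI)
  fix x0 :: 'x
  show "(Q \<longlongrightarrow> Q x0) (at x0 within UNIV)"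
    unfolding filterlim_iff
  proof (intro allI impI)
    fix P assume "eventually P (nhds (Q x0))"
    then obtain K e where K: "compact K" "e > 0"
      and P: "\<And>d. (\<forall>s\<in>K. dist (char_of d s) (char_of (Q x0) s) < e) \<Longrightarrow> P d"
      unfolding eventually_nhds_dual by blast
    obtain X0 where "x0 \<in> X0" "open X0"
      and le: "\<And>x t. x \<in> X0 \<Longrightarrow> t \<in> K \<Longrightarrow> dist (char_of (Q x) t) (char_of (Q x0) t) \<le> e / 2"
      using continuous_on_compact_param[OF assms K(1), of "e / 2" x0] K(2) by auto
    moreover have "P (Q x)" if "x \<in> X0" for x
    proof (rule P, rule ballI)
      show "dist (char_of (Q x) s) (char_of (Q x0) s) < e" if "s \<in> K" for s
        using le[OF \<open>x \<in> X0\<close> that] K(2) by linarith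
    qed
    ultimately show "\<forall>\<^sub>F x in at x0 within UNIV. P (Q x)"
      unfolding eventually_at_topological by blast
  qed
qed

section \<open>Exponents of one-parameter subgroups\<close>

text \<open>\<open>freq \<phi> c\<close> is meaningful only for a one-parameter subgroup \<open>\<phi>\<close>; the choice is arbitrary otherwise.\<close>

definition freq :: "(real \<Rightarrow> 'g::topological_ab_group_add) \<Rightarrow> 'g dual \<Rightarrow> real" where
  "freq \<phi> c = (SOME y. \<forall>r. char_of c (\<phi> r) = cis (r * y))"

lemma char_of_one_param:
  assumes "\<phi> \<in> one_param_subgroups"
  shows "char_of c (\<phi> r) = cis (r * freq \<phi> c)"
proof -
  have "continuous_on UNIV (\<lambda>r. char_of c (\<phi> r))"
    by (rule continuous_on_compose2[OF char_of_cont one_paramD(1)[OF assms]]) auto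
  then obtain y where "\<And>r. char_of c (\<phi> r) = cis (r * y)"
    by (rule continuous_circle_hom) (auto simp: one_paramD(2)[OF assms] char_of_add)
  then have "\<exists>y. \<forall>r. char_of c (\<phi> r) = cis (r * y)" by blast
  from someI_ex[OF this] show ?thesis unfolding freq_def by blast
qed

lemma freqI:
  assumes "\<phi> \<in> one_param_subgroups" "\<And>r. char_of c (\<phi> r) = cis (r * y)"
  shows "freq \<phi> c = y"
  using cis_linear_unique[of "freq \<phi> c" y] assms(2) char_of_one_param[OF assms(1)] by metis

text \<open>These exponents serve as coordinates of the dual: its weight is built from
  \<open>freq (e i)\<close> and \<open>freq (\<tau> j)\<close>.\<close>

lemma freq_real_hom:
  assumes lc: "locally compact (UNIV :: 'g::topological_ab_group_add set)"
    and \<phi>: "(\<phi> :: real \<Rightarrow> 'g) \<in> one_param_subgroups"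
  shows "freq \<phi> \<in> real_homs"
proof -
  have "continuous_on UNIV (\<lambda>(c, r). char_of c (\<phi> r))"
    unfolding case_prod_unfold
    by (intro continuous_on_char_of_compose[OF lc] continuous_on_compose2[OF one_paramD(1)[OF \<phi>]]
        continuous_intros) auto
  then have "continuous_on UNIV (freq \<phi>)"
    by (rule continuous_exponent) (rule char_of_one_param[OF \<phi>])
  moreover have "freq \<phi> (c + d) = freq \<phi> c + freq \<phi> d" for c d
    by (intro freqI \<phi>) (simp only: char_of_plus_dual, simp only: char_of_one_param[OF \<phi>] cis_mult distrib_left)
  ultimately show ?thesis by (simp add: real_homs_def)
qed

text \<open>Differentiating \<open>char_of (\<phi> r) s\<close> in \<open>r\<close> produces the
  factor \<open>\<i> * h s\<close>, so a derivative along the dual acts on Fourier integrals as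
  multiplication by \<open>h\<close> under the integral sign, up to a scalar.\<close>

lemma dual_one_param:
  assumes lc: "locally compact (UNIV :: 'g::topological_ab_group_add set)"
    and \<phi>: "(\<phi> :: real \<Rightarrow> 'g dual) \<in> one_param_subgroups"
  obtains h where "h \<in> real_homs" "\<And>r s. char_of (\<phi> r) s = cis (r * h s)"
proof -
  have cE: "continuous_on UNIV (\<lambda>(s, r). char_of (\<phi> r) s)"
    unfolding case_prod_unfold
    by (intro continuous_on_char_of_compose[OF lc] continuous_on_compose2[OF one_paramD(1)[OF \<phi>]]
        continuous_intros) auto
  have "\<exists>y. \<forall>r. char_of (\<phi> r) s = cis (r * y)" for s
  proof -
    have "continuous_on UNIV (\<lambda>r. char_of (\<phi> r) s)"
      by (intro continuous_on_char_of_compose[OF lc] one_paramD(1)[OF \<phi>] continuous_intros)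
    then show ?thesis
      by (rule continuous_circle_hom) (auto simp: one_paramD(2)[OF \<phi>])
  qed
  then obtain h where h: "\<And>r s. char_of (\<phi> r) s = cis (r * h s)" by metis
  have "h \<in> real_homs"
    unfolding real_homs_def
  proof (intro CollectI conjI allI)
    show "continuous_on UNIV h" using cE h by (rule continuous_exponent)
    show "h (s + t) = h s + h t" for s t
    proof (rule cis_linear_unique)
      show "cis (r * h (s + t)) = cis (r * (h s + h t))" for r
        using char_of_add[of "\<phi> r" s t] by (simp add: h cis_mult algebra_simps)
    qed
  qed
  with h that show ?thesis by blast
qed

text \<open>Meaningful for a real homomorphism \<open>h\<close>; the multiples \<open>r * h\<close>
  then trace out a one-parameter subgroup of the dual.\<close>

definition exp_char :: "('g::topological_ab_group_add \<Rightarrow> real) \<Rightarrow> 'g dual" where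
  "exp_char h = Dual (\<lambda>s. cis (h s))"

lemma char_of_exp_char:
  assumes "h \<in> real_homs"
  shows "char_of (exp_char h) s = cis (h s)"
  unfolding exp_char_def using assms
  by (subst Dual_inverse) (auto simp: real_homs_def cis_mult intro!: continuous_intros)

lemma real_homs_scale: "h \<in> real_homs \<Longrightarrow> (\<lambda>s. r * h s) \<in> real_homs"
  by (auto simp: real_homs_def algebra_simps intro!: continuous_intros)

lemma exp_char_one_param:
  assumes "h \<in> real_homs"
  shows "(\<lambda>r. exp_char (\<lambda>s. r * h s)) \<in> one_param_subgroups"
  unfolding one_param_subgroups_def
proof (intro CollectI conjI allI)
  note * = char_of_exp_char[OF real_homs_scale[OF assms]]
  have "continuous_on UNIV (\<lambda>x. h (snd x))" 
    by (intro continuous_on_compose2[OF real_homsD(1)[OF assms]] continuous_intros) auto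
  then show "continuous_on UNIV (\<lambda>r. exp_char (\<lambda>s. r * h s))"
    by (intro continuous_on_dualI) (auto simp: case_prod_unfold * intro!: continuous_intros)
  show "exp_char (\<lambda>s. (r + r') * h s) = exp_char (\<lambda>s. r * h s) + exp_char (\<lambda>s. r' * h s)" for r r'
    by (rule dual_eqI) (simp only: char_of_plus_dual *, simp add: cis_mult algebra_simps)
qed

section \<open>Measurability on products\<close>

text \<open>For a basis set \<open>b\<close>, \<open>U b\<close> is the largest open set such that
  \<open>U b \<times> b\<close> lies inside \<open>W\<close>. These rectangles exhaust
  \<open>W\<close>, and there are countably many of them as soon as one factor has a countable
  basis.\<close>

lemma sets_pair_open:
  fixes W :: "('a::topological_space \<times> 'b::topological_space) set"
  assumes B: "countable B" "topological_basis (B :: 'b set set)" and W: "open W"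
  shows "W \<in> sets (borel \<Otimes>\<^sub>M borel)"
proof -
  define U where "U b = \<Union>{U. open U \<and> U \<times> b \<subseteq> W}" for b
  have "W = (\<Union>b\<in>B. U b \<times> b)"
  proof (intro set_eqI iffI)
    fix p assume p: "p \<in> W"
    obtain S T where ST: "open S" "open T" "p \<in> S \<times> T" "S \<times> T \<subseteq> W"
      using open_prod_elim[OF W p] by blast
    obtain b where "b \<in> B" "snd p \<in> b" "b \<subseteq> T"
      using topological_basisE[OF B(2) ST(2), of "snd p"] ST(3) by (auto simp: mem_Times_iff)
    with ST show "p \<in> (\<Union>b\<in>B. U b \<times> b)"
      unfolding U_def by (intro UN_I[of b]) (auto simp: mem_Times_iff subset_iff)
  next
    fix p assume "p \<in> (\<Union>b\<in>B. U b \<times> b)"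
    then show "p \<in> W" unfolding U_def by auto
  qed
  also have "\<dots> \<in> sets (borel \<Otimes>\<^sub>M borel)"
  proof (rule sets.countable_UN'[OF B(1)], rule image_subsetI)
    fix b assume "b \<in> B"
    then show "U b \<times> b \<in> sets (borel \<Otimes>\<^sub>M borel)"
      using B(2) by (intro pair_measureI borel_open open_Union) (auto simp: U_def topological_basis_open)
  qed
  finally show ?thesis .
qed

lemma borel_measurable_pair_continuous:
  fixes f :: "'a::topological_space \<times> 'b::topological_space \<Rightarrow> 'c::topological_space"
  assumes B: "countable B" "topological_basis (B :: 'b set set)" and f: "continuous_on UNIV f"
  shows "f \<in> borel_measurable (borel \<Otimes>\<^sub>M borel)"
proof (rule borel_measurableI)
  fix S :: "'c set" assume "open S"
  then have "open (f -` S)" using f by (rule open_vimage)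
  with sets_pair_open[OF B] show "f -` S \<inter> space (borel \<Otimes>\<^sub>M borel) \<in> sets (borel \<Otimes>\<^sub>M borel)"
    by (simp add: space_pair_measure)
qed

lemma borel_measurable_pair_continuous_sc:
  fixes f :: "'a::topological_space \<times> 'b::second_countable_topology \<Rightarrow> 'c::topological_space"
  assumes "continuous_on UNIV f"
  shows "f \<in> borel_measurable (borel \<Otimes>\<^sub>M borel)"
  using borel_measurable_pair_continuous assms ex_countable_basis[where 'a = 'b] by metis

text \<open>A basic set imposes finitely many conditions, each that a character map the compact
  closure of a basis set of the group into a basis set of the plane. Such a condition is open
  because a compact set inside an open one has a uniform margin. The result makes subtraction on the
  dual measurable for the product sigma-algebra.\<close>

lemma dual_countable_basis:
  assumes lc: "locally compact (UNIV :: 'g::{topological_ab_group_add, t2_space, second_countable_topology} set)"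
  shows "\<exists>B :: 'g dual set set. countable B \<and> topological_basis B"
proof -
  obtain BG :: "'g set set" where BG: "countable BG" "topological_basis BG"
    using ex_countable_basis by blast
  obtain BC :: "complex set set" where BC: "countable BC" "topological_basis BC"
    using ex_countable_basis by blast
  define R where "R = {U \<in> BG. compact (closure U)}"
  define N where "N T = {c :: 'g dual. \<forall>(U, V) \<in> T. char_of c ` closure U \<subseteq> V}" for T
  define B where "B = N ` {T. finite T \<and> T \<subseteq> R \<times> BC}"
  have "countable (R \<times> BC)"
    using BG BC by (auto simp: R_def)
  then have "countable B"
    unfolding B_def by (intro countable_image countable_Collect_finite_subset)
  moreover have "topological_basis B"
  proof (rule topological_basisI)
    fix b assume "b \<in> B"
    then obtain T where T: "finite T" "T \<subseteq> R \<times> BC" "b = N T" by (auto simp: B_def)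
    have "open {c :: 'g dual. char_of c ` closure U \<subseteq> V}" if UV: "(U, V) \<in> T" for U V
      unfolding open_dual_def
    proof
      fix c :: "'g dual" assume c: "c \<in> {c. char_of c ` closure U \<subseteq> V}"
      have K: "compact (closure U)" and V: "open V"
        using UV T BC by (auto simp: R_def topological_basis_open)
      have "compact (char_of c ` closure U)"
        using K by (intro compact_continuous_image continuous_on_subset[OF char_of_cont]) auto
      then obtain e where e: "e > 0" "(\<Union>y\<in>char_of c ` closure U. ball y e) \<subseteq> V"
        using compact_subset_open_imp_ball_epsilon_subset[OF _ V] c by blast
      then have "{d. \<forall>s\<in>closure U. dist (char_of d s) (char_of c s) < e} \<subseteq> {c. char_of c ` closure U \<subseteq> V}"
        by (force simp: dist_commute)
      then show "\<exists>K e. compact K \<and> e > 0 \<and>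
          {d. \<forall>s\<in>K. dist (char_of d s) (char_of c s) < e} \<subseteq> {c. char_of c ` closure U \<subseteq> V}"
        using K e by blast
    qed
    then have "open (\<Inter>p\<in>T. {c :: 'g dual. char_of c ` closure (fst p) \<subseteq> snd p})"
      using T by (intro open_INT) auto
    also have "(\<Inter>p\<in>T. {c :: 'g dual. char_of c ` closure (fst p) \<subseteq> snd p}) = b"
      unfolding T(3) N_def case_prod_unfold by blast
    finally show "open b" .
  next
    fix O' and c :: "'g dual" assume O: "open O'" "c \<in> O'"
    then obtain K e where K: "compact K" "e > 0"
      and sub: "{d. \<forall>s\<in>K. dist (char_of d s) (char_of c s) < e} \<subseteq> O'"
      unfolding open_dual_def by (auto dest!: bspec)
    \<comment> \<open>Every point has a relatively compact basis neighbourhood whose closure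
      \<open>c\<close> maps into a basis set of diameter at most \<open>e\<close>. Finitely many of
      these neighbourhoods cover \<open>K\<close> and make up \<open>T\<close>.\<close>
    have "\<exists>U V. U \<in> R \<and> V \<in> BC \<and> s \<in> U \<and> char_of c ` closure U \<subseteq> V \<and> V \<subseteq> ball (char_of c s) (e / 2)" for s
    proof -
      obtain V where V: "V \<in> BC" "char_of c s \<in> V" "V \<subseteq> ball (char_of c s) (e / 2)"
        using topological_basisE[OF BC(2), of "ball (char_of c s) (e / 2)" "char_of c s"] K by auto
      have "open (char_of c -` V)"
        using V BC char_of_cont by (intro open_vimage) (auto simp: topological_basis_open)
      then obtain U' K' where U': "open U'" "compact K'" "s \<in> U'" "U' \<subseteq> K'" "K' \<subseteq> char_of c -` V"
        using locallyE[OF lc, of "char_of c -` V" s] V by auto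
      obtain U where U: "U \<in> BG" "s \<in> U" "U \<subseteq> U'"
        using topological_basisE[OF BG(2) U'(1) U'(3)] by blast
      have "closure U \<subseteq> K'"
        using U U' by (intro closure_minimal compact_imp_closed) auto
      moreover from this have "compact (closure U)"
        using U'(2) by (metis closed_closure compact_Int_closed inf.absorb_iff2)
      ultimately show ?thesis using U U' V unfolding R_def by blast
    qed
    then obtain U V where UV: "\<And>s. U s \<in> R" "\<And>s. V s \<in> BC" "\<And>s. s \<in> U s"
      "\<And>s. char_of c ` closure (U s) \<subseteq> V s" "\<And>s. V s \<subseteq> ball (char_of c s) (e / 2)"
      by metis
    have "open (U s)" for s using UV(1) BG by (auto simp: R_def topological_basis_open)
    then obtain C where C: "C \<subseteq> K" "finite C" "K \<subseteq> (\<Union>s\<in>C. U s)"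
      by (rule compactE_image[OF K(1), of K U]) (use UV(3) in auto)
    define T where "T = (\<lambda>s. (U s, V s)) ` C"
    have "N T \<in> B" unfolding B_def T_def using C UV by auto
    moreover have "c \<in> N T" unfolding N_def T_def using UV by auto
    moreover have "N T \<subseteq> O'"
    proof
      fix d assume d: "d \<in> N T"
      have "dist (char_of d s) (char_of c s) < e" if "s \<in> K" for s
      proof -
        obtain s' where s': "s' \<in> C" "s \<in> U s'" using C \<open>s \<in> K\<close> by blast
        then have s: "s \<in> closure (U s')" using closure_subset by blast
        then have "char_of d s \<in> V s'" "char_of c s \<in> V s'"
          using d s' UV(4)[of s'] unfolding N_def T_def by auto
        then have "dist (char_of c s') (char_of d s) < e / 2" "dist (char_of c s') (char_of c s) < e / 2"
          using UV(5)[of s'] by auto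
        then show ?thesis by (metis dist_commute dist_triangle_half_r)
      qed
      then show "d \<in> O'" using sub by blast
    qed
    ultimately show "\<exists>B'\<in>B. c \<in> B' \<and> B' \<subseteq> O'" by blast
  qed
  ultimately show ?thesis by blast
qed

section \<open>Haar measures\<close>

lemma haar_measureD:
  assumes "haar_measure M"
  shows "sets M = sets borel" "space M = UNIV" "measurable M N = measurable borel N"
    "measurable N M = measurable N borel"
    "distr M borel (\<lambda>x. a + x) = M" "compact K \<Longrightarrow> emeasure M K < \<infinity>"
    "open U \<Longrightarrow> U \<noteq> {} \<Longrightarrow> emeasure M U > 0"
proof -
  show s: "sets M = sets borel" "distr M borel (\<lambda>x. a + x) = M"
    "compact K \<Longrightarrow> emeasure M K < \<infinity>" "open U \<Longrightarrow> U \<noteq> {} \<Longrightarrow> emeasure M U > 0"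
    using assms by (auto simp: haar_measure_def)
  show "space M = UNIV" using sets_eq_imp_space_eq[OF s(1)] by simp
  show "measurable M N = measurable borel N" "measurable N M = measurable N borel"
    by (rule measurable_cong_sets[OF s(1) refl], rule measurable_cong_sets[OF refl s(1)])
qed

lemma measurable_translate: "(\<lambda>x. (a :: 'a::topological_monoid_add) + x) \<in> borel_measurable borel"
  by (intro borel_measurable_continuous_onI continuous_intros)

lemma haar_nn_integral_translate:
  assumes "haar_measure M" and f: "f \<in> borel_measurable borel"
  shows "(\<integral>\<^sup>+x. f (x + a) \<partial>M) = (\<integral>\<^sup>+x. f x \<partial>M)"
proof -
  note M = haar_measureD[OF assms(1)]
  have "(\<integral>\<^sup>+x. f x \<partial>M) = (\<integral>\<^sup>+x. f x \<partial>distr M borel (\<lambda>x. a + x))" by (simp only: M)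
  also have "\<dots> = (\<integral>\<^sup>+x. f (a + x) \<partial>M)"
    using f by (intro nn_integral_distr) (auto simp: M intro: measurable_translate)
  finally show ?thesis by (simp add: add.commute)
qed

lemma haar_integral_translate:
  fixes f :: "_ \<Rightarrow> complex"
  assumes "haar_measure M" and f: "f \<in> borel_measurable borel"
  shows "(LINT x|M. f (x + a)) = (LINT x|M. f x)"
    and "integrable M (\<lambda>x. f (x + a)) \<longleftrightarrow> integrable M f"
proof -
  note M = haar_measureD[OF assms(1)]
  have t: "(\<lambda>x. a + x) \<in> measurable M borel" unfolding M by (rule measurable_translate)
  have "(LINT x|M. f x) = (LINT x|distr M borel (\<lambda>x. a + x). f x)" by (simp only: M)
  also have "\<dots> = (LINT x|M. f (a + x))" using t f by (rule integral_distr)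
  finally show "(LINT x|M. f (x + a)) = (LINT x|M. f x)" by (simp add: add.commute)
  have "integrable M f \<longleftrightarrow> integrable (distr M borel (\<lambda>x. a + x)) f" by (simp only: M)
  also have "\<dots> \<longleftrightarrow> integrable M (\<lambda>x. f (a + x))" using t f by (rule integrable_distr_eq)
  finally show "integrable M (\<lambda>x. f (x + a)) \<longleftrightarrow> integrable M f" by (simp add: add.commute)
qed

text \<open>The sets where \<open>w\<close> is at least \<open>1 / n\<close> exhaust the space and
  have finite measure by Markov's inequality.\<close>

lemma sigma_finite_posI:
  assumes w: "w \<in> borel_measurable M" "\<And>x. x \<in> space M \<Longrightarrow> 0 < w x" "(\<integral>\<^sup>+x. w x \<partial>M) < \<infinity>"
  shows "sigma_finite_measure M"
proof
  define A where "A n = {x \<in> space M. 1 \<le> of_nat n * w x}" for n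
  have A: "A n \<in> sets M" for n unfolding A_def using w(1) by measurable
  have "emeasure M (A n) \<le> of_nat n * (\<integral>\<^sup>+x. w x \<partial>M)" for n
  proof -
    have "A n = {x \<in> space M. 1 \<le> of_nat n * w x} \<inter> space M" by (auto simp: A_def)
    then show ?thesis
      using nn_integral_Markov_inequality[of w "space M" M "of_nat n"] w(1)
      unfolding A_def by (auto simp: nn_set_integral_space cong: conj_cong)
  qed
  then have "emeasure M (A n) \<noteq> \<infinity>" for n
    using w(3) by (metis ennreal_mult_less_top infinity_ennreal_def leD less_top of_nat_less_top)
  moreover have "(\<Union>n. A n) = space M"
  proof safe
    fix x assume x: "x \<in> space M"
    have "\<exists>n. 1 \<le> of_nat n * w x"
    proof (cases "w x")
      case (real r)
      with w(2)[OF x] have "r > 0" by simp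
      then obtain n where "1 < real n * r" using reals_Archimedean3[of r] by blast
      then have "1 \<le> of_nat n * w x"
        unfolding real(2) ennreal_of_nat_eq_real_of_nat ennreal_1[symmetric]
        using \<open>r > 0\<close> by (subst ennreal_mult[symmetric]) (auto intro!: ennreal_leI simp del: ennreal_1)
      then show ?thesis ..
    next
      case top then show ?thesis by (intro exI[of _ 1]) auto
    qed
    with x show "x \<in> (\<Union>n. A n)" by (auto simp: A_def)
  qed (auto simp: A_def)
  ultimately show "\<exists>A. countable A \<and> A \<subseteq> sets M \<and> \<Union>A = space M \<and> (\<forall>a\<in>A. emeasure M a \<noteq> \<infinity>)"
    using A by (intro exI[of _ "range A"]) auto
qed

text \<open>Integrate \<open>f x * g (x - y)\<close> in both orders. Translation in \<open>y\<close>
  gives the integral of \<open>f\<close> times that of \<open>g (- y)\<close>; translation in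
  \<open>x\<close>, followed by one in \<open>y\<close>, gives the integral of \<open>f\<close>
  times that of \<open>g\<close>. The auxiliary \<open>f\<close> has a positive finite integral, so
  it cancels.\<close>

lemma haar_nn_integral_uminus:
  fixes M :: "'a::topological_ab_group_add measure"
  assumes "haar_measure M" "sigma_finite_measure M"
    and diff: "(\<lambda>(x, y). x - y :: 'a) \<in> borel_measurable (borel \<Otimes>\<^sub>M borel)"
    and f: "f \<in> borel_measurable borel" "0 < (\<integral>\<^sup>+x. f x \<partial>M)" "(\<integral>\<^sup>+x. f x \<partial>M) < \<infinity>"
    and g: "g \<in> borel_measurable borel"
  shows "(\<integral>\<^sup>+x. g (- x) \<partial>M) = (\<integral>\<^sup>+x. g x \<partial>M)"
proof -
  note M = haar_measureD[OF assms(1)]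
  interpret pair_sigma_finite M M using assms(2) by (simp add: pair_sigma_finite_def)
  have MM: "sets (M \<Otimes>\<^sub>M M) = sets (borel \<Otimes>\<^sub>M borel)" by (intro sets_pair_measure_cong M)
  have mMM: "borel_measurable (M \<Otimes>\<^sub>M M) = borel_measurable (borel \<Otimes>\<^sub>M borel)"
    by (rule measurable_cong_sets[OF MM refl])
  have um: "(\<lambda>x. - x :: 'a) \<in> borel_measurable borel"
    by (intro borel_measurable_continuous_onI continuous_intros)
  note [measurable] = f(1) g um
  have d1: "(\<lambda>p. fst p - snd p :: 'a) \<in> borel_measurable (borel \<Otimes>\<^sub>M borel)"
    using diff by (simp add: case_prod_unfold)
  have gd: "(\<lambda>p. g (fst p - snd p)) \<in> borel_measurable (borel \<Otimes>\<^sub>M borel)"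
    by (rule measurable_compose[OF d1 g])
  have m1: "(\<lambda>(x, y). f x * g (x - y)) \<in> borel_measurable (M \<Otimes>\<^sub>M M)"
    unfolding mMM case_prod_unfold using gd by measurable
  have d2: "(\<lambda>p. fst p + snd p :: 'a) \<in> borel_measurable (borel \<Otimes>\<^sub>M borel)"
  proof -
    have "(\<lambda>p. (fst p, - snd p)) \<in> measurable (borel \<Otimes>\<^sub>M borel) (borel \<Otimes>\<^sub>M (borel :: 'a measure))"
      by measurable
    from measurable_compose[OF this d1] show ?thesis by simp
  qed
  have fd: "(\<lambda>p. f (fst p + snd p)) \<in> borel_measurable (borel \<Otimes>\<^sub>M borel)"
    by (rule measurable_compose[OF d2 f(1)])
  have m2: "(\<lambda>(x, y). f (x + y) * g x) \<in> borel_measurable (M \<Otimes>\<^sub>M M)"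
    unfolding mMM case_prod_unfold using fd by measurable
  have fM [measurable]: "f \<in> borel_measurable M" and gM [measurable]: "g \<in> borel_measurable M"
    and uM: "(\<lambda>x. - x) \<in> borel_measurable M"
    using f g um by (auto simp: M)
  have gdx: "(\<lambda>y. g (x - y)) \<in> borel_measurable M" for x
    unfolding M by (intro measurable_compose[OF _ g] borel_measurable_continuous_onI continuous_intros)
  have fdx: "(\<lambda>y. f (x + y)) \<in> borel_measurable M" for x
    unfolding M by (intro measurable_compose[OF _ f(1)] borel_measurable_continuous_onI continuous_intros)
  have "(\<integral>\<^sup>+x. f x \<partial>M) * (\<integral>\<^sup>+y. g (- y) \<partial>M) = (\<integral>\<^sup>+x. f x * (\<integral>\<^sup>+y. g (- y) \<partial>M) \<partial>M)"
    by (rule nn_integral_multc[symmetric]) (rule fM)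
  also have "\<dots> = (\<integral>\<^sup>+x. f x * (\<integral>\<^sup>+y. g (x - y) \<partial>M) \<partial>M)"
  proof (rule nn_integral_cong)
    fix x :: 'a
    have "(\<lambda>y. g (- y)) \<in> borel_measurable borel" by measurable
    from haar_nn_integral_translate[OF assms(1) this, of "- x"]
    have "(\<integral>\<^sup>+y. g (- y) \<partial>M) = (\<integral>\<^sup>+y. g (x - y) \<partial>M)" by simp
    then show "f x * (\<integral>\<^sup>+y. g (- y) \<partial>M) = f x * (\<integral>\<^sup>+y. g (x - y) \<partial>M)" by (simp only:)
  qed
  also have "\<dots> = (\<integral>\<^sup>+x. \<integral>\<^sup>+y. f x * g (x - y) \<partial>M \<partial>M)"
    by (intro nn_integral_cong nn_integral_cmult[symmetric] gdx)
  also have "\<dots> = (\<integral>\<^sup>+y. \<integral>\<^sup>+x. f x * g (x - y) \<partial>M \<partial>M)"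
    by (rule Fubini'[OF m1, symmetric])
  also have "\<dots> = (\<integral>\<^sup>+y. \<integral>\<^sup>+x. f (x + y) * g x \<partial>M \<partial>M)"
  proof (rule nn_integral_cong)
    fix y
    have "(\<lambda>x. g (x - y)) \<in> borel_measurable borel"
      by (intro measurable_compose[OF _ g] borel_measurable_continuous_onI continuous_intros)
    then have "(\<lambda>x. f x * g (x - y)) \<in> borel_measurable borel" by measurable
    from haar_nn_integral_translate[OF assms(1) this, of y]
    show "(\<integral>\<^sup>+x. f x * g (x - y) \<partial>M) = (\<integral>\<^sup>+x. f (x + y) * g x \<partial>M)" by simp
  qed
  also have "\<dots> = (\<integral>\<^sup>+x. \<integral>\<^sup>+y. f (x + y) * g x \<partial>M \<partial>M)" by (rule Fubini'[OF m2])
  also have "\<dots> = (\<integral>\<^sup>+x. (\<integral>\<^sup>+y. f (x + y) \<partial>M) * g x \<partial>M)"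
    by (intro nn_integral_cong nn_integral_multc fdx)
  also have "\<dots> = (\<integral>\<^sup>+x. (\<integral>\<^sup>+y. f y \<partial>M) * g x \<partial>M)"
    using haar_nn_integral_translate[OF assms(1) f(1)] by (simp add: add.commute)
  also have "\<dots> = (\<integral>\<^sup>+y. f y \<partial>M) * (\<integral>\<^sup>+x. g x \<partial>M)"
    by (rule nn_integral_cmult) (rule gM)
  finally show ?thesis
    using f(2,3) by (auto simp: ennreal_mult_cancel_left)
qed

section \<open>Integrable weights\<close>

text \<open>A product rather than a sum of squares, so that the coordinates can be integrated one at
  a time; the exponent 2 makes the reciprocal of each factor summable over unit steps.\<close>

definition hom_weight :: "'i set \<Rightarrow> ('i \<Rightarrow> 'a \<Rightarrow> real) \<Rightarrow> 'a \<Rightarrow> real" where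
  "hom_weight I h s = (\<Prod>i\<in>I. 1 + (h i s)\<^sup>2)"

lemma hom_weight_ge_1: "1 \<le> hom_weight I h s"
  unfolding hom_weight_def by (rule prod_ge_1) simp

lemma hom_weight_pos: "0 < hom_weight I h s"
  using hom_weight_ge_1[of I h s] by linarith

lemma continuous_hom_weight:
  assumes "\<And>i. i \<in> I \<Longrightarrow> h i \<in> real_homs"
  shows "continuous_on UNIV (hom_weight I h)"
  unfolding hom_weight_def
  by (intro continuous_on_prod continuous_intros real_homsD(1) assms)

text \<open>A form of Peetre's inequality, taken factor by factor. It compares the weight at
  neighbouring points, which is what domination under the integral requires.\<close>

lemma hom_weight_translate:
  assumes "finite I" "\<And>i. i \<in> I \<Longrightarrow> h i \<in> real_homs"
  shows "hom_weight I h s \<le> 2 ^ card I * hom_weight I h (s + t) * hom_weight I h t"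
proof -
  have "1 + a\<^sup>2 \<le> 2 * (1 + (a + b)\<^sup>2) * (1 + b\<^sup>2)" for a b :: real
  proof -
    have "a\<^sup>2 \<le> 2 * (a + b)\<^sup>2 + 2 * b\<^sup>2"
      using sum_squares_bound[of "a + b" "- b"] by (simp add: power2_eq_square algebra_simps)
    moreover have "0 \<le> (a + b)\<^sup>2 * b\<^sup>2" by simp
    ultimately have "a\<^sup>2 \<le> 1 + 2 * (a + b)\<^sup>2 + 2 * b\<^sup>2 + 2 * ((a + b)\<^sup>2 * b\<^sup>2)" by linarith
    also have "\<dots> = 2 * (1 + (a + b)\<^sup>2) * (1 + b\<^sup>2) - 1" by algebra
    finally show ?thesis by simp
  qed
  then have "hom_weight I h s \<le> (\<Prod>i\<in>I. 2 * (1 + (h i (s + t))\<^sup>2) * (1 + (h i t)\<^sup>2))"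
    unfolding hom_weight_def by (intro prod_mono) (auto simp: real_homsD(2)[OF assms(2)] add_nonneg_nonneg)
  then show ?thesis unfolding hom_weight_def by (simp only: prod.distrib prod_constant)
qed

text \<open>Cutting along the level sets of \<open>h\<close> and translating by multiples of \<open>a\<close> compares the integral with that
  over \<open>0 \<le> h < 1\<close>.\<close>

lemma nn_integral_weight_step:
  assumes M: "haar_measure M" and h: "h \<in> real_homs" "h a = 1"
    and u: "u \<in> borel_measurable borel" "\<And>x. u (x + a) = u x"
    and fin: "(\<integral>\<^sup>+x. u x * indicator {x. 0 \<le> h x \<and> h x < 1} x \<partial>M) < \<infinity>"
  shows "(\<integral>\<^sup>+x. u x * ennreal (1 / (1 + (h x)\<^sup>2)) \<partial>M) < \<infinity>"
proof -
  note Md = haar_measureD[OF M]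
  have hm [measurable]: "h \<in> borel_measurable borel"
    by (rule borel_measurable_continuous_onI[OF real_homsD(1)[OF h(1)]])
  note [measurable] = u(1)
  define S where "S k = {x. of_int k \<le> h x \<and> h x < of_int k + 1}" for k
  have S [measurable]: "S k \<in> sets borel" for k unfolding S_def by measurable
  define J where "J k = (\<integral>\<^sup>+x. u x * indicator (S k) x \<partial>M)" for k
  have step: "J (k + 1) = J k" for k
  proof -
    have "J (k + 1) = (\<integral>\<^sup>+x. u (x + a) * indicator (S (k + 1)) (x + a) \<partial>M)"
      unfolding J_def by (rule haar_nn_integral_translate[OF M, symmetric]) measurable
    also have "\<dots> = J k"
      unfolding J_def by (intro nn_integral_cong) (auto simp: u(2) S_def indicator_def real_homsD(2)[OF h(1)] h(2))
    finally show ?thesis .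
  qed
  have J: "J k = J 0" for k
  proof (induction k rule: int_induct[where k = 0])
    case (step2 i) with step[of "i - 1"] show ?case by simp
  qed (simp_all add: step)
  have J0: "J 0 < \<infinity>" using fin by (simp add: J_def S_def)
  define c where "c m = 1 / (1 + (real m)\<^sup>2)" for m
  have sc: "summable c"
  proof (rule summable_comparison_test_ev)
    show "\<forall>\<^sub>F n in sequentially. norm (c n) \<le> 1 / real n ^ 2"
      using eventually_gt_at_top[of 0] by eventually_elim (auto simp: c_def intro!: divide_left_mono mult_pos_pos add_pos_nonneg)
    show "summable (\<lambda>n. 1 / real n ^ 2)" using inverse_power_summable[of 2, where 'a = real] by (simp add: inverse_eq_divide)
  qed
  have cpos: "c m \<ge> 0" for m by (simp add: c_def)
  \<comment> \<open>On the slabs \<open>S m\<close> and \<open>S (- m - 1)\<close>, mirror images of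
    each other about 0 up to end points, \<open>\<bar>h\<bar>\<close> is at least \<open>m\<close>,
    so the weight is at most \<open>c m\<close>. Over all \<open>m\<close> these slabs cover the
    group.\<close>
  define V where "V m x = (u x * indicator (S (int m)) x + u x * indicator (S (- int m - 1)) x) * ennreal (c m)" for m x
  have "(\<integral>\<^sup>+x. u x * ennreal (1 / (1 + (h x)\<^sup>2)) \<partial>M)
      \<le> (\<integral>\<^sup>+x. (\<Sum>m. V m x) \<partial>M)"
  proof (intro nn_integral_mono)
    fix x
    define k where "k = \<lfloor>h x\<rfloor>"
    define m where "m = (if k \<ge> 0 then nat k else nat (- k - 1))"
    have kx: "x \<in> S k" by (auto simp: S_def k_def)
    have mk: "k = int m \<or> k = - int m - 1" by (auto simp: m_def)
    have "(real m)\<^sup>2 \<le> (h x)\<^sup>2"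
    proof (rule abs_le_square_iff[THEN iffD1])
      show "\<bar>real m\<bar> \<le> \<bar>h x\<bar>"
        using mk kx by (auto simp: S_def)
    qed
    then have "1 / (1 + (h x)\<^sup>2) \<le> c m"
      unfolding c_def by (intro divide_left_mono) (auto intro!: mult_pos_pos add_pos_nonneg)
    then have "u x * ennreal (1 / (1 + (h x)\<^sup>2)) \<le> u x * ennreal (c m)"
      by (intro mult_left_mono ennreal_leI) auto
    also have "\<dots> \<le> V m x"
      unfolding V_def using mk kx by (intro mult_right_mono) (auto simp: indicator_def)
    also have "\<dots> \<le> (\<Sum>m. V m x)"
      using sum_le_suminf[of "\<lambda>m. V m x" "{m}"] by simp
    finally show "u x * ennreal (1 / (1 + (h x)\<^sup>2)) \<le> \<dots>" .
  qed
  also have "\<dots> = (\<Sum>m. (\<integral>\<^sup>+x. V m x \<partial>M))"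
    by (intro nn_integral_suminf) (simp add: Md V_def)
  also have "\<dots> = (\<Sum>m. (J 0 + J 0) * ennreal (c m))"
  proof (intro suminf_cong)
    fix m
    have "(\<integral>\<^sup>+x. V m x \<partial>M)
      = (J (int m) + J (- int m - 1)) * ennreal (c m)"
      unfolding J_def V_def
      by (subst nn_integral_multc, simp add: Md) (subst nn_integral_add, auto simp: Md)
    then show "(\<integral>\<^sup>+x. V m x \<partial>M)
      = (J 0 + J 0) * ennreal (c m)" using J[of "int m"] J[of "- int m - 1"] by simp
  qed
  also have "\<dots> = (J 0 + J 0) * ennreal (\<Sum>m. c m)"
    using sc cpos by (simp add: suminf_ennreal2)
  also have "\<dots> < \<infinity>" using J0 by (simp add: ennreal_mult_less_top)
  finally show ?thesis .
qed

text \<open>The indicator of the box is a product over the coordinates, and its factors are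
  exchanged for weights one at a time. The other factors are invariant under translation by
  \<open>a j\<close>, because \<open>h i (a j) = 0\<close> for \<open>i \<noteq> j\<close>; this is
  the periodicity required of \<open>u\<close> in \<open>nn_integral_weight_step\<close>.\<close>

lemma nn_integral_weight_finite:
  assumes M: "haar_measure M" and I: "finite I" "\<And>i. i \<in> I \<Longrightarrow> h i \<in> real_homs"
    and a: "\<And>i j. i \<in> I \<Longrightarrow> j \<in> I \<Longrightarrow> h i (a j) = (if i = j then 1 else 0)"
    and box: "emeasure M {x. \<forall>i\<in>I. 0 \<le> h i x \<and> h i x < 1} < \<infinity>"
  shows "(\<integral>\<^sup>+x. ennreal (1 / hom_weight I h x) \<partial>M) < \<infinity>"
proof -
  have hm [measurable]: "h i \<in> borel_measurable borel" if "i \<in> I" for i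
    by (rule borel_measurable_continuous_onI[OF real_homsD(1)[OF I(2)[OF that]]])
  define w where "w i x = ennreal (1 / (1 + (h i x)\<^sup>2))" for i x
  define b where "b i x = (indicator {x. 0 \<le> h i x \<and> h i x < 1} x :: ennreal)" for i x
  have mw: "w i \<in> borel_measurable borel" and mb: "b i \<in> borel_measurable borel" if "i \<in> I" for i
    unfolding w_def b_def using hm[OF that] by measurable
  have main: "(\<integral>\<^sup>+x. (\<Prod>i\<in>K. w i x) * (\<Prod>i\<in>I - K. b i x) \<partial>M) < \<infinity>" if "K \<subseteq> I" for K
    using finite_subset[OF that I(1)] that
  proof (induction K rule: finite_induct)
    case empty
    have "(\<Prod>i\<in>I. b i x) = indicator {x. \<forall>i\<in>I. 0 \<le> h i x \<and> h i x < 1} x" for x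
      using I(1) by (induction I rule: finite_induct) (auto simp: b_def indicator_def)
    moreover have "{x. \<forall>i\<in>I. 0 \<le> h i x \<and> h i x < 1} \<in> sets M"
    proof -
      have "{x. \<forall>i\<in>I. 0 \<le> h i x \<and> h i x < 1} = {x \<in> space borel. \<forall>i\<in>I. 0 \<le> h i x \<and> h i x < 1}" by simp
      also have "\<dots> \<in> sets borel"
        by (intro sets.sets_Collect_finite_All I(1) sets.sets_Collect_conj) (use hm in measurable)
      finally show ?thesis by (simp add: haar_measureD[OF M])
    qed
    ultimately show ?case using box by simp
  next
    case (insert j K)
    define u where "u x = (\<Prod>i\<in>K. w i x) * (\<Prod>i\<in>I - insert j K. b i x)" for x
    have "(\<integral>\<^sup>+x. u x * ennreal (1 / (1 + (h j x)\<^sup>2)) \<partial>M) < \<infinity>"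
    proof (rule nn_integral_weight_step[OF M I(2), where a = "a j"])
      show "j \<in> I" using insert by auto
      show "h j (a j) = 1" using a insert by auto
      show "u \<in> borel_measurable borel"
        unfolding u_def using insert.prems
        by (intro borel_measurable_times_ennreal borel_measurable_prod_ennreal) (auto intro: mw mb)
      show "u (x + a j) = u x" for x
      proof -
        have *: "h i (x + a j) = h i x" if "i \<in> I" "i \<noteq> j" for i
          using a[of i j] that insert.prems by (simp add: real_homsD(2)[OF I(2)])
        then show ?thesis
          unfolding u_def
        proof (intro arg_cong2[of _ _ _ _ "(*)"] prod.cong refl)
          show "w i (x + a j) = w i x" if "i \<in> K" for i
          proof -
            have "i \<in> I" "i \<noteq> j" using that insert.prems insert.hyps by auto
            from *[OF this] show ?thesis by (simp add: w_def)
          qed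
          show "b i (x + a j) = b i x" if "i \<in> I - insert j K" for i
          proof -
            have "i \<in> I" "i \<noteq> j" using that by auto
            from *[OF this] show ?thesis by (simp add: b_def indicator_def)
          qed
        qed
      qed
      have IK: "I - K = insert j (I - insert j K)" using insert by auto
      have bj: "(\<Prod>i\<in>I - K. b i x) = b j x * (\<Prod>i\<in>I - insert j K. b i x)" for x
        unfolding IK by (rule prod.insert) (use I(1) in auto)
      show "(\<integral>\<^sup>+x. u x * indicator {x. 0 \<le> h j x \<and> h j x < 1} x \<partial>M) < \<infinity>"
      proof -
        have "u x * indicator {x. 0 \<le> h j x \<and> h j x < 1} x = (\<Prod>i\<in>K. w i x) * (\<Prod>i\<in>I - K. b i x)" for x
          unfolding u_def bj by (simp only: b_def ac_simps)
        then show ?thesis using insert.IH insert.prems by simp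
      qed
    qed
    then show ?case using insert.hyps by (simp add: u_def w_def mult_ac)
  qed
  have "(\<Prod>i\<in>I. w i x) = ennreal (1 / hom_weight I h x)" for x
    unfolding w_def hom_weight_def by (subst prod_ennreal) (auto simp: prod_dividef)
  with main[of I] show ?thesis by simp
qed

section \<open>Closure properties of Schwartz--Bruhat functions\<close>

text \<open>A class containing the constants besides the Schwartz--Bruhat functions, so that the
  Fourier transform can be treated as the matrix coefficient against the constant function
  1.\<close>

definition bounded_smooth :: "('a::topological_ab_group_add \<Rightarrow> complex) set" where
  "bounded_smooth = {f. smooth_fun f \<and> (\<forall>\<phi>s \<in> lists one_param_subgroups. bounded (range (iter_deriv \<phi>s f)))}"

lemma schwartz_bounded_smooth:
  assumes "f \<in> schwartz"
  shows "f \<in> bounded_smooth"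
proof -
  have "bounded (range (iter_deriv \<phi>s f))" if "\<phi>s \<in> lists one_param_subgroups" for \<phi>s
  proof -
    have "[] \<in> lists real_homs" by simp
    with assms that have "bounded (range (\<lambda>s. of_real (\<Prod>h\<leftarrow>[]. h s) * iter_deriv \<phi>s f s))"
      unfolding schwartz_def by blast
    then show ?thesis by simp
  qed
  with assms show ?thesis by (auto simp: schwartz_def bounded_smooth_def)
qed

lemma iter_deriv_append: "iter_deriv (\<phi>s @ \<phi>s') f = iter_deriv \<phi>s (iter_deriv \<phi>s' f)"
  by (induction \<phi>s) auto

abbreviation dir_deriv where "dir_deriv \<phi> f \<equiv> iter_deriv [\<phi>] f"

lemma smooth_fun_dir_deriv:
  assumes "smooth_fun f" "\<phi> \<in> one_param_subgroups"
  shows "smooth_fun (dir_deriv \<phi> f)"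
  using assms unfolding smooth_fun_def by (simp only: iter_deriv_append[symmetric] append_in_lists_conv) auto

lemma bounded_smooth_dir_deriv:
  assumes "f \<in> bounded_smooth" "\<phi> \<in> one_param_subgroups"
  shows "dir_deriv \<phi> f \<in> bounded_smooth"
  using assms smooth_fun_dir_deriv[of f \<phi>] unfolding bounded_smooth_def
  by (simp only: iter_deriv_append[symmetric] append_in_lists_conv mem_Collect_eq) auto

lemma schwartz_dir_deriv:
  assumes "f \<in> schwartz" "\<phi> \<in> one_param_subgroups"
  shows "dir_deriv \<phi> f \<in> schwartz"
  using assms smooth_fun_dir_deriv[of f \<phi>] unfolding schwartz_def
  by (simp only: iter_deriv_append[symmetric] append_in_lists_conv mem_Collect_eq) auto

lemma bounded_smoothD:
  assumes "f \<in> bounded_smooth"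
  shows "continuous_on UNIV f" "\<exists>B. \<forall>s. norm (f s) \<le> B" "f \<in> borel_measurable borel"
proof -
  have "[] \<in> lists one_param_subgroups" by simp
  with assms have "continuous_on UNIV (iter_deriv [] f)" "bounded (range (iter_deriv [] f))"
    unfolding bounded_smooth_def smooth_fun_def by blast+
  then show "continuous_on UNIV f" "\<exists>B. \<forall>s. norm (f s) \<le> B" by (auto simp: bounded_iff)
  then show "f \<in> borel_measurable borel" by (intro borel_measurable_continuous_onI)
qed

lemmas schwartzD = bounded_smoothD[OF schwartz_bounded_smooth]

text \<open>Smoothness speaks of the parameter 0 alone; the addition law of \<open>\<phi>\<close>
  moves the base point to \<open>s + \<phi> r0\<close>.\<close>

lemma has_dir_deriv:
  assumes "f \<in> bounded_smooth" and \<phi>: "\<phi> \<in> one_param_subgroups"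
  shows "((\<lambda>r. f (s + \<phi> r)) has_vector_derivative dir_deriv \<phi> f (s + \<phi> r0)) (at r0)"
proof -
  have "[] \<in> lists one_param_subgroups" by simp
  with assms have "(\<lambda>r. iter_deriv [] f (t + \<phi> r)) differentiable (at 0)" for t
    unfolding bounded_smooth_def smooth_fun_def by blast
  then have "((\<lambda>r. f (t + \<phi> r)) has_vector_derivative dir_deriv \<phi> f t) (at 0)" for t
    by (simp add: vector_derivative_works)
  from this[of "s + \<phi> r0"]
  have "((\<lambda>r. f (s + \<phi> r0 + \<phi> r)) has_vector_derivative dir_deriv \<phi> f (s + \<phi> r0)) (at (r0 - r0))" by simp
  then have "(((\<lambda>r. f (s + \<phi> r0 + \<phi> r)) \<circ> (\<lambda>r. r - r0)) has_vector_derivative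
      1 *\<^sub>R dir_deriv \<phi> f (s + \<phi> r0)) (at r0)"
    by (intro vector_diff_chain_at) (auto intro!: derivative_eq_intros)
  moreover have "((\<lambda>r. f (s + \<phi> r0 + \<phi> r)) \<circ> (\<lambda>r. r - r0)) = (\<lambda>r. f (s + \<phi> r))"
    by (auto simp: one_paramD(5)[OF \<phi>])
  ultimately show ?thesis by simp
qed

lemma vector_derivative_bound:
  fixes f :: "real \<Rightarrow> complex"
  assumes d: "\<And>x. (f has_vector_derivative f' x) (at x)" and B: "\<And>x. \<bar>x\<bar> \<le> \<bar>r\<bar> \<Longrightarrow> norm (f' x) \<le> B"
  shows "norm (f r - f 0) \<le> B * \<bar>r\<bar>"
proof -
  have "norm (f r - f 0) \<le> B * norm (r - 0)"
  proof (rule differentiable_bound[of "{-\<bar>r\<bar>..\<bar>r\<bar>}"])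
    show "(f has_derivative (\<lambda>h. h *\<^sub>R f' x)) (at x within {-\<bar>r\<bar>..\<bar>r\<bar>})" for x
      using d[of x] unfolding has_vector_derivative_def by (rule has_derivative_at_withinI)
    show "onorm (\<lambda>h. h *\<^sub>R f' x) \<le> B" if "x \<in> {-\<bar>r\<bar>..\<bar>r\<bar>}" for x
    proof (rule onorm_le)
      have "\<bar>x\<bar> \<le> \<bar>r\<bar>" using that by auto
      from B[OF this] show "norm (h *\<^sub>R f' x) \<le> B * norm h" for h
        by (simp add: mult.commute[of B] mult_left_mono)
    qed
  qed auto
  then show ?thesis by simp
qed

lemma real_hom_one_param:
  assumes h: "h \<in> real_homs" and \<phi>: "\<phi> \<in> one_param_subgroups"
  shows "h (s + \<phi> r) = h s + r * h (\<phi> 1)"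
proof -
  have "continuous_on UNIV (\<lambda>r. h (\<phi> r))"
    by (rule continuous_on_compose2[OF real_homsD(1)[OF h] one_paramD(1)[OF \<phi>]]) auto
  then have "h (\<phi> r) = r * h (\<phi> 1)"
    by (rule continuous_additive_linear) (simp add: real_homsD(2)[OF h] one_paramD(2)[OF \<phi>])
  then show ?thesis by (simp add: real_homsD(2)[OF h])
qed

text \<open>Every function in the definition of \<open>schwartz\<close> arises from \<open>f\<close>
  by finitely many derivatives followed by finitely many multiplications, so it never leaves
  \<open>V\<close>. Membership is thus reduced to single operations, and no formula for iterated
  derivatives has to be written down.\<close>

lemma schwartz_coinduct:
  assumes "f \<in> V"
    and cont: "\<And>f. f \<in> V \<Longrightarrow> continuous_on UNIV f"
    and bdd: "\<And>f. f \<in> V \<Longrightarrow> bounded (range f)"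
    and deriv: "\<And>f \<phi>. f \<in> V \<Longrightarrow> \<phi> \<in> one_param_subgroups \<Longrightarrow>
      \<exists>g\<in>V. \<forall>s. ((\<lambda>r. f (s + \<phi> r)) has_vector_derivative g s) (at 0)"
    and mult: "\<And>f h. f \<in> V \<Longrightarrow> h \<in> real_homs \<Longrightarrow> (\<lambda>s. of_real (h s) * f s) \<in> V"
  shows "f \<in> schwartz"
proof -
  have it: "iter_deriv \<phi>s f \<in> V" if "\<phi>s \<in> lists one_param_subgroups" for \<phi>s
    using that
  proof (induction \<phi>s)
    case (Cons \<phi> \<phi>s)
    then obtain g where "g \<in> V" "\<And>s. ((\<lambda>r. iter_deriv \<phi>s f (s + \<phi> r)) has_vector_derivative g s) (at 0)"
      using deriv[of "iter_deriv \<phi>s f" \<phi>] by auto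
    then have "iter_deriv (\<phi> # \<phi>s) f = g" by (auto simp: vector_derivative_at)
    with \<open>g \<in> V\<close> show ?case by simp
  qed (simp add: assms(1))
  have pr: "(\<lambda>s. of_real (\<Prod>h\<leftarrow>hs. h s) * g s) \<in> V" if "hs \<in> lists real_homs" "g \<in> V" for hs g
    using that
  proof (induction hs)
    case (Cons h hs)
    then show ?case using mult[of "\<lambda>s. of_real (\<Prod>h\<leftarrow>hs. h s) * g s" h] by (simp add: mult.assoc)
  qed simp
  show ?thesis
    unfolding schwartz_def smooth_fun_def
  proof (intro CollectI conjI ballI allI)
    fix \<phi>s :: "(real \<Rightarrow> 'a) list" assume s: "\<phi>s \<in> lists one_param_subgroups"
    show "continuous_on UNIV (iter_deriv \<phi>s f)" by (rule cont[OF it[OF s]])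
    show "(\<lambda>r. iter_deriv \<phi>s f (s + \<phi> r)) differentiable at 0" if "\<phi> \<in> one_param_subgroups" for \<phi> s
      using deriv[OF it[OF s] that] by (auto intro: differentiableI_vector)
    show "bounded (range (\<lambda>s. complex_of_real (\<Prod>h\<leftarrow>hs. h s) * iter_deriv \<phi>s f s))"
      if "hs \<in> lists real_homs" for hs
      by (rule bdd[OF pr[OF that it[OF s]]])
  qed
qed

text \<open>The definition of \<open>schwartz\<close> multiplies after differentiating, whereas a
  polynomial multiple must be differentiated after multiplying. The Leibniz rule produces linear
  combinations of this shape, which are closed under both operations.\<close>

inductive_set poly_schwartz :: "('a::topological_ab_group_add \<Rightarrow> complex) set" where
  base: "hs \<in> lists real_homs \<Longrightarrow> f \<in> schwartz \<Longrightarrow> (\<lambda>s. c * (of_real (\<Prod>h\<leftarrow>hs. h s) * f s)) \<in> poly_schwartz"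
| add: "f \<in> poly_schwartz \<Longrightarrow> g \<in> poly_schwartz \<Longrightarrow> (\<lambda>s. f s + g s) \<in> poly_schwartz"

lemma continuous_on_prod_list:
  fixes hs :: "('a::topological_space \<Rightarrow> real) list"
  assumes "\<And>h. h \<in> set hs \<Longrightarrow> continuous_on S h"
  shows "continuous_on S (\<lambda>s. \<Prod>h\<leftarrow>hs. h s)"
  using assms by (induction hs) (auto intro!: continuous_intros)

lemma bounded_range_add:
  fixes f g :: "'a \<Rightarrow> complex"
  assumes "bounded (range f)" "bounded (range g)"
  shows "bounded (range (\<lambda>s. f s + g s))"
proof -
  obtain A B where "\<And>s. norm (f s) \<le> A" "\<And>s. norm (g s) \<le> B"
    using assms by (auto simp: bounded_iff)
  then have "norm (f s + g s) \<le> A + B" for s by (intro norm_triangle_le add_mono)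
  then show ?thesis by (auto simp: bounded_iff)
qed

lemma bounded_range_scale:
  fixes f :: "'a \<Rightarrow> complex"
  assumes "bounded (range f)"
  shows "bounded (range (\<lambda>s. c * f s))"
proof -
  obtain A where "\<And>s. norm (f s) \<le> A"
    using assms by (auto simp: bounded_iff)
  then have "norm (c * f s) \<le> norm c * A" for s by (simp add: norm_mult mult_left_mono)
  then show ?thesis unfolding bounded_iff by blast
qed

lemma schwartz_bounded:
  assumes "f \<in> schwartz" "hs \<in> lists real_homs"
  shows "bounded (range (\<lambda>s. of_real (\<Prod>h\<leftarrow>hs. h s) * f s))"
proof -
  have "[] \<in> lists one_param_subgroups" by simp
  with assms have "bounded (range (\<lambda>s. of_real (\<Prod>h\<leftarrow>hs. h s) * iter_deriv [] f s))"
    unfolding schwartz_def by blast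
  then show ?thesis by simp
qed

lemma has_dir_deriv_0:
  assumes "f \<in> bounded_smooth" and \<phi>: "\<phi> \<in> one_param_subgroups"
  shows "((\<lambda>r. f (s + \<phi> r)) has_vector_derivative dir_deriv \<phi> f s) (at 0)"
  using has_dir_deriv[OF assms, of s 0] one_paramD(3)[OF \<phi>] by simp

lemma poly_schwartz_hom_mult:
  assumes "f \<in> poly_schwartz" "h \<in> real_homs"
  shows "(\<lambda>s. of_real (h s) * f s) \<in> poly_schwartz"
  using assms
proof (induction rule: poly_schwartz.induct)
  case (base hs f c)
  then show ?case using poly_schwartz.base[of "h # hs" f c] by (simp add: mult_ac)
next
  case (add f g)
  then show ?case using poly_schwartz.add by (fastforce simp: distrib_left)
qed

lemma poly_schwartz_scale:
  assumes "f \<in> poly_schwartz"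
  shows "(\<lambda>s. c * f s) \<in> poly_schwartz"
  using assms
proof (induction rule: poly_schwartz.induct)
  case (base hs f d)
  then show ?case using poly_schwartz.base[of hs f "c * d"] by (simp add: mult.assoc)
next
  case (add f g)
  then show ?case using poly_schwartz.add by (fastforce simp: distrib_left)
qed

lemma poly_schwartz_deriv:
  assumes "f \<in> poly_schwartz" and \<phi>: "\<phi> \<in> one_param_subgroups"
  shows "\<exists>g\<in>poly_schwartz. \<forall>s. ((\<lambda>r. f (s + \<phi> r)) has_vector_derivative g s) (at 0)"
  using assms(1)
proof (induction rule: poly_schwartz.induct)
  case (base hs f c)
  from base(1) show ?case
  proof (induction hs)
    case Nil
    show ?case
    proof (intro bexI allI)
      show "(\<lambda>s. c * dir_deriv \<phi> f s) \<in> poly_schwartz"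
        using poly_schwartz.base[of "[]" "dir_deriv \<phi> f" c] schwartz_dir_deriv[OF base(2) \<phi>] by simp
      show "((\<lambda>r. c * (of_real (\<Prod>h\<leftarrow>[]. h (s + \<phi> r)) * f (s + \<phi> r))) has_vector_derivative
          c * dir_deriv \<phi> f s) (at 0)" for s
        using has_vector_derivative_mult_right[OF has_dir_deriv_0[OF schwartz_bounded_smooth[OF base(2)] \<phi>, of s], of c]
        by simp
    qed
  next
    case (Cons h hs)
    define F where "F s = c * (of_real (\<Prod>h\<leftarrow>hs. h s) * f s)" for s
    have F: "F \<in> poly_schwartz" unfolding F_def using Cons base(2) by (intro poly_schwartz.base) auto
    have h: "h \<in> real_homs" using Cons.hyps by simp
    obtain g where g: "g \<in> poly_schwartz" "\<And>s. ((\<lambda>r. F (s + \<phi> r)) has_vector_derivative g s) (at 0)"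
      using Cons unfolding F_def by auto
    have "((\<lambda>r. of_real (h (s + \<phi> r)) * F (s + \<phi> r)) has_vector_derivative
        (of_real (h (\<phi> 1)) * F s + of_real (h s) * g s)) (at 0)" for s
    proof -
      \<comment> \<open>Along a one-parameter subgroup \<open>h\<close> is affine with slope
        \<open>h (\<phi> 1)\<close>, so differentiating it leaves a constant.\<close>
      have "((\<lambda>r. of_real (h (s + \<phi> r)) :: complex) has_vector_derivative of_real (h (\<phi> 1))) (at 0)"
        unfolding real_hom_one_param[OF h \<phi>] by (auto intro!: derivative_eq_intros)
      from has_vector_derivative_mult[OF this g(2)[of s]] show ?thesis
        by (simp add: one_paramD(3)[OF \<phi>] algebra_simps)
    qed
    moreover have "(\<lambda>s. of_real (h (\<phi> 1)) * F s + of_real (h s) * g s) \<in> poly_schwartz"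
      using g(1) F h by (intro poly_schwartz.add poly_schwartz_scale poly_schwartz_hom_mult)
    ultimately show ?case unfolding F_def by (intro bexI) (auto simp: mult_ac)
  qed
next
  case (add f g)
  then obtain f' g' where "f' \<in> poly_schwartz" "g' \<in> poly_schwartz"
    "\<And>s. ((\<lambda>r. f (s + \<phi> r)) has_vector_derivative f' s) (at 0)"
    "\<And>s. ((\<lambda>r. g (s + \<phi> r)) has_vector_derivative g' s) (at 0)" by auto
  then show ?case
    by (intro bexI[of _ "\<lambda>s. f' s + g' s"]) (auto intro!: has_vector_derivative_add poly_schwartz.add)
qed

lemma poly_schwartz_eq: "poly_schwartz = schwartz"
proof (intro set_eqI iffI)
  fix f :: "'a \<Rightarrow> complex" assume "f \<in> poly_schwartz"
  then show "f \<in> schwartz"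
  proof (rule schwartz_coinduct)
    fix f :: "'a \<Rightarrow> complex" assume "f \<in> poly_schwartz"
    then show "continuous_on UNIV f"
      by induction (auto intro!: continuous_intros continuous_on_prod_list simp: real_homsD(1) schwartzD)
  next
    fix f :: "'a \<Rightarrow> complex" assume "f \<in> poly_schwartz"
    then show "bounded (range f)"
      by induction (auto intro!: bounded_range_add bounded_range_scale schwartz_bounded simp: in_lists_conv_set)
  qed (auto intro: poly_schwartz_deriv poly_schwartz_hom_mult)
next
  fix f :: "'a \<Rightarrow> complex" assume "f \<in> schwartz"
  then show "f \<in> poly_schwartz" using poly_schwartz.base[of "[]" f 1] by simp
qed

lemmas schwartz_add = poly_schwartz.add[unfolded poly_schwartz_eq]
lemmas schwartz_scale = poly_schwartz_scale[unfolded poly_schwartz_eq]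
lemmas schwartz_hom_mult = poly_schwartz_hom_mult[unfolded poly_schwartz_eq]

lemma schwartz_weight_mult:
  assumes "finite I" "\<And>i. i \<in> I \<Longrightarrow> h i \<in> real_homs" "f \<in> schwartz"
  shows "(\<lambda>s. of_real (hom_weight I h s) * f s) \<in> schwartz"
  using assms(1,2)
proof (induction I rule: finite_induct)
  case empty
  then show ?case using assms(3) by (simp add: hom_weight_def)
next
  case (insert i I)
  define g where "g s = of_real (hom_weight I h s) * f s" for s
  have g: "g \<in> schwartz" unfolding g_def using insert by auto
  have "(\<lambda>s. g s + of_real (h i s) * (of_real (h i s) * g s)) \<in> schwartz"
    using insert.prems by (intro schwartz_add g schwartz_hom_mult) auto
  also have "(\<lambda>s. g s + of_real (h i s) * (of_real (h i s) * g s)) =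
      (\<lambda>s. of_real (hom_weight (insert i I) h s) * f s)"
    using insert.hyps by (auto simp: g_def hom_weight_def algebra_simps power2_eq_square)
  finally show ?case .
qed

lemma schwartz_decay:
  assumes "finite I" "\<And>i. i \<in> I \<Longrightarrow> h i \<in> real_homs" "f \<in> schwartz"
  shows "\<exists>C. \<forall>s. norm (f s) \<le> C / hom_weight I h s"
proof -
  obtain C where C: "\<And>s. norm (of_real (hom_weight I h s) * f s) \<le> C"
    using schwartzD(2)[OF schwartz_weight_mult[where h = h, OF assms]] by blast
  have "norm (f s) \<le> C / hom_weight I h s" for s
    using C[of s] hom_weight_pos[of I h s] by (simp add: norm_mult field_simps)
  then show ?thesis by blast
qed

lemma const_bounded_smooth: "(\<lambda>_. c) \<in> bounded_smooth"
proof -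
  have "\<exists>d. iter_deriv \<phi>s (\<lambda>_. c) = (\<lambda>_. d)" for \<phi>s :: "(real \<Rightarrow> 'a::topological_ab_group_add) list"
    by (induction \<phi>s) auto
  then have *: "P (iter_deriv \<phi>s (\<lambda>_. c))" if "\<And>d. P (\<lambda>_. d)"
    for P and \<phi>s :: "(real \<Rightarrow> 'a::topological_ab_group_add) list"
    using that by metis
  show ?thesis
    unfolding bounded_smooth_def smooth_fun_def
    by (intro CollectI conjI ballI allI; rule *) auto
qed

section \<open>Coordinates on elementary groups\<close>

text \<open>Coordinates and the corresponding embeddings on \<open>\<real>\<^sup>n \<times> \<T>\<^sup>p \<times> \<int>\<^sup>q \<times> F\<close>: \<open>x, e\<close> for the real, \<open>z, \<tau>\<close> for the
  circle (\<open>\<tau> j\<close> winds around the \<open>j\<close>-th circle with period \<open>2 \<pi>\<close>) and \<open>k, \<iota>\<close> for the integer factors,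
  while \<open>pf\<close> is the projection to \<open>F\<close>.\<close>

locale elementary_coords =
  fixes n p q :: nat
    and x :: "nat \<Rightarrow> 'g::{topological_ab_group_add, t2_space} \<Rightarrow> real" and e :: "nat \<Rightarrow> real \<Rightarrow> 'g"
    and z :: "nat \<Rightarrow> 'g dual" and \<tau> :: "nat \<Rightarrow> real \<Rightarrow> 'g"
    and k :: "nat \<Rightarrow> 'g \<Rightarrow> int" and \<iota> :: "nat \<Rightarrow> int \<Rightarrow> 'g"
    and pf :: "'g \<Rightarrow> 'g"
  assumes x_hom: "i < n \<Longrightarrow> x i \<in> real_homs" and e_sub: "i < n \<Longrightarrow> e i \<in> one_param_subgroups"
    and \<tau>_sub: "j < p \<Longrightarrow> \<tau> j \<in> one_param_subgroups" and \<tau>_period: "j < p \<Longrightarrow> \<tau> j (2 * pi) = 0"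
    and k_hom: "j < q \<Longrightarrow> (\<lambda>s. of_int (k j s)) \<in> real_homs"
    and \<iota>_add: "j < q \<Longrightarrow> \<iota> j (a + b) = \<iota> j a + \<iota> j b"
    and pf_cont: "continuous_on UNIV pf" and pf_add: "pf (s + t) = pf s + pf t"
    and pf_finite: "finite (range pf)"
    and decomp: "s = (\<Sum>i<n. e i (x i s)) + (\<Sum>j<p. \<tau> j (Arg (char_of (z j) s)))
        + (\<Sum>j<q. \<iota> j (k j s)) + pf s"
    and x_e: "i < n \<Longrightarrow> i' < n \<Longrightarrow> x i (e i' r) = (if i = i' then r else 0)"
    and x_\<tau>: "i < n \<Longrightarrow> j < p \<Longrightarrow> x i (\<tau> j r) = 0"
    and x_\<iota>: "i < n \<Longrightarrow> j < q \<Longrightarrow> x i (\<iota> j m) = 0"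
    and k_e: "i < n \<Longrightarrow> j < q \<Longrightarrow> k j (e i r) = 0"
    and k_\<iota>: "j < q \<Longrightarrow> j' < q \<Longrightarrow> k j (\<iota> j' m) = (if j = j' then m else 0)"
    and z_e: "i < n \<Longrightarrow> j < p \<Longrightarrow> char_of (z j) (e i r) = 1"
    and z_\<tau>: "j < p \<Longrightarrow> j' < p \<Longrightarrow> char_of (z j) (\<tau> j' r) = (if j = j' then cis r else 1)"

text \<open>Coordinates are read off from \<open>\<Psi>\<close>, and the embeddings are the images
  under \<open>\<Phi>\<close> of points with at most one non-neutral entry; the identities are then
  compared entry by entry in the model.\<close>

lemma elementary_group_coords:
  assumes "elementary_group TYPE('g::{topological_ab_group_add, t2_space})"
  shows "\<exists>n p q x e z \<tau> k \<iota> (pf :: 'g \<Rightarrow> 'g). elementary_coords n p q x e z \<tau> k \<iota> pf"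
proof -
  obtain n p q and F :: "'g set" and \<Phi> :: "_ \<Rightarrow> 'g" and \<Psi>
    where F: "finite F" "0 \<in> F" "\<forall>f\<in>F. \<forall>g\<in>F. f - g \<in> F"
      and hom: "homeomorphism (elementary_model n p q F) UNIV \<Phi> \<Psi>"
      and add: "\<forall>(x, z, k, f) \<in> elementary_model n p q F. \<forall>(y, w, l, g) \<in> elementary_model n p q F.
        \<Phi> (\<lambda>i. x i + y i, \<lambda>i. z i * w i, \<lambda>i. k i + l i, f + g) = \<Phi> (x, z, k, f) + \<Phi> (y, w, l, g)"
    using assms unfolding elementary_group_def by (elim exE conjE) (rule that)
  define mem where "mem x z k f \<longleftrightarrow> (\<forall>i\<ge>n. x i = (0::real)) \<and> (\<forall>i. norm (z i :: complex) = 1) \<and>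
    (\<forall>i\<ge>p. z i = 1) \<and> (\<forall>i\<ge>q. k i = (0::int)) \<and> f \<in> F" for x z k f
  have mem: "(x, z, k, f) \<in> elementary_model n p q F \<longleftrightarrow> mem x z k f" for x z k f
    by (auto simp: elementary_model_def mem_def)
  define G where "G x z k f = \<Phi> (x, z, k, f)" for x z k f
  have Gadd: "G (\<lambda>i. x i + y i) (\<lambda>i. z i * w i) (\<lambda>i. k i + l i) (f + g) = G x z k f + G y w l g"
    if "mem x z k f" "mem y w l g" for x y z w k l f g
  proof -
    have "(x, z, k, f) \<in> elementary_model n p q F" "(y, w, l, g) \<in> elementary_model n p q F"
      using that mem by auto
    from bspec[OF bspec[OF add this(1), unfolded case_prod_conv] this(2)] show ?thesis
      by (simp add: G_def)
  qed
  define X where "X s = fst (\<Psi> s)" for s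
  define Z where "Z s = fst (snd (\<Psi> s))" for s
  define K where "K s = fst (snd (snd (\<Psi> s)))" for s
  define P where "P s = snd (snd (snd (\<Psi> s)))" for s
  have \<Psi>: "\<Psi> s = (X s, Z s, K s, P s)" for s by (simp add: X_def Z_def K_def P_def)
  have memc: "mem (X s) (Z s) (K s) (P s)" and Gc: "G (X s) (Z s) (K s) (P s) = s" for s
  proof -
    have "\<Psi> s \<in> elementary_model n p q F" "\<Phi> (\<Psi> s) = s" using hom by (auto simp: homeomorphism_def)
    then show "mem (X s) (Z s) (K s) (P s)" "G (X s) (Z s) (K s) (P s) = s"
      unfolding \<Psi> by (auto simp: mem G_def)
  qed
  have cG: "X (G x z k f) = x" "Z (G x z k f) = z" "K (G x z k f) = k" "P (G x z k f) = f"
    if "mem x z k f" for x z k f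
  proof -
    have "\<Psi> (\<Phi> (x, z, k, f)) = (x, z, k, f)" using hom that by (auto simp: homeomorphism_def mem)
    then show "X (G x z k f) = x" "Z (G x z k f) = z" "K (G x z k f) = k" "P (G x z k f) = f"
      by (auto simp: X_def Z_def K_def P_def G_def)
  qed
  have Fadd: "f + g \<in> F" if "f \<in> F" "g \<in> F" for f g
  proof -
    have "0 - g \<in> F" using F that by blast
    then have "f - (0 - g) \<in> F" using F that by blast
    then show ?thesis by simp
  qed
  have mem_add: "mem (\<lambda>i. x i + y i) (\<lambda>i. z i * w i) (\<lambda>i. k i + l i) (f + g)"
    if "mem x z k f" "mem y w l g" for x y z w k l f g
    using that Fadd by (auto simp: mem_def norm_mult)
  have cadd: "X (s + t) = (\<lambda>i. X s i + X t i)" "Z (s + t) = (\<lambda>i. Z s i * Z t i)"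
    "K (s + t) = (\<lambda>i. K s i + K t i)" "P (s + t) = P s + P t" for s t
    using cG[OF mem_add[OF memc[of s] memc[of t]]] Gadd[OF memc[of s] memc[of t]] Gc[of s] Gc[of t] by simp_all
  have c\<Psi>: "continuous_on UNIV \<Psi>" and c\<Phi>: "continuous_on (elementary_model n p q F) \<Phi>"
    using hom by (auto simp: homeomorphism_def)
  have cX: "continuous_on UNIV (\<lambda>s. X s i)" for i
    unfolding X_def
    by (rule continuous_on_compose2[OF continuous_on_product_coordinates[of i], of UNIV "\<lambda>s. fst (\<Psi> s)"])
      (intro continuous_on_fst continuous_on_snd c\<Psi>, simp)
  have cZ: "continuous_on UNIV (\<lambda>s. Z s i)" for i
    unfolding Z_def
    by (rule continuous_on_compose2[OF continuous_on_product_coordinates[of i], of UNIV "\<lambda>s. fst (snd (\<Psi> s))"])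
      (intro continuous_on_fst continuous_on_snd c\<Psi>, simp)
  have cK: "continuous_on UNIV (\<lambda>s. K s i)" for i
    unfolding K_def
    by (rule continuous_on_compose2[OF continuous_on_product_coordinates[of i], of UNIV "\<lambda>s. fst (snd (snd (\<Psi> s)))"])
      (intro continuous_on_fst continuous_on_snd c\<Psi>, simp)
  have cP: "continuous_on UNIV P"
    unfolding P_def by (auto intro!: continuous_intros c\<Psi>)
  \<comment> \<open>Neutral sequences of the real, circle and integer factors; \<open>u0\<close>,
    \<open>u1\<close> and \<open>u2\<close> below depart from them at most in entry
    \<open>i\<close>.\<close>
  define o0 where "o0 = (\<lambda>_::nat. 0::real)"
  define o1 where "o1 = (\<lambda>_::nat. 1::complex)"
  define o2 where "o2 = (\<lambda>_::nat. 0::int)"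
  note o = o0_def o1_def o2_def
  define u0 where "u0 i r = (\<lambda>j. if j = i then r else 0 :: real)" for i :: nat and r
  define u1 where "u1 i r = (\<lambda>j. if j = i then cis r else 1)" for i :: nat and r
  define u2 where "u2 i m = (\<lambda>j. if j = i then m else 0 :: int)" for i :: nat and m
  note u = u0_def u1_def u2_def
  define e where "e i r = G (u0 i r) o1 o2 0" for i r
  define \<tau> where "\<tau> i r = G o0 (u1 i r) o2 0" for i r
  define \<iota> where "\<iota> i m = G o0 o1 (u2 i m) 0" for i m
  define pf where "pf s = G o0 o1 o2 (P s)" for s
  have mu0: "mem (u0 i r) o1 o2 0" if "i < n" for i r using that F by (auto simp: mem_def o u)
  have mu1: "mem o0 (u1 i r) o2 0" if "i < p" for i r using that F by (auto simp: mem_def o u)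
  have mu2: "mem o0 o1 (u2 i m) 0" if "i < q" for i m using that F by (auto simp: mem_def o u)
  have mo: "mem o0 o1 o2 f" if "f \<in> F" for f using that by (auto simp: mem_def o)
  have PF: "P s \<in> F" for s using memc[of s] by (simp add: mem_def)
  have G0: "G o0 o1 o2 0 = 0"
    using Gadd[OF mo[OF F(2)] mo[OF F(2)]] by (simp add: o)
  have z: "char_of (Dual (\<lambda>s. Z s j)) s = Z s j" for j s
    using memc cZ by (subst Dual_inverse) (auto simp: cadd mem_def)
  have mm: "elementary_model n p q F = {m. mem (fst m) (fst (snd m)) (fst (snd (snd m))) (snd (snd (snd m)))}"
    using mem by auto
  have contG: "continuous_on UNIV (\<lambda>r. G (a r) (b r) (c r) (d r))"
    if "\<And>r. mem (a r) (b r) (c r) (d r)" "\<And>i. continuous_on UNIV (\<lambda>r. a r i)" "\<And>i. continuous_on UNIV (\<lambda>r. b r i)"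
      "\<And>i. continuous_on UNIV (\<lambda>r. c r i)" "continuous_on UNIV d"
    for a b c and d :: "'t::topological_space \<Rightarrow> 'g"
  proof -
    have "continuous_on UNIV (\<lambda>r::'t. (a r, b r, c r, d r))"
      using that by (intro continuous_on_Pair continuous_on_coordinatewise_then_product) auto
    moreover have "range (\<lambda>r. (a r, b r, c r, d r)) \<subseteq> elementary_model n p q F"
      using that(1) by (auto simp: mem)
    ultimately show ?thesis unfolding G_def by (rule continuous_on_compose2[OF c\<Phi>])
  qed
  have "elementary_coords n p q (\<lambda>i s. X s i) e (\<lambda>j. Dual (\<lambda>s. Z s j)) \<tau> (\<lambda>j s. K s j) \<iota> pf"
  proof
    show "(\<lambda>s. X s i) \<in> real_homs" for i using cX by (simp add: real_homs_def cadd)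
    show "e i \<in> one_param_subgroups" if "i < n" for i
      unfolding one_param_subgroups_def
    proof (intro CollectI conjI allI)
      have "continuous_on UNIV (\<lambda>r. if b then r else 0 :: real)" for b by (cases b) auto
      then show "continuous_on UNIV (e i)" unfolding e_def
        by (intro contG mu0 that) (auto simp: u o)
      show "e i (r + r') = e i r + e i r'" for r r'
        unfolding e_def Gadd[OF mu0[OF that] mu0[OF that], symmetric]
        by (rule arg_cong4[of _ _ _ _ _ _ _ _ G]) (auto simp: u o)
    qed
    show "\<tau> i \<in> one_param_subgroups" if "i < p" for i
      unfolding one_param_subgroups_def
    proof (intro CollectI conjI allI)
      have "continuous_on UNIV (\<lambda>r. if b then cis r else 1)" for b by (cases b) (auto intro!: continuous_intros)
      then show "continuous_on UNIV (\<tau> i)" unfolding \<tau>_def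
        by (intro contG mu1 that) (auto simp: u o)
      show "\<tau> i (r + r') = \<tau> i r + \<tau> i r'" for r r'
        unfolding \<tau>_def Gadd[OF mu1[OF that] mu1[OF that], symmetric]
        by (rule arg_cong4[of _ _ _ _ _ _ _ _ G]) (auto simp: u o cis_mult)
    qed
    show "\<tau> j (2 * pi) = 0" for j
    proof -
      have "u1 j (2 * pi) = o1" by (auto simp: u o)
      then show ?thesis by (simp add: \<tau>_def G0)
    qed
    show "(\<lambda>s. real_of_int (K s j)) \<in> real_homs" for j
      using cK[of j] by (auto simp: real_homs_def cadd intro!: continuous_intros)
    show "\<iota> j (a + b) = \<iota> j a + \<iota> j b" if "j < q" for j a b
      unfolding \<iota>_def Gadd[OF mu2[OF that] mu2[OF that], symmetric]
      by (rule arg_cong4[of _ _ _ _ _ _ _ _ G]) (auto simp: u o)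
    show "continuous_on UNIV pf" unfolding pf_def
      by (intro contG mo PF cP) (auto simp: o)
    show "pf (s + t) = pf s + pf t" for s t
      unfolding pf_def cadd Gadd[OF mo[OF PF] mo[OF PF], symmetric] by (simp add: o)
    have "range pf \<subseteq> G o0 o1 o2 ` F" using PF by (auto simp: pf_def)
    then show "finite (range pf)" using F(1) finite_surj by blast
    show "s = (\<Sum>i<n. e i (X s i)) + (\<Sum>j<p. \<tau> j (Arg (char_of (Dual (\<lambda>s. Z s j)) s))) + (\<Sum>j<q. \<iota> j (K s j)) + pf s" for s
    proof -
      note ms = memc[of s, unfolded mem_def]
      \<comment> \<open>Partial sums are points whose later entries are neutral. Membership in the
        model is carried through the induction because \<open>Gadd\<close> demands it;
        \<open>t1\<close> and \<open>t2\<close> do the same for the other factors.\<close>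
      have t0: "(\<Sum>i<m. e i (X s i)) = G (\<lambda>i. if i < m then X s i else 0) o1 o2 0 \<and>
          mem (\<lambda>i. if i < m then X s i else 0) o1 o2 0" if "m \<le> n" for m
        using that
      proof (induction m)
        case 0 then show ?case using mo[OF F(2)] G0 by (simp add: o)
      next
        case (Suc m)
        then have "m < n" by simp
        have eq: "(\<lambda>i. (if i < m then X s i else 0) + u0 m (X s m) i) = (\<lambda>i. if i < Suc m then X s i else 0)"
          by (auto simp: u)
        show ?case using Suc Gadd[of "\<lambda>i. if i < m then X s i else 0" o1 o2 0, OF _ mu0[OF \<open>m < n\<close>], of "X s m"]
            mem_add[of "\<lambda>i. if i < m then X s i else 0" o1 o2 0, OF _ mu0[OF \<open>m < n\<close>], of "X s m"]
          unfolding eq by (simp add: e_def) (simp add: o)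
      qed
      have t1: "(\<Sum>i<m. \<tau> i (Arg (Z s i))) = G o0 (\<lambda>i. if i < m then Z s i else 1) o2 0 \<and>
          mem o0 (\<lambda>i. if i < m then Z s i else 1) o2 0" if "m \<le> p" for m
        using that
      proof (induction m)
        case 0 then show ?case using mo[OF F(2)] G0 by (simp add: o)
      next
        case (Suc m)
        then have "m < p" by simp
        have "cis (Arg (Z s m)) = Z s m" using ms by (metis cis_Arg norm_zero sgn_eq zero_neq_one div_by_1 of_real_1)
        then have eq: "(\<lambda>i. (if i < m then Z s i else 1) * u1 m (Arg (Z s m)) i) = (\<lambda>i. if i < Suc m then Z s i else 1)"
          by (auto simp: u)
        show ?case using Suc Gadd[of o0 "\<lambda>i. if i < m then Z s i else 1" o2 0, OF _ mu1[OF \<open>m < p\<close>], of "Arg (Z s m)"]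
            mem_add[of o0 "\<lambda>i. if i < m then Z s i else 1" o2 0, OF _ mu1[OF \<open>m < p\<close>], of "Arg (Z s m)"]
          unfolding eq by (simp add: \<tau>_def) (simp add: o)
      qed
      have t2: "(\<Sum>i<m. \<iota> i (K s i)) = G o0 o1 (\<lambda>i. if i < m then K s i else 0) 0 \<and>
          mem o0 o1 (\<lambda>i. if i < m then K s i else 0) 0" if "m \<le> q" for m
        using that
      proof (induction m)
        case 0 then show ?case using mo[OF F(2)] G0 by (simp add: o)
      next
        case (Suc m)
        then have "m < q" by simp
        have eq: "(\<lambda>i. (if i < m then K s i else 0) + u2 m (K s m) i) = (\<lambda>i. if i < Suc m then K s i else 0)"
          by (auto simp: u)
        show ?case using Suc Gadd[of o0 o1 "\<lambda>i. if i < m then K s i else 0" 0, OF _ mu2[OF \<open>m < q\<close>], of "K s m"]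
            mem_add[of o0 o1 "\<lambda>i. if i < m then K s i else 0" 0, OF _ mu2[OF \<open>m < q\<close>], of "K s m"]
          unfolding eq by (simp add: \<iota>_def) (simp add: o)
      qed
      have "(\<lambda>i. if i < n then X s i else 0) = X s" "(\<lambda>i. if i < p then Z s i else 1) = Z s"
        "(\<lambda>i. if i < q then K s i else 0) = K s" using ms by auto
      then have s: "(\<Sum>i<n. e i (X s i)) = G (X s) o1 o2 0" "mem (X s) o1 o2 0"
        "(\<Sum>j<p. \<tau> j (Arg (Z s j))) = G o0 (Z s) o2 0" "mem o0 (Z s) o2 0"
        "(\<Sum>j<q. \<iota> j (K s j)) = G o0 o1 (K s) 0" "mem o0 o1 (K s) 0"
        using t0[of n] t1[of p] t2[of q] by auto
      have s1: "G (X s) o1 o2 0 + G o0 (Z s) o2 0 = G (X s) (Z s) o2 0" "mem (X s) (Z s) o2 0"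
        using Gadd[OF s(2) s(4)] mem_add[OF s(2) s(4)] by (simp_all add: o)
      have s2: "G (X s) (Z s) o2 0 + G o0 o1 (K s) 0 = G (X s) (Z s) (K s) 0" "mem (X s) (Z s) (K s) 0"
        using Gadd[OF s1(2) s(6)] mem_add[OF s1(2) s(6)] by (simp_all add: o)
      have "G (X s) (Z s) (K s) 0 + pf s = s"
        using Gadd[OF s2(2) mo[OF PF[of s]]] Gc[of s] by (simp add: o pf_def)
      then show ?thesis unfolding z s s1 s2 by simp
    qed
    show "X (e i' r) i = (if i = i' then r else 0)" if "i < n" "i' < n" for i i' r
      unfolding e_def cG[OF mu0[OF that(2)]] by (simp add: u)
    show "X (\<tau> j r) i = 0" if "i < n" "j < p" for i j r
      unfolding \<tau>_def cG[OF mu1[OF that(2)]] by (simp add: o)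
    show "X (\<iota> j r) i = 0" if "i < n" "j < q" for i j r
      unfolding \<iota>_def cG[OF mu2[OF that(2)]] by (simp add: o)
    show "K (e i r) j = 0" if "i < n" "j < q" for i j r
      unfolding e_def cG[OF mu0[OF that(1)]] by (simp add: o)
    show "K (\<iota> j' m) j = (if j = j' then m else 0)" if "j < q" "j' < q" for j j' m
      unfolding \<iota>_def cG[OF mu2[OF that(2)]] by (simp add: u)
    show "char_of (Dual (\<lambda>s. Z s j)) (e i r) = 1" if "i < n" "j < p" for i j r
      unfolding z e_def cG[OF mu0[OF that(1)]] by (simp add: o)
    show "char_of (Dual (\<lambda>s. Z s j)) (\<tau> j' r) = (if j = j' then cis r else 1)" if "j < p" "j' < p" for j j' r
      unfolding z \<tau>_def cG[OF mu1[OF that(2)]] by (simp add: u)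
  qed
  then show ?thesis by blast
qed

section \<open>Compactness and integrable weights on the group\<close>

lemma compact_sum_set:
  fixes C :: "'i \<Rightarrow> 'a::topological_ab_group_add set"
  assumes "finite I" "\<And>i. i \<in> I \<Longrightarrow> compact (C i)"
  shows "\<exists>D. compact D \<and> (\<forall>f. (\<forall>i\<in>I. f i \<in> C i) \<longrightarrow> sum f I \<in> D)"
  using assms
proof (induction I rule: finite_induct)
  case empty
  show ?case by (intro exI[of _ "{0}"]) auto
next
  case (insert i I)
  then obtain D where D: "compact D" "\<forall>f. (\<forall>i\<in>I. f i \<in> C i) \<longrightarrow> sum f I \<in> D" by auto
  have "compact ((\<lambda>(a, b). a + b) ` (C i \<times> D))"
    using D insert by (intro compact_continuous_image compact_Times) (auto simp: case_prod_unfold intro!: continuous_intros)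
  moreover have "sum f (insert i I) \<in> (\<lambda>(a, b). a + b) ` (C i \<times> D)" if "\<forall>j\<in>insert i I. f j \<in> C j" for f
    using that D(2) insert.hyps by (auto simp: image_iff intro!: bexI[of _ "(f i, sum f I)"])
  ultimately show ?case by blast
qed

lemma compact_plus_set:
  fixes C D :: "'a::topological_ab_group_add set"
  assumes "compact C" "compact D"
  shows "compact {a + b |a b. a \<in> C \<and> b \<in> D}"
proof -
  have "compact ((\<lambda>(a, b). a + b) ` (C \<times> D))"
    using assms by (intro compact_continuous_image compact_Times) (auto simp: case_prod_unfold intro!: continuous_intros)
  also have "(\<lambda>(a, b). a + b) ` (C \<times> D) = {a + b |a b. a \<in> C \<and> b \<in> D}" by auto
  finally show ?thesis .
qed

lemma hom_weight_factor_le: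
  assumes "finite I" "i \<in> I"
  shows "1 + (h i s)\<^sup>2 \<le> hom_weight I h s"
proof -
  have "hom_weight I h s = (1 + (h i s)\<^sup>2) * hom_weight (I - {i}) h s"
    unfolding hom_weight_def using assms by (rule prod.remove)
  with mult_left_mono[OF hom_weight_ge_1[of "I - {i}" h s], of "1 + (h i s)\<^sup>2"] show ?thesis by simp
qed

lemma prod_cis: "(\<Prod>i\<in>I. cis (f i)) = cis (sum f I)"
  by (induction I rule: infinite_finite_induct) (auto simp: cis_mult)

lemma real_homs_sum:
  assumes "h \<in> real_homs"
  shows "h (sum f I) = (\<Sum>i\<in>I. h (f i))"
  by (induction I rule: infinite_finite_induct) (auto simp: real_homsD[OF assms])

locale elementary_lc_coords = elementary_coords n p q x e z \<tau> k \<iota> pf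
  for n p q and x :: "nat \<Rightarrow> 'g::{topological_ab_group_add, t2_space} \<Rightarrow> real" and e z \<tau> k \<iota> pf +
  assumes lc: "locally compact (UNIV :: 'g set)"
begin

text \<open>\<open>IG\<close> indexes the unbounded coordinates of the group, the real and integer
  ones. \<open>ID\<close> indexes those of the dual, where the circles have turned into integer
  factors. The elements \<open>aG\<close> and \<open>aD\<close> are unit steps in these
  coordinates.\<close>

definition IG :: "(nat + nat) set" where "IG = {..<n} <+> {..<q}"
definition hG where "hG = case_sum x (\<lambda>j s. real_of_int (k j s))"
definition aG where "aG = case_sum (\<lambda>i. e i 1) (\<lambda>j. \<iota> j 1)"
definition ID :: "(nat + nat) set" where "ID = {..<n} <+> {..<p}"
definition hD where "hD = case_sum (\<lambda>i. freq (e i)) (\<lambda>j. freq (\<tau> j))"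
definition aD where "aD = case_sum (\<lambda>i. exp_char (x i)) z"

lemma finite_IG: "finite IG" and finite_ID: "finite ID"
  by (auto simp: IG_def ID_def)

lemma hG_hom: "i \<in> IG \<Longrightarrow> hG i \<in> real_homs"
  by (auto simp: IG_def hG_def x_hom k_hom)

lemma hD_hom: "i \<in> ID \<Longrightarrow> hD i \<in> real_homs"
  by (auto simp: ID_def hD_def intro!: freq_real_hom lc e_sub \<tau>_sub)

lemma hG_aG: "i \<in> IG \<Longrightarrow> j \<in> IG \<Longrightarrow> hG i (aG j) = (if i = j then 1 else 0)"
  by (auto simp: IG_def hG_def aG_def x_e x_\<iota> k_e k_\<iota> split: if_splits)

lemma hD_aD: "i \<in> ID \<Longrightarrow> j \<in> ID \<Longrightarrow> hD i (aD j) = (if i = j then 1 else 0)"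
  by (auto simp: ID_def hD_def aD_def char_of_exp_char[OF x_hom] x_e x_\<tau> z_e z_\<tau>
      intro!: freqI e_sub \<tau>_sub)

text \<open>A bound on the weight bounds every real and integer coordinate, the circle coordinates
  have arguments between \<open>- pi\<close> and \<open>pi\<close>, and \<open>pf\<close> has
  finitely many values. By \<open>decomp\<close> the closed sublevel set lies in a sum of compact
  sets.\<close>

lemma compact_weight_sublevel: "compact {s. hom_weight IG hG s \<le> R}"
proof -
  obtain D1 where D1: "compact D1" "\<And>f. (\<And>i. i < n \<Longrightarrow> f i \<in> e i ` {-R..R}) \<Longrightarrow> (\<Sum>i<n. f i) \<in> D1"
    using compact_sum_set[of "{..<n}" "\<lambda>i. e i ` {-R..R}"]
    by (metis (no_types, lifting) finite_lessThan lessThan_iff compact_continuous_image compact_Icc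
        continuous_on_subset[OF one_paramD(1)[OF e_sub]] subset_UNIV)
  obtain D2 where D2: "compact D2" "\<And>f. (\<And>i. i < p \<Longrightarrow> f i \<in> \<tau> i ` {-pi..pi}) \<Longrightarrow> (\<Sum>i<p. f i) \<in> D2"
    using compact_sum_set[of "{..<p}" "\<lambda>i. \<tau> i ` {-pi..pi}"]
    by (metis (no_types, lifting) finite_lessThan lessThan_iff compact_continuous_image compact_Icc
        continuous_on_subset[OF one_paramD(1)[OF \<tau>_sub]] subset_UNIV)
  obtain D3 where D3: "compact D3" "\<And>f. (\<And>i. i < q \<Longrightarrow> f i \<in> \<iota> i ` {-\<lceil>R\<rceil>..\<lceil>R\<rceil>}) \<Longrightarrow> (\<Sum>i<q. f i) \<in> D3"
    using compact_sum_set[of "{..<q}" "\<lambda>i. \<iota> i ` {-\<lceil>R\<rceil>..\<lceil>R\<rceil>}"]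
    by (metis (no_types, lifting) finite_lessThan lessThan_iff finite_imp_compact finite_imageI finite_atLeastAtMost_int)
  define D where "D = {a + b |a b. a \<in> {a + b |a b. a \<in> {a + b |a b. a \<in> D1 \<and> b \<in> D2} \<and> b \<in> D3} \<and> b \<in> range pf}"
  have "compact D" unfolding D_def
    by (intro compact_plus_set D1 D2 D3 finite_imp_compact pf_finite)
  have "s \<in> D" if "hom_weight IG hG s \<le> R" for s
  proof -
    have h: "\<bar>hG i s\<bar> \<le> R" if "i \<in> IG" for i
    proof -
      have "\<bar>hG i s\<bar> \<le> 1 + (hG i s)\<^sup>2"
        using sum_squares_bound[of "\<bar>hG i s\<bar>" 1] by simp
      then show ?thesis
        using hom_weight_factor_le[OF finite_IG that, of hG s] \<open>hom_weight IG hG s \<le> R\<close> by linarith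
    qed
    have "\<bar>x i s\<bar> \<le> R" if "i < n" for i using h[of "Inl i"] that by (auto simp: IG_def hG_def)
    then have 1: "(\<Sum>i<n. e i (x i s)) \<in> D1" by (intro D1(2) imageI) (simp add: abs_le_iff minus_le_iff)
    have 2: "(\<Sum>j<p. \<tau> j (Arg (char_of (z j) s))) \<in> D2"
      using Arg_bounded by (intro D2(2) imageI) (auto intro: less_imp_le)
    have "\<bar>real_of_int (k j s)\<bar> \<le> R" if "j < q" for j using h[of "Inr j"] that by (auto simp: IG_def hG_def)
    then have "\<bar>k j s\<bar> \<le> \<lceil>R\<rceil>" if "j < q" for j
      using that by (metis le_of_int_ceiling of_int_abs of_int_le_iff order_trans)
    then have 3: "(\<Sum>j<q. \<iota> j (k j s)) \<in> D3" by (intro D3(2) imageI) (simp add: abs_le_iff minus_le_iff)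
    show "s \<in> D" unfolding D_def using 1 2 3 decomp[of s] by blast
  qed
  then have "{s. hom_weight IG hG s \<le> R} = D \<inter> {s. hom_weight IG hG s \<le> R}" by auto
  moreover have "closed {s. hom_weight IG hG s \<le> R}"
    by (intro closed_Collect_le continuous_hom_weight hG_hom continuous_intros)
  ultimately show ?thesis using \<open>compact D\<close> by (metis compact_Int_closed)
qed

lemma box_subset_sublevel: "{s. \<forall>i\<in>IG. 0 \<le> hG i s \<and> hG i s < 1} \<subseteq> {s. hom_weight IG hG s \<le> 2 ^ card IG}"
proof safe
  fix s assume s: "\<forall>i\<in>IG. 0 \<le> hG i s \<and> hG i s < 1"
  have "hom_weight IG hG s \<le> (\<Prod>i\<in>IG. 2)" unfolding hom_weight_def
    using s by (intro prod_mono) (auto simp: power2_eq_square intro!: mult_le_one)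
  then show "hom_weight IG hG s \<le> 2 ^ card IG" by simp
qed

lemma integrable_weight_G:
  assumes "haar_measure \<mu>"
  shows "(\<integral>\<^sup>+s. ennreal (1 / hom_weight IG hG s) \<partial>\<mu>) < \<infinity>"
proof (rule nn_integral_weight_finite[OF assms finite_IG hG_hom hG_aG])
  have "emeasure \<mu> {s. \<forall>i\<in>IG. 0 \<le> hG i s \<and> hG i s < 1} \<le> emeasure \<mu> {s. hom_weight IG hG s \<le> 2 ^ card IG}"
    using box_subset_sublevel compact_weight_sublevel
    by (intro emeasure_mono) (auto simp: haar_measureD[OF assms] intro!: borel_closed compact_imp_closed)
  also have "\<dots> < \<infinity>" by (intro haar_measureD(6)[OF assms] compact_weight_sublevel)
  finally show "emeasure \<mu> {s. \<forall>i\<in>IG. 0 \<le> hG i s \<and> hG i s < 1} < \<infinity>" .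
qed

section \<open>Exponents of characters and the unit box of the dual\<close>

lemma freq_\<tau>_int:
  assumes "j < p"
  shows "\<exists>m. freq (\<tau> j) c = of_int m"
proof -
  have "cis (2 * pi * freq (\<tau> j) c) = 1"
    using char_of_one_param[OF \<tau>_sub[OF assms], of c "2 * pi"] \<tau>_period[OF assms] by simp
  then obtain m where "2 * pi * freq (\<tau> j) c = of_int m * (2 * pi)"
    using cos_one_2pi_int[of "2 * pi * freq (\<tau> j) c"] by (auto simp: complex_eq_iff)
  then show ?thesis by auto
qed

lemma char_of_decomp:
  "char_of c s = cis (\<Sum>i<n. x i s * freq (e i) c) * cis (\<Sum>j<p. Arg (char_of (z j) s) * freq (\<tau> j) c)
    * (\<Prod>j<q. char_of c (\<iota> j (k j s))) * char_of c (pf s)"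
proof -
  have "char_of c s = char_of c ((\<Sum>i<n. e i (x i s)) + (\<Sum>j<p. \<tau> j (Arg (char_of (z j) s)))
        + (\<Sum>j<q. \<iota> j (k j s)) + pf s)" using decomp[of s] by simp
  also have "\<dots> = (\<Prod>i<n. char_of c (e i (x i s))) * (\<Prod>j<p. char_of c (\<tau> j (Arg (char_of (z j) s))))
      * (\<Prod>j<q. char_of c (\<iota> j (k j s))) * char_of c (pf s)"
    by (simp only: char_of_add char_of_sum)
  also have "(\<Prod>i<n. char_of c (e i (x i s))) = cis (\<Sum>i<n. x i s * freq (e i) c)"
    unfolding prod_cis[symmetric] by (intro prod.cong refl char_of_one_param e_sub) auto
  also have "(\<Prod>j<p. char_of c (\<tau> j (Arg (char_of (z j) s)))) = cis (\<Sum>j<p. Arg (char_of (z j) s) * freq (\<tau> j) c)"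
    unfolding prod_cis[symmetric] by (intro prod.cong refl char_of_one_param \<tau>_sub) auto
  finally show ?thesis .
qed

lemma pf_0: "pf 0 = 0"
  using pf_add[of 0 0] by simp

lemma \<iota>_0: "j < q \<Longrightarrow> \<iota> j 0 = 0"
  using \<iota>_add[of j 0 0] by simp

text \<open>The complement is the preimage of a finite set, which is closed in a Hausdorff
  space.\<close>

lemma open_pf_kernel: "open {s. pf s = 0}"
proof -
  have "closed (pf -` (range pf - {0}))"
    using pf_finite by (intro closed_vimage pf_cont finite_imp_closed) auto
  moreover have "{s. pf s = 0} = - (pf -` (range pf - {0}))" by auto
  ultimately show ?thesis by (simp add: open_closed)
qed

text \<open>On the box, the Fourier transform of the indicator function of a small neighbourhood \<open>U\<close> of \<open>0\<close> is at
  least half of the measure of \<open>U\<close>, so Plancherel's theorem bounds the measure of the box.\<close>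

lemma dual_box_finite:
  assumes \<mu>: "haar_measure \<mu>" and \<nu>: "haar_measure \<nu>" and pl: "plancherel \<mu> \<nu>"
  shows "emeasure \<nu> {c. \<forall>i\<in>ID. 0 \<le> hD i c \<and> hD i c < 1} < \<infinity>"
proof -
  note M = haar_measureD[OF \<mu>]
  note N = haar_measureD[OF \<nu>]
  have "\<exists>V K. open V \<and> compact K \<and> (0 :: 'g) \<in> V \<and> V \<subseteq> K"
    by (rule locallyE[OF lc, of UNIV 0]) auto
  then obtain V and K :: "'g set" where V: "open V" "compact K" "0 \<in> V" "V \<subseteq> K" by blast
  \<comment> \<open>The bound \<open>1 / (n + 1)\<close> keeps the total real phase of a character
    from the box at most 1 on \<open>U\<close>. The next two conditions remove the integer and
    finite coordinates, and \<open>V\<close> makes the measure finite.\<close>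
  define U where "U = {s. \<forall>i<n. \<bar>x i s\<bar> < 1 / (real n + 1)} \<inter> {s. \<forall>j<q. \<bar>real_of_int (k j s)\<bar> < 1} \<inter> {s. pf s = 0} \<inter> V"
  have "open {s. \<forall>i<n. \<bar>x i s\<bar> < 1 / (real n + 1)}"
  proof -
    have "{s. \<forall>i<n. \<bar>x i s\<bar> < 1 / (real n + 1)} = (\<Inter>i<n. {s. \<bar>x i s\<bar> < 1 / (real n + 1)})" by auto
    moreover have "open {s. \<bar>x i s\<bar> < 1 / (real n + 1)}" if "i < n" for i
      by (intro open_Collect_less continuous_intros continuous_on_rabs real_homsD(1)[OF x_hom] that)
    ultimately show ?thesis by (auto intro!: open_INT)
  qed
  moreover have "open {s. \<forall>j<q. \<bar>real_of_int (k j s)\<bar> < 1}"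
  proof -
    have "{s. \<forall>j<q. \<bar>real_of_int (k j s)\<bar> < 1} = (\<Inter>j<q. {s. \<bar>real_of_int (k j s)\<bar> < 1})" by auto
    moreover have "open {s. \<bar>real_of_int (k j s)\<bar> < 1}" if "j < q" for j
      by (intro open_Collect_less continuous_intros continuous_on_rabs real_homsD(1)[OF k_hom] that)
    ultimately show ?thesis by (auto intro!: open_INT)
  qed
  ultimately have "open U" unfolding U_def using open_pf_kernel V by (intro open_Int)
  have "0 \<in> U" unfolding U_def using V by (simp add: real_homsD(3)[OF x_hom] real_homsD(3)[OF k_hom] pf_0)
  have Um: "U \<in> sets \<mu>" using \<open>open U\<close> by (simp add: M)
  have "emeasure \<mu> U \<le> emeasure \<mu> K"
    using V by (intro emeasure_mono) (auto simp: U_def M intro!: borel_closed compact_imp_closed)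
  then have Ufin: "emeasure \<mu> U < \<infinity>" using M(6)[OF V(2)] by (rule le_less_trans)
  have Upos: "0 < emeasure \<mu> U" using \<open>open U\<close> \<open>0 \<in> U\<close> by (intro M(7)) auto
  define m where "m = measure \<mu> U"
  have m: "0 < m" using Ufin Upos unfolding m_def by (simp add: measure_def enn2real_positive_iff)
  define f where "f s = (of_real (indicator U s) :: complex)" for s
  have fi: "integrable \<mu> f" unfolding f_def using Um Ufin by (intro integrable_of_real integrable_real_indicator)
  have "(norm (f s))\<^sup>2 = indicator U s" for s by (auto simp: f_def indicator_def)
  then have fL: "f \<in> L2 \<mu>" unfolding L2_def using fi Um Ufin by (auto intro: integrable_real_indicator)
  have "fourier \<mu> f \<in> L2 \<nu>" using pl fi fL unfolding plancherel_def by blast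
  then have Fi: "integrable \<nu> (\<lambda>c. (norm (fourier \<mu> f c))\<^sup>2)" and Fm: "fourier \<mu> f \<in> borel_measurable \<nu>"
    by (auto simp: L2_def)
  have ge: "m / 2 \<le> norm (fourier \<mu> f c)" if c: "\<forall>i\<in>ID. 0 \<le> hD i c \<and> hD i c < 1" for c
  proof -
    have cR: "1 / 2 \<le> Re (char_of c s)" if s: "s \<in> U" for s
    proof -
      have fr: "0 \<le> freq (e i) c \<and> freq (e i) c < 1" if "i < n" for i
        using c[rule_format, of "Inl i"] that by (auto simp: ID_def hD_def)
      \<comment> \<open>The winding numbers are integers, and in the box they are at least 0 and
        less than 1.\<close>
      have "freq (\<tau> j) c = 0" if j: "j < p" for j
      proof -
        obtain m where "freq (\<tau> j) c = of_int m" using freq_\<tau>_int[OF j] by blast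
        moreover have "Inr j \<in> ID" using j by (auto simp: ID_def)
        ultimately show ?thesis using c[rule_format, of "Inr j"] by (auto simp: hD_def)
      qed
      moreover have "k j s = 0" if "j < q" for j using s that by (auto simp: U_def)
      ultimately have cs: "char_of c s = cis (\<Sum>i<n. x i s * freq (e i) c)"
        using s char_of_decomp[of c s] by (simp add: \<iota>_0 U_def)
      have "\<bar>\<Sum>i<n. x i s * freq (e i) c\<bar> \<le> (\<Sum>i<n. \<bar>x i s * freq (e i) c\<bar>)" by (rule sum_abs)
      also have "\<dots> \<le> (\<Sum>i<n. 1 / (real n + 1))"
      proof (rule sum_mono)
        fix i assume i: "i \<in> {..<n}"
        have "\<bar>x i s\<bar> < 1 / (real n + 1)" using s i by (auto simp: U_def)
        then have "\<bar>x i s\<bar> * \<bar>freq (e i) c\<bar> \<le> 1 / (real n + 1) * 1"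
          using fr[of i] i by (intro mult_mono) auto
        then show "\<bar>x i s * freq (e i) c\<bar> \<le> 1 / (real n + 1)" by (simp add: abs_mult)
      qed
      also have "\<dots> \<le> 1" by simp
      \<comment> \<open>\<open>cos (pi / 3) = 1 / 2\<close> is the origin of the factor one half in
        the lower bound for the transform.\<close>
      also have "\<dots> \<le> pi / 3" using pi_gt3 by simp
      finally have le: "\<bar>\<Sum>i<n. x i s * freq (e i) c\<bar> \<le> pi / 3" .
      have "cos (pi / 3) \<le> cos \<bar>\<Sum>i<n. x i s * freq (e i) c\<bar>"
        using le by (intro cos_monotone_0_pi_le) auto
      then show ?thesis unfolding cs by (simp add: cos_60)
    qed
    have int: "integrable \<mu> (\<lambda>s. f s * cnj (char_of c s))"
    proof (rule Bochner_Integration.integrable_bound[OF fi])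
      have "(\<lambda>s. cnj (char_of c s)) \<in> borel_measurable borel"
        by (intro borel_measurable_continuous_onI continuous_intros char_of_cont)
      moreover have "f \<in> borel_measurable \<mu>" using fi by auto
      ultimately show "(\<lambda>s. f s * cnj (char_of c s)) \<in> borel_measurable \<mu>" by (simp add: M)
    qed (simp add: norm_mult)
    have "m / 2 = (LINT s|\<mu>. indicator U s * (1 / 2))" by (simp add: m_def M)
    also have "\<dots> \<le> (LINT s|\<mu>. Re (f s * cnj (char_of c s)))"
    proof (rule integral_mono)
      show "integrable \<mu> (\<lambda>s. indicator U s * (1 / 2 :: real))"
        using Um Ufin by (intro integrable_mult_left integrable_real_indicator)
      show "integrable \<mu> (\<lambda>s. Re (f s * cnj (char_of c s)))" using int by (rule integrable_Re)
    qed (use cR in \<open>auto simp: f_def indicator_def\<close>)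
    also have "\<dots> = Re (fourier \<mu> f c)" unfolding fourier_def using int by (rule integral_Re)
    also have "\<dots> \<le> norm (fourier \<mu> f c)" by (rule complex_Re_le_cmod)
    finally show ?thesis .
  qed
  \<comment> \<open>Chebyshev's inequality: the box lies where the transform has modulus at least
    \<open>m / 2\<close>, and the squared modulus has a finite integral.\<close>
  define A where "A = {c \<in> space \<nu>. (m / 2)\<^sup>2 \<le> (norm (fourier \<mu> f c))\<^sup>2}"
  have Am: "A \<in> sets \<nu>" unfolding A_def using Fm by measurable
  have "emeasure \<nu> {c. \<forall>i\<in>ID. 0 \<le> hD i c \<and> hD i c < 1} \<le> emeasure \<nu> A"
    using ge m by (intro emeasure_mono Am) (auto simp: A_def N intro!: power_mono)
  also have "emeasure \<nu> A < \<infinity>"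
  proof -
    have "ennreal ((m / 2)\<^sup>2) * emeasure \<nu> A = (\<integral>\<^sup>+c. ennreal ((m / 2)\<^sup>2) * indicator A c \<partial>\<nu>)"
      using Am by (rule nn_integral_cmult_indicator[symmetric])
    also have "\<dots> \<le> (\<integral>\<^sup>+c. ennreal ((norm (fourier \<mu> f c))\<^sup>2) \<partial>\<nu>)"
      by (intro nn_integral_mono) (auto simp: A_def indicator_def intro!: ennreal_leI)
    also have "\<dots> < \<infinity>" using Fi by (simp add: integrable_iff_bounded)
    finally show ?thesis using m by (auto simp: ennreal_mult_less_top ennreal_mult_eq_top_iff less_top)
  qed
  finally show ?thesis .
qed

lemma integrable_weight_D:
  assumes "haar_measure \<mu>" "haar_measure \<nu>" "plancherel \<mu> \<nu>"
  shows "(\<integral>\<^sup>+c. ennreal (1 / hom_weight ID hD c) \<partial>\<nu>) < \<infinity>"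
  by (rule nn_integral_weight_finite[OF assms(2) finite_ID hD_hom hD_aD dual_box_finite[OF assms]])

section \<open>Real homomorphisms of the dual as one-parameter subgroups of the group\<close>

definition zpow :: "nat \<Rightarrow> int \<Rightarrow> 'g dual" where
  "zpow j m = Dual (\<lambda>s. char_of (z j) s powi m)"

lemma char_of_zpow [simp]: "char_of (zpow j m) s = char_of (z j) s powi m"
  unfolding zpow_def
  by (subst Dual_inverse)
    (auto simp: norm_power_int char_of_add power_int_mult_distrib intro!: continuous_intros char_of_cont)

definition pullpf :: "'g dual \<Rightarrow> 'g dual" where
  "pullpf c = Dual (\<lambda>s. char_of c (pf s))"

lemma char_of_pullpf [simp]: "char_of (pullpf c) s = char_of c (pf s)"
  unfolding pullpf_def
  by (subst Dual_inverse)
    (auto simp: char_of_add pf_add intro!: continuous_on_compose2[OF char_of_cont pf_cont])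

text \<open>\<open>pullpf c\<close> has finite order: translating the product of the values of \<open>c\<close> over the finite subgroup
  \<open>range pf\<close> by an element \<open>g\<close> shows that \<open>char_of c g\<close> is a root of unity.\<close>

lemma real_hom_pullpf:
  assumes H: "H \<in> real_homs"
  shows "H (pullpf c) = 0"
proof -
  define R where "R = range pf"
  have fin: "finite R" and ne: "R \<noteq> {}" using pf_finite by (auto simp: R_def)
  have tr: "char_of c g ^ card R = 1" if "g \<in> R" for g
  proof -
    have "bij_betw (\<lambda>f. f + g) R R"
    proof (rule bij_betwI')
      show "f + g \<in> R" if "f \<in> R" for f using that \<open>g \<in> R\<close> by (auto simp: R_def pf_add[symmetric])
      show "\<exists>f\<in>R. y = f + g" if y: "y \<in> R" for y
      proof -
        obtain a b where "y = pf a" "g = pf b" using y \<open>g \<in> R\<close> by (auto simp: R_def)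
        moreover have "pf (a - b) + pf b = pf a" using pf_add[of "a - b" b] by simp
        ultimately show ?thesis by (intro bexI[of _ "pf (a - b)"]) (auto simp: R_def)
      qed
    qed simp
    then have "(\<Prod>f\<in>R. char_of c f) = (\<Prod>f\<in>R. char_of c (f + g))"
      by (rule prod.reindex_bij_betw[symmetric])
    also have "\<dots> = (\<Prod>f\<in>R. char_of c f) * char_of c g ^ card R"
      by (simp add: char_of_add prod.distrib)
    finally show ?thesis using fin by simp
  qed
  have "(\<Sum>i<card R. pullpf c) = 0"
    by (rule dual_eqI) (simp add: char_of_sum_dual tr[unfolded R_def] R_def)
  then have "real (card R) * H (pullpf c) = 0"
    using real_homs_sum[OF H, of "\<lambda>_. pullpf c" "{..<card R}"] real_homsD(3)[OF H] by simp
  then show ?thesis using fin ne by simp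
qed

lemma real_hom_exp_char:
  assumes H: "H \<in> real_homs" and h: "h \<in> real_homs"
  shows "H (exp_char (\<lambda>s. y * h s)) = y * H (exp_char h)"
proof -
  note o = one_paramD[OF exp_char_one_param[OF h]]
  have "continuous_on UNIV (\<lambda>y. H (exp_char (\<lambda>s. y * h s)))"
    by (rule continuous_on_compose2[OF real_homsD(1)[OF H] o(1)]) auto
  from continuous_additive_linear[OF this, of y] show ?thesis
    by (simp add: o(2) real_homsD(2)[OF H])
qed

text \<open>Pontryagin duality in coordinates: the real factors are self-dual, winding numbers
  describe characters of the circles, and a character of the integers is determined by its value at
  1.\<close>

lemma dual_decomp:
  "c = (\<Sum>i<n. exp_char (\<lambda>s. freq (e i) c * x i s)) + (\<Sum>j<p. zpow j \<lfloor>freq (\<tau> j) c\<rfloor>)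
    + (\<Sum>j<q. exp_char (\<lambda>s. Arg (char_of c (\<iota> j 1)) * real_of_int (k j s))) + pullpf c"
proof (rule dual_eqI)
  fix s
  have "char_of (exp_char (\<lambda>s. freq (e i) c * x i s)) s = cis (x i s * freq (e i) c)" if "i < n" for i
    unfolding char_of_exp_char[OF real_homs_scale[OF x_hom[OF that]]] by (simp add: mult.commute)
  then have 1: "(\<Prod>i<n. char_of (exp_char (\<lambda>s. freq (e i) c * x i s)) s) = cis (\<Sum>i<n. x i s * freq (e i) c)"
    unfolding prod_cis[symmetric] by (intro prod.cong) auto
  have "char_of (z j) s powi \<lfloor>freq (\<tau> j) c\<rfloor> = cis (Arg (char_of (z j) s) * freq (\<tau> j) c)" if j: "j < p" for j
  proof -
    \<comment> \<open>The floor in \<open>zpow\<close> is exact because the winding number is an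
      integer.\<close>
    obtain m where m: "freq (\<tau> j) c = of_int m" using freq_\<tau>_int[OF j, of c] by blast
    have "cis (Arg (char_of (z j) s)) = char_of (z j) s"
      by (simp add: cis_Arg sgn_eq)
    then show ?thesis by (metis m cis_power_int floor_of_int mult.commute)
  qed
  then have 2: "(\<Prod>j<p. char_of (zpow j \<lfloor>freq (\<tau> j) c\<rfloor>) s) = cis (\<Sum>j<p. Arg (char_of (z j) s) * freq (\<tau> j) c)"
    unfolding prod_cis[symmetric] by (intro prod.cong) auto
  have "char_of (exp_char (\<lambda>s. Arg (char_of c (\<iota> j 1)) * real_of_int (k j s))) s = char_of c (\<iota> j (k j s))" if "j < q" for j
  proof -
    have u: "cis (Arg (char_of c (\<iota> j 1))) = char_of c (\<iota> j 1)"
      by (simp add: cis_Arg sgn_eq)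
    have nat: "char_of c (\<iota> j (int m)) = char_of c (\<iota> j 1) ^ m" for m
      by (induction m) (auto simp: \<iota>_0[OF that] \<iota>_add[OF that] char_of_add)
    have neg: "\<iota> j (- a) = - \<iota> j a" for a
      using \<iota>_add[OF that, of a "- a"] \<iota>_0[OF that] by (simp add: eq_neg_iff_add_eq_0 add.commute)
    have inv: "cnj (char_of c (\<iota> j 1) ^ m) = inverse (char_of c (\<iota> j 1) ^ m)" for m
      unfolding inverse_eq_divide by (subst divide_conv_cnj) (simp_all add: norm_power)
    have "char_of c (\<iota> j m) = char_of c (\<iota> j 1) powi m" for m
      by (cases m rule: int_cases2) (simp_all add: nat neg char_of_uminus power_int_minus inv del: complex_cnj_power)
    then have "char_of c (\<iota> j (k j s)) = cis (of_int (k j s) * Arg (char_of c (\<iota> j 1)))"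
      unfolding cis_power_int[symmetric] u .
    then show ?thesis
      unfolding char_of_exp_char[OF real_homs_scale[OF k_hom[OF that]]] by (simp only: mult.commute)
  qed
  then have 3: "(\<Prod>j<q. char_of (exp_char (\<lambda>s. Arg (char_of c (\<iota> j 1)) * real_of_int (k j s))) s) =
      (\<Prod>j<q. char_of c (\<iota> j (k j s)))" by (intro prod.cong) auto
  show "char_of c s = char_of ((\<Sum>i<n. exp_char (\<lambda>s. freq (e i) c * x i s)) + (\<Sum>j<p. zpow j \<lfloor>freq (\<tau> j) c\<rfloor>)
    + (\<Sum>j<q. exp_char (\<lambda>s. Arg (char_of c (\<iota> j 1)) * real_of_int (k j s))) + pullpf c) s"
    unfolding char_of_plus_dual char_of_sum_dual 1 2 3 char_of_pullpf by (rule char_of_decomp)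
qed

text \<open>By \<open>dual_decomp\<close>, \<open>H\<close> is determined by its values
  \<open>\<alpha> i\<close> and \<open>\<beta> j\<close> on the real and winding directions, since
  it vanishes on the other two components. The subgroup \<open>\<phi>\<close> moves along
  \<open>e i\<close> and \<open>\<tau> j\<close> at these speeds. Multiplication by \<open>H\<close>
  on the dual can thereby be traded for differentiation along \<open>\<phi>\<close>.\<close>

lemma real_hom_dual_one_param:
  assumes H: "H \<in> real_homs"
  obtains \<phi> where "\<phi> \<in> one_param_subgroups" "\<And>c r. char_of c (\<phi> r :: 'g) = cis (r * H c)"
proof -
  define \<alpha> where "\<alpha> i = H (exp_char (x i))" for i
  define \<beta> where "\<beta> j = H (z j)" for j
  have He: "H (exp_char (\<lambda>s. y * x i s)) = y * \<alpha> i" if "i < n" for i y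
    unfolding \<alpha>_def by (rule real_hom_exp_char[OF H x_hom[OF that]])
  have Hz: "H (zpow j m) = of_int m * \<beta> j" for j m
  proof -
    have "zpow j (a + b) = zpow j a + zpow j b" for a b
      by (rule dual_eqI) (simp add: power_int_add)
    then have add: "H (zpow j (a + b)) = H (zpow j a) + H (zpow j b)" for a b
      by (simp add: real_homsD(2)[OF H])
    have z1: "zpow j 1 = z j" by (rule dual_eqI) simp
    have z0: "H (zpow j 0) = 0" using add[of 0 0] by simp
    have neg: "H (zpow j (- a)) = - H (zpow j a)" for a using add[of a "- a"] z0 by simp
    have nat: "H (zpow j (int a)) = real a * \<beta> j" for a
      by (induction a) (auto simp: z0 add z1 \<beta>_def algebra_simps)
    show ?thesis by (cases m rule: int_cases2) (auto simp: nat neg)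
  qed
  have Hk: "H (exp_char (\<lambda>s. y * real_of_int (k j s))) = 0" if "j < q" for j y
  proof -
    \<comment> \<open>This family of characters closes up at \<open>y = 2 * pi\<close>, and a linear
      function of \<open>y\<close> that vanishes there is zero.\<close>
    have "exp_char (\<lambda>s. 2 * pi * real_of_int (k j s)) = 0"
      by (rule dual_eqI) (simp add: char_of_exp_char[OF real_homs_scale[OF k_hom[OF that]]])
    then show ?thesis
      using real_hom_exp_char[OF H k_hom[OF that]] real_homsD(3)[OF H]
      by (metis mult_eq_0_iff pi_neq_zero zero_neq_numeral)
  qed
  define \<phi> where "\<phi> r = (\<Sum>i<n. e i (r * \<alpha> i)) + (\<Sum>j<p. \<tau> j (r * \<beta> j))" for r
  have "\<phi> \<in> one_param_subgroups"
    unfolding one_param_subgroups_def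
  proof (intro CollectI conjI allI)
    show "continuous_on UNIV \<phi>"
      unfolding \<phi>_def
      by (intro continuous_on_add continuous_on_sum)
        (auto intro!: continuous_on_compose2[OF one_paramD(1)[OF e_sub]]
          continuous_on_compose2[OF one_paramD(1)[OF \<tau>_sub]] continuous_intros)
    show "\<phi> (r + r') = \<phi> r + \<phi> r'" for r r'
      by (simp add: \<phi>_def one_paramD(2)[OF e_sub] one_paramD(2)[OF \<tau>_sub]
          distrib_right sum.distrib algebra_simps)
  qed
  moreover have "char_of c (\<phi> r) = cis (r * H c)" for c r
  proof -
    have "H c = (\<Sum>i<n. freq (e i) c * \<alpha> i) + (\<Sum>j<p. freq (\<tau> j) c * \<beta> j)"
    proof -
      have "H c = H ((\<Sum>i<n. exp_char (\<lambda>s. freq (e i) c * x i s)) + (\<Sum>j<p. zpow j \<lfloor>freq (\<tau> j) c\<rfloor>)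
          + (\<Sum>j<q. exp_char (\<lambda>s. Arg (char_of c (\<iota> j 1)) * real_of_int (k j s))) + pullpf c)"
        by (rule arg_cong[OF dual_decomp])
      also have "\<dots> = (\<Sum>i<n. freq (e i) c * \<alpha> i) + (\<Sum>j<p. of_int \<lfloor>freq (\<tau> j) c\<rfloor> * \<beta> j)"
        by (simp add: real_homsD(2)[OF H] real_homs_sum[OF H] He Hz Hk real_hom_pullpf[OF H])
      also have "(\<Sum>j<p. of_int \<lfloor>freq (\<tau> j) c\<rfloor> * \<beta> j) = (\<Sum>j<p. freq (\<tau> j) c * \<beta> j)"
      proof (intro sum.cong refl)
        fix j assume "j \<in> {..<p}"
        then obtain m where "freq (\<tau> j) c = of_int m" using freq_\<tau>_int[of j c] by auto
        then show "of_int \<lfloor>freq (\<tau> j) c\<rfloor> * \<beta> j = freq (\<tau> j) c * \<beta> j" by simp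
      qed
      finally show ?thesis .
    qed
    moreover have "char_of c (\<phi> r) = cis (\<Sum>i<n. r * \<alpha> i * freq (e i) c) * cis (\<Sum>j<p. r * \<beta> j * freq (\<tau> j) c)"
      unfolding \<phi>_def char_of_add char_of_sum prod_cis[symmetric]
      by (intro arg_cong2[of _ _ _ _ "(*)"] prod.cong refl char_of_one_param e_sub \<tau>_sub) auto
    ultimately show ?thesis
      by (simp add: cis_mult distrib_left sum_distrib_left mult_ac)
  qed
  ultimately show ?thesis by (rule that)
qed

end

section \<open>Differentiation under the integral\<close>

lemma norm_integral_le:
  fixes f :: "'a \<Rightarrow> complex"
  assumes "integrable M f" "integrable M g" "\<And>x. norm (f x) \<le> g x"
  shows "norm (LINT x|M. f x) \<le> (LINT x|M. g x)"
  using assms by (intro order_trans[OF integral_norm_bound] integral_mono integrable_norm)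

lemma borel_measurable_cnj [measurable (raw)]:
  "f \<in> borel_measurable M \<Longrightarrow> (\<lambda>x. cnj (f x)) \<in> borel_measurable M"
  by (rule measurable_compose[where g = cnj and N = borel])
    (auto intro!: borel_measurable_continuous_onI continuous_intros)

lemma has_vector_derivative_0_iff:
  fixes f :: "real \<Rightarrow> complex"
  shows "(f has_vector_derivative d) (at 0) \<longleftrightarrow> ((\<lambda>h. (f h - f 0) /\<^sub>R h) \<longlongrightarrow> d) (at 0)"
proof -
  have "(f has_vector_derivative d) (at 0) \<longleftrightarrow> ((\<lambda>h. norm (f h - f 0 - h *\<^sub>R d) / norm h) \<longlongrightarrow> 0) (at 0)"
    unfolding has_vector_derivative_def has_derivative_at
    by (auto intro: bounded_linear_scaleR_left)
  also have "\<dots> \<longleftrightarrow> ((\<lambda>h. norm ((f h - f 0) /\<^sub>R h - d)) \<longlongrightarrow> 0) (at 0)"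
  proof (intro filterlim_cong refl)
    show "\<forall>\<^sub>F h in at 0. norm (f h - f 0 - h *\<^sub>R d) / norm h = norm ((f h - f 0) /\<^sub>R h - d)"
      unfolding eventually_at_filter
    proof (intro always_eventually allI impI)
      fix h :: real assume "h \<noteq> 0"
      then have "(f h - f 0) /\<^sub>R h - d = (f h - f 0 - h *\<^sub>R d) /\<^sub>R h"
        by (simp add: scaleR_diff_right)
      then show "norm (f h - f 0 - h *\<^sub>R d) / norm h = norm ((f h - f 0) /\<^sub>R h - d)"
        by (simp add: divide_inverse mult.commute)
    qed
  qed
  also have "\<dots> \<longleftrightarrow> ((\<lambda>h. (f h - f 0) /\<^sub>R h) \<longlongrightarrow> d) (at 0)"
    by (simp add: tendsto_norm_zero_iff LIM_zero_iff)
  finally show ?thesis .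
qed

text \<open>Dominated convergence for the difference quotients along an arbitrary null sequence. The
  increments are dominated for \<open>\<bar>r\<bar> \<le> 1\<close>, so an initial segment of the
  sequence is dropped.\<close>

lemma has_vector_derivative_integral:
  fixes K :: "real \<Rightarrow> 'a \<Rightarrow> complex"
  assumes int0: "integrable M (K 0)" and meas: "\<And>r. K r \<in> borel_measurable M" "K' \<in> borel_measurable M"
    and deriv: "\<And>s. ((\<lambda>r. K r s) has_vector_derivative K' s) (at 0)"
    and bound: "\<And>r s. \<bar>r\<bar> \<le> 1 \<Longrightarrow> norm (K r s - K 0 s) \<le> g s * \<bar>r\<bar>" and g: "integrable M g"
  shows "((\<lambda>r. LINT s|M. K r s) has_vector_derivative (LINT s|M. K' s)) (at 0)"
  unfolding has_vector_derivative_0_iff tendsto_at_iff_sequentially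
proof (intro allI impI)
  fix X :: "nat \<Rightarrow> real" assume X: "\<forall>i. X i \<in> UNIV - {0}" "X \<longlonglongrightarrow> 0"
  then have "\<forall>\<^sub>F i in sequentially. \<bar>X i\<bar> \<le> 1"
    by (auto dest!: tendstoD[of _ _ _ 1] elim!: eventually_mono)
  then obtain N where N: "\<And>i. \<bar>X (i + N)\<bar> \<le> 1"
    by (auto simp: eventually_sequentially) (metis le_add2)
  have int: "integrable M (K r)" if "\<bar>r\<bar> \<le> 1" for r
  proof -
    have "integrable M (\<lambda>s. K r s - K 0 s)"
    proof (rule Bochner_Integration.integrable_bound[OF integrable_mult_right[OF integrable_norm[OF g], of "\<bar>r\<bar>"]])
      show "AE s in M. norm (K r s - K 0 s) \<le> norm (\<bar>r\<bar> * norm (g s))"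
      proof (intro AE_I2)
        fix s
        have "norm (K r s - K 0 s) \<le> \<bar>g s * \<bar>r\<bar>\<bar>" using bound[OF that, of s] by linarith
        then show "norm (K r s - K 0 s) \<le> norm (\<bar>r\<bar> * norm (g s))" by (simp add: abs_mult mult.commute)
      qed
    qed (use meas in measurable)
    from Bochner_Integration.integrable_add[OF this int0] show ?thesis by simp
  qed
  have "(\<lambda>i. LINT s|M. (K (X (i + N)) s - K 0 s) /\<^sub>R X (i + N)) \<longlonglongrightarrow> (LINT s|M. K' s)"
  proof (rule integral_dominated_convergence[where w = g])
    show "(\<lambda>s. (K (X (i + N)) s - K 0 s) /\<^sub>R X (i + N)) \<in> borel_measurable M" for i
      using meas(1) by measurable
    show "AE s in M. (\<lambda>i. (K (X (i + N)) s - K 0 s) /\<^sub>R X (i + N)) \<longlonglongrightarrow> K' s"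
    proof (intro AE_I2)
      fix s
      have "((\<lambda>h. (K h s - K 0 s) /\<^sub>R h) \<circ> X) \<longlonglongrightarrow> K' s"
        using deriv[of s] X unfolding has_vector_derivative_0_iff tendsto_at_iff_sequentially by blast
      from LIMSEQ_ignore_initial_segment[OF this, of N]
      show "(\<lambda>i. (K (X (i + N)) s - K 0 s) /\<^sub>R X (i + N)) \<longlonglongrightarrow> K' s" by (simp add: o_def)
    qed
    show "AE s in M. norm ((K (X (i + N)) s - K 0 s) /\<^sub>R X (i + N)) \<le> g s" for i
    proof (intro AE_I2)
      fix s
      have "X (i + N) \<noteq> 0" using X by auto
      then show "norm ((K (X (i + N)) s - K 0 s) /\<^sub>R X (i + N)) \<le> g s"
        using bound[OF N[of i], of s] by (simp add: divide_le_eq inverse_eq_divide del: scaleR_diff_right)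
    qed
  qed (use meas g in auto)
  moreover have "(LINT s|M. (K (X (i + N)) s - K 0 s) /\<^sub>R X (i + N)) =
      ((LINT s|M. K (X (i + N)) s) - (LINT s|M. K 0 s)) /\<^sub>R X (i + N)" for i
    using int[OF N[of i]] int0 by simp
  ultimately have "(\<lambda>i. ((\<lambda>h. ((LINT s|M. K h s) - (LINT s|M. K 0 s)) /\<^sub>R h) \<circ> X) (i + N)) \<longlonglongrightarrow> (LINT s|M. K' s)"
    by (simp only: o_def)
  then show "((\<lambda>h. ((LINT s|M. K h s) - (LINT s|M. K 0 s)) /\<^sub>R h) \<circ> X) \<longlonglongrightarrow> (LINT s|M. K' s)"
    by (rule LIMSEQ_offset)
qed

lemma has_vector_derivative_cis:
  "((\<lambda>r. cis (r * a)) has_vector_derivative \<i> * of_real a * cis (r * a)) (at r)"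
proof -
  have "((\<lambda>r. exp (\<i> * of_real a * r)) has_field_derivative \<i> * of_real a * exp (\<i> * of_real a * of_real r)) (at (of_real r))"
    by (auto intro!: derivative_eq_intros)
  from has_vector_derivative_real_field[OF this] show ?thesis
    by (simp add: cis_conv_exp mult_ac)
qed

lemma norm_cis_minus_1: "norm (cis (r * a) - 1) \<le> \<bar>a\<bar> * \<bar>r\<bar>"
  using vector_derivative_bound[of "\<lambda>r. cis (r * a)", OF has_vector_derivative_cis, of r "\<bar>a\<bar>"]
  by (simp add: norm_mult)

section \<open>Matrix coefficients of the Heisenberg representation\<close>

locale elementary_dual_pair = elementary_lc_coords n p q x e z \<tau> k \<iota> pf
  for n p q and x :: "nat \<Rightarrow> 'g::{topological_ab_group_add, t2_space, second_countable_topology} \<Rightarrow> real"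
    and e z \<tau> k \<iota> pf +
  fixes \<mu> :: "'g measure" and \<nu> :: "'g dual measure"
  assumes haar_G: "haar_measure \<mu>" and haar_D: "haar_measure \<nu>" and planch: "plancherel \<mu> \<nu>"
begin

lemmas G = haar_measureD[OF haar_G]
lemmas N = haar_measureD[OF haar_D]

abbreviation "\<rho> \<equiv> \<nu> \<Otimes>\<^sub>M \<mu>"
abbreviation "wG \<equiv> hom_weight IG hG"
abbreviation "wD \<equiv> hom_weight ID hD"

lemma wG_cont: "continuous_on UNIV wG" and wD_cont: "continuous_on UNIV wD"
  by (rule continuous_hom_weight[OF hG_hom] continuous_hom_weight[OF hD_hom], assumption)+

lemma wG_meas [measurable]: "wG \<in> borel_measurable borel" and wD_meas [measurable]: "wD \<in> borel_measurable borel"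
  using wG_cont wD_cont by (auto intro: borel_measurable_continuous_onI)

lemma integrable_wG: "integrable \<mu> (\<lambda>s. 1 / wG s)"
  using integrable_weight_G[OF haar_G]
  by (auto simp: integrable_iff_bounded G hom_weight_pos less_imp_le)

lemma integrable_wD: "integrable \<nu> (\<lambda>c. 1 / wD c)"
  using integrable_weight_D[OF haar_G haar_D planch]
  by (auto simp: integrable_iff_bounded N hom_weight_pos less_imp_le)

lemma sigma_finite_G: "sigma_finite_measure \<mu>"
  by (rule sigma_finite_posI[OF _ _ integrable_weight_G[OF haar_G]]) (auto simp: G hom_weight_pos)

lemma sigma_finite_D: "sigma_finite_measure \<nu>"
  by (rule sigma_finite_posI[OF _ _ integrable_weight_D[OF haar_G haar_D planch]]) (auto simp: N hom_weight_pos)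

sublocale GG: pair_sigma_finite \<mu> \<mu>
  using sigma_finite_G by (simp add: pair_sigma_finite_def)

sublocale DG: pair_sigma_finite \<nu> \<mu>
  using sigma_finite_G sigma_finite_D by (simp add: pair_sigma_finite_def)

lemma schwartz_decay_G: "f \<in> schwartz \<Longrightarrow> \<exists>C. \<forall>s. norm (f s) \<le> C / wG s"
  by (rule schwartz_decay[OF finite_IG hG_hom])

lemma integrable_decay_G:
  fixes f :: "'g \<Rightarrow> complex"
  assumes "f \<in> borel_measurable borel" "\<And>s. norm (f s) \<le> C / wG s"
  shows "integrable \<mu> f"
proof (rule Bochner_Integration.integrable_bound[OF integrable_mult_right[OF integrable_wG, of C]])
  show "AE s in \<mu>. norm (f s) \<le> norm (C * (1 / wG s))"
  proof (intro AE_I2)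
    show "norm (f s) \<le> norm (C * (1 / wG s))" for s
      using assms(2)[of s] abs_ge_self[of "C / wG s"] by simp
  qed
qed (use assms(1) in \<open>simp add: G\<close>)

lemma schwartz_integrable: "f \<in> schwartz \<Longrightarrow> integrable \<mu> f"
  using schwartz_decay_G[of f] schwartzD(3)[of f] integrable_decay_G[of f] by metis

text \<open>Written out as an integral so that \<open>\<eta>\<close> may be the constant 1, which
  need not be square-integrable; this is how the Fourier transform becomes a special case.\<close>

definition coeff :: "('g \<Rightarrow> complex) \<Rightarrow> ('g \<Rightarrow> complex) \<Rightarrow> 'g dual \<times> 'g \<Rightarrow> complex" where
  "coeff \<xi> \<eta> g = (LINT u|\<mu>. \<xi> u * cnj (char_of (fst g) u * \<eta> (u - snd g)))"

lemma coeff_eq: "l2_inner \<mu> \<xi> (heis_rep g \<eta>) = coeff \<xi> \<eta> g"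
  by (simp add: l2_inner_def heis_rep_def coeff_def)

lemma fourier_eq_coeff: "fourier \<mu> f c = coeff f (\<lambda>_. 1) (c, 0)"
  by (simp add: fourier_def coeff_def)

lemma char_of_meas [measurable]: "char_of c \<in> borel_measurable borel"
  by (intro borel_measurable_continuous_onI char_of_cont)

lemma coeff_integrable:
  assumes "integrable \<mu> \<xi>" "\<eta> \<in> bounded_smooth"
  shows "integrable \<mu> (\<lambda>u. \<xi> u * cnj (char_of c u * \<eta> (u - t)))"
proof -
  obtain B where B: "\<And>s. norm (\<eta> s) \<le> B" using bounded_smoothD(2)[OF assms(2)] by blast
  have m: "(\<lambda>u. \<eta> (u - t)) \<in> borel_measurable borel"
    by (intro borel_measurable_continuous_onI continuous_on_compose2[OF bounded_smoothD(1)[OF assms(2)]] continuous_intros) auto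
  show ?thesis
  proof (rule Bochner_Integration.integrable_bound[OF integrable_mult_right[OF integrable_norm[OF assms(1)], of B]])
    have "\<xi> \<in> borel_measurable borel" using borel_measurable_integrable[OF assms(1)] by (simp only: G)
    then show "(\<lambda>u. \<xi> u * cnj (char_of c u * \<eta> (u - t))) \<in> borel_measurable \<mu>"
      using m unfolding G by measurable
    show "AE u in \<mu>. norm (\<xi> u * cnj (char_of c u * \<eta> (u - t))) \<le> norm (B * norm (\<xi> u))"
    proof (intro AE_I2)
      fix u
      have "norm (\<eta> (u - t)) * norm (\<xi> u) \<le> \<bar>B * norm (\<xi> u)\<bar>"
        using mult_right_mono[OF B[of "u - t"], of "norm (\<xi> u)"] by simp
      then show "norm (\<xi> u * cnj (char_of c u * \<eta> (u - t))) \<le> norm (B * norm (\<xi> u))"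
        by (simp add: norm_mult mult.commute)
    qed
  qed
qed

lemma coeff_scale_left: "coeff (\<lambda>s. c * \<xi> s) \<eta> g = c * coeff \<xi> \<eta> g"
  unfolding coeff_def mult.assoc by simp

lemma coeff_bounded:
  assumes "integrable \<mu> \<xi>" "\<eta> \<in> bounded_smooth"
  shows "bounded (range (coeff \<xi> \<eta>))"
proof -
  obtain B where B: "\<And>s. norm (\<eta> s) \<le> B" using bounded_smoothD(2)[OF assms(2)] by blast
  have "norm (coeff \<xi> \<eta> g) \<le> (LINT u|\<mu>. B * norm (\<xi> u))" for g
    unfolding coeff_def
  proof (rule norm_integral_le)
    show "integrable \<mu> (\<lambda>u. \<xi> u * cnj (char_of (fst g) u * \<eta> (u - snd g)))"
      by (rule coeff_integrable[OF assms])
    show "integrable \<mu> (\<lambda>u. B * norm (\<xi> u))" using assms(1) by auto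
    show "norm (\<xi> u * cnj (char_of (fst g) u * \<eta> (u - snd g))) \<le> B * norm (\<xi> u)" for u
      using mult_right_mono[OF B[of "u - snd g"], of "norm (\<xi> u)"] by (simp add: norm_mult mult.commute)
  qed
  then show ?thesis by (auto simp: bounded_iff)
qed

text \<open>On a compact sublevel set of the weight the kernel \<open>Q\<close> is uniformly close
  to its value at \<open>g0\<close>; outside it the decay of \<open>\<xi>\<close> makes the integral
  small.\<close>

lemma coeff_continuous:
  assumes \<xi>: "\<xi> \<in> schwartz" and \<eta>: "\<eta> \<in> bounded_smooth"
  shows "continuous_on UNIV (coeff \<xi> \<eta>)"
  unfolding continuous_on_def
proof (intro ballI tendstoI)
  fix g0 :: "'g dual \<times> 'g" and \<epsilon> :: real assume \<epsilon>: "\<epsilon> > 0"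
  obtain B where B: "\<And>s. norm (\<eta> s) \<le> B" using bounded_smoothD(2)[OF \<eta>] by blast
  have B0: "0 \<le> B" using B[of 0] norm_ge_zero order_trans by blast
  \<comment> \<open>\<open>\<xi>\<close> decays like the inverse square of \<open>wG\<close>: one
    power makes the tail integrable, the other yields the factor \<open>1 / R\<close> outside the
    sublevel set.\<close>
  obtain C where C: "\<And>s. norm (of_real (wG s) * \<xi> s) \<le> C / wG s"
    using schwartz_decay_G[OF schwartz_weight_mult[where h = hG, OF finite_IG hG_hom \<xi>]] by blast
  have C0: "0 \<le> C" using C[of 0] hom_weight_pos[of IG hG 0] by (metis norm_ge_zero order_trans zero_le_divide_iff less_imp_le not_less)
  define I1 where "I1 = (LINT s|\<mu>. 1 / wG s)"
  define I2 where "I2 = (LINT s|\<mu>. norm (\<xi> s))"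
  have I: "0 \<le> I1" "0 \<le> I2" unfolding I1_def I2_def by (auto intro!: Bochner_Integration.integral_nonneg simp: hom_weight_pos less_imp_le)
  \<comment> \<open>With these choices the tail and the main part contribute at most
    \<open>\<epsilon> / 4\<close> each; the summands 1 keep \<open>R\<close> and the denominator of
    \<open>\<delta>\<close> positive.\<close>
  define R where "R = 8 * B * C * I1 / \<epsilon> + 1"
  define \<delta> where "\<delta> = \<epsilon> / (4 * (I2 + 1))"
  have R: "R > 0" unfolding R_def using B0 C0 I \<epsilon> by (intro add_nonneg_pos) auto
  have \<delta>: "\<delta> > 0" using \<epsilon> I by (simp add: \<delta>_def)
  define Q where "Q g u = cnj (char_of (fst g) u * \<eta> (u - snd g))" for g :: "'g dual \<times> 'g" and u
  have "continuous_on UNIV (\<lambda>(g, u). Q g u)"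
    unfolding Q_def case_prod_unfold
    by (intro continuous_intros continuous_on_char_of_compose[OF lc]
        continuous_on_compose2[OF bounded_smoothD(1)[OF \<eta>]]) auto
  from continuous_on_compact_param[OF this compact_weight_sublevel[of R] \<delta>, of g0]
  obtain X where X: "g0 \<in> X" "open X" and le: "\<And>g u. g \<in> X \<Longrightarrow> wG u \<le> R \<Longrightarrow> dist (Q g u) (Q g0 u) \<le> \<delta>"
    by auto
  have QB: "norm (Q g u) \<le> B" for g u using B by (simp add: Q_def norm_mult)
  have "dist (coeff \<xi> \<eta> g) (coeff \<xi> \<eta> g0) < \<epsilon>" if "g \<in> X" for g
  proof -
    have int: "integrable \<mu> (\<lambda>u. \<xi> u * Q g u)" for g
      unfolding Q_def by (rule coeff_integrable[OF schwartz_integrable[OF \<xi>] \<eta>])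
    have "coeff \<xi> \<eta> g - coeff \<xi> \<eta> g0 = (LINT u|\<mu>. \<xi> u * Q g u - \<xi> u * Q g0 u)"
      unfolding coeff_def Q_def[symmetric] by (rule Bochner_Integration.integral_diff[symmetric]) (rule int)+
    also have "norm \<dots> \<le> (LINT u|\<mu>. \<delta> * norm (\<xi> u) + 2 * B * C / R * (1 / wG u))"
    proof (rule norm_integral_le)
      show "integrable \<mu> (\<lambda>u. \<xi> u * Q g u - \<xi> u * Q g0 u)" using int by auto
      show "integrable \<mu> (\<lambda>u. \<delta> * norm (\<xi> u) + 2 * B * C / R * (1 / wG u))"
        using schwartz_integrable[OF \<xi>] integrable_wG by (intro Bochner_Integration.integrable_add integrable_mult_right) auto
      fix u
      have eq: "norm (\<xi> u * Q g u - \<xi> u * Q g0 u) = norm (\<xi> u) * dist (Q g u) (Q g0 u)"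
        by (simp add: dist_norm norm_mult flip: right_diff_distrib)
      show "norm (\<xi> u * Q g u - \<xi> u * Q g0 u) \<le> \<delta> * norm (\<xi> u) + 2 * B * C / R * (1 / wG u)"
      proof (cases "wG u \<le> R")
        case True
        have "norm (\<xi> u) * dist (Q g u) (Q g0 u) \<le> norm (\<xi> u) * \<delta>"
          using le[OF that True] by (intro mult_left_mono) auto
        moreover have "0 \<le> 2 * B * C / R * (1 / wG u)" using B0 C0 R hom_weight_pos[of IG hG u] by simp
        ultimately show ?thesis unfolding eq by (simp add: mult.commute)
      next
        case False
        have "dist (Q g u) (Q g0 u) \<le> 2 * B"
          using QB[of g u] QB[of g0 u] norm_triangle_ineq4[of "Q g u" "Q g0 u"] by (simp add: dist_norm)
        moreover have "norm (\<xi> u) \<le> C / R * (1 / wG u)"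
        proof -
          have "R * norm (\<xi> u) \<le> wG u * norm (\<xi> u)" using False by (intro mult_right_mono) auto
          also have "\<dots> \<le> C / wG u" using C[of u] hom_weight_pos[of IG hG u] by (simp add: norm_mult)
          finally have "norm (\<xi> u) \<le> (C / wG u) / R" using R by (simp only: pos_le_divide_eq mult.commute)
          then show ?thesis by (simp add: mult.commute)
        qed
        ultimately have "norm (\<xi> u) * dist (Q g u) (Q g0 u) \<le> (C / R * (1 / wG u)) * (2 * B)"
          by (intro mult_mono) (auto intro: order_trans[OF norm_ge_zero])
        moreover have "0 \<le> \<delta> * norm (\<xi> u)" using \<delta> by simp
        ultimately show ?thesis unfolding eq by (simp add: mult_ac)
      qed
    qed
    also have "\<dots> = \<delta> * I2 + 2 * B * C / R * I1"
      unfolding I1_def I2_def using schwartz_integrable[OF \<xi>] integrable_wG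
      by (subst Bochner_Integration.integral_add) (auto intro!: integrable_mult_right simp del: times_divide_eq_right)
    also have "\<dots> < \<epsilon>"
    proof -
      have "\<delta> * I2 \<le> \<epsilon> / 4" unfolding \<delta>_def using I \<epsilon> by (simp add: field_simps)
      moreover have "2 * B * C * I1 \<le> \<epsilon> / 4 * R" unfolding R_def using \<epsilon> by (simp add: field_simps)
      then have "2 * B * C / R * I1 \<le> \<epsilon> / 4" using R by (simp add: field_simps)
      ultimately show ?thesis using \<epsilon> by linarith
    qed
    finally show ?thesis by (simp add: dist_norm)
  qed
  then show "\<forall>\<^sub>F g in at g0 within UNIV. dist (coeff \<xi> \<eta> g) (coeff \<xi> \<eta> g0) < \<epsilon>"
    unfolding eventually_at_topological using X by blast
qed

section \<open>Derivatives and polynomial multiples of matrix coefficients\<close>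

lemma one_param_prod:
  fixes \<phi> :: "real \<Rightarrow> 'a::topological_ab_group_add \<times> 'b::topological_ab_group_add"
  assumes "\<phi> \<in> one_param_subgroups"
  shows "(\<lambda>r. fst (\<phi> r)) \<in> one_param_subgroups" "(\<lambda>r. snd (\<phi> r)) \<in> one_param_subgroups"
  using assms by (auto simp: one_param_subgroups_def intro!: continuous_intros)

text \<open>The conjugated character contributes the factor \<open>- \<i> * h u\<close>, the
  translate of \<open>\<eta>\<close> contributes minus its derivative. Both scalars are attached to
  \<open>\<xi>\<close>, so that the result is again a sum of matrix coefficients.\<close>

lemma coeff_deriv:
  assumes \<xi>: "\<xi> \<in> schwartz" and \<eta>: "\<eta> \<in> bounded_smooth" and \<phi>: "\<phi> \<in> one_param_subgroups"
    and h: "h \<in> real_homs" "\<And>r s. char_of (fst (\<phi> r)) s = cis (r * h s)"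
  shows "((\<lambda>r. coeff \<xi> \<eta> (g + \<phi> r)) has_vector_derivative
    (coeff (\<lambda>s. - \<i> * (of_real (h s) * \<xi> s)) \<eta> g + coeff (\<lambda>s. - 1 * \<xi> s) (dir_deriv (\<lambda>r. snd (\<phi> r)) \<eta>) g)) (at 0)"
proof -
  define \<psi> where "\<psi> = (\<lambda>r. snd (\<phi> r))"
  have \<psi>: "\<psi> \<in> one_param_subgroups" unfolding \<psi>_def by (rule one_param_prod(2)[OF \<phi>])
  define \<eta>' where "\<eta>' = dir_deriv \<psi> \<eta>"
  have \<eta>': "\<eta>' \<in> bounded_smooth" unfolding \<eta>'_def by (rule bounded_smooth_dir_deriv[OF \<eta> \<psi>])
  obtain B0 where B0: "\<And>s. norm (\<eta> s) \<le> B0" using bounded_smoothD(2)[OF \<eta>] by blast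
  obtain B1 where B1: "\<And>s. norm (\<eta>' s) \<le> B1" using bounded_smoothD(2)[OF \<eta>'] by blast
  obtain c t where g: "g = (c, t)" by (cases g)
  define K where "K r u = \<xi> u * cnj (char_of c u) * (cis (r * - h u) * cnj (\<eta> (u - t - \<psi> r)))" for r u
  define K' where "K' u = \<xi> u * cnj (char_of c u) * (- \<i> * of_real (h u) * cnj (\<eta> (u - t)) - cnj (\<eta>' (u - t)))" for u
  have hm: "h \<in> borel_measurable borel" by (intro borel_measurable_continuous_onI real_homsD(1) h)
  note [measurable] = schwartzD(3)[OF \<xi>] hm
  have \<eta>m [measurable]: "(\<lambda>u. f (u - a)) \<in> borel_measurable borel" if "f \<in> bounded_smooth" for f :: "'g \<Rightarrow> complex" and a
    by (intro borel_measurable_continuous_onI continuous_on_compose2[OF bounded_smoothD(1)[OF that]] continuous_intros) auto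
  have K0: "K 0 u = \<xi> u * cnj (char_of c u * \<eta> (u - t))" for u
    by (simp add: K_def one_paramD(3)[OF \<psi>])
  have d: "((\<lambda>r. \<eta> (v - \<psi> r)) has_vector_derivative - \<eta>' (v - \<psi> r0)) (at r0)" for v r0
  proof -
    have "((\<lambda>r. \<eta> (v + \<psi> r)) has_vector_derivative \<eta>' (v + \<psi> (- r0))) (at (- r0))"
      unfolding \<eta>'_def by (rule has_dir_deriv[OF \<eta> \<psi>])
    then have "(((\<lambda>r. \<eta> (v + \<psi> r)) \<circ> uminus) has_vector_derivative (- 1) *\<^sub>R \<eta>' (v + \<psi> (- r0))) (at r0)"
      by (intro vector_diff_chain_at) (auto intro!: derivative_eq_intros)
    then show ?thesis by (simp add: o_def one_paramD(4)[OF \<psi>])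
  qed
  have "((\<lambda>r. LINT u|\<mu>. K r u) has_vector_derivative (LINT u|\<mu>. K' u)) (at 0)"
  proof (rule has_vector_derivative_integral)
    show "integrable \<mu> (K 0)"
      unfolding K0[abs_def] by (rule coeff_integrable[OF schwartz_integrable[OF \<xi>] \<eta>])
    show "K r \<in> borel_measurable \<mu>" for r
    proof -
      have "(\<lambda>u. \<eta> (u - t - \<psi> r)) \<in> borel_measurable borel" using \<eta>m[OF \<eta>, of "t + \<psi> r"] by (simp add: diff_diff_eq)
      moreover have "(\<lambda>u. cis (r * - h u)) \<in> borel_measurable borel"
        by (intro borel_measurable_continuous_onI continuous_intros real_homsD(1) h)
      ultimately show ?thesis unfolding K_def G by measurable
    qed
    show "K' \<in> borel_measurable \<mu>" unfolding K'_def G using \<eta>m[OF \<eta>] \<eta>m[OF \<eta>'] by measurable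
    show "((\<lambda>r. K r u) has_vector_derivative K' u) (at 0)" for u
    proof -
      have "((\<lambda>r. cis (r * - h u) * cnj (\<eta> (u - t - \<psi> r))) has_vector_derivative
          cis (0 * - h u) * cnj (- \<eta>' (u - t - \<psi> 0)) + \<i> * of_real (- h u) * cis (0 * - h u) * cnj (\<eta> (u - t - \<psi> 0))) (at 0)"
        by (intro has_vector_derivative_mult has_vector_derivative_cis has_vector_derivative_cnj d)
      moreover have "cis (0 * - h u) * cnj (- \<eta>' (u - t - \<psi> 0)) + \<i> * of_real (- h u) * cis (0 * - h u) * cnj (\<eta> (u - t - \<psi> 0)) =
          - \<i> * of_real (h u) * cnj (\<eta> (u - t)) - cnj (\<eta>' (u - t))"
        by (simp add: one_paramD(3)[OF \<psi>])
      ultimately have "((\<lambda>r. cis (r * - h u) * cnj (\<eta> (u - t - \<psi> r))) has_vector_derivative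
          (- \<i> * of_real (h u) * cnj (\<eta> (u - t)) - cnj (\<eta>' (u - t)))) (at 0)"
        by (simp only:)
      from has_vector_derivative_mult_right[OF this] show ?thesis unfolding K_def K'_def .
    qed
    show "norm (K r u - K 0 u) \<le> (B0 * norm (of_real (h u) * \<xi> u) + B1 * norm (\<xi> u)) * \<bar>r\<bar>" for r u
    proof -
      define a where "a = cis (r * - h u)"
      define b where "b = cnj (\<eta> (u - t - \<psi> r))"
      define b' where "b' = cnj (\<eta> (u - t))"
      have bb: "norm (b - b') \<le> B1 * \<bar>r\<bar>"
      proof -
        have "norm (\<eta> (u - t - \<psi> r) - \<eta> (u - t - \<psi> 0)) \<le> B1 * \<bar>r\<bar>"
          by (rule vector_derivative_bound[OF d]) (simp add: B1)
        moreover have "b - b' = cnj (\<eta> (u - t - \<psi> r) - \<eta> (u - t - \<psi> 0))"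
          by (simp add: b_def b'_def one_paramD(3)[OF \<psi>])
        ultimately show ?thesis by (simp only: complex_mod_cnj)
      qed
      \<comment> \<open>The phase changes by at most \<open>\<bar>h u\<bar> * \<bar>r\<bar>\<close>
        and the translate by at most \<open>B1 * \<bar>r\<bar>\<close>; the unbounded factor
        \<open>h u\<close> is absorbed by the decay of \<open>\<xi>\<close>.\<close>
      have "a * b - b' = (a - 1) * b + (b - b')" by (simp add: algebra_simps)
      also have "norm \<dots> \<le> \<bar>h u\<bar> * \<bar>r\<bar> * B0 + B1 * \<bar>r\<bar>"
      proof (intro norm_triangle_mono bb)
        have "norm (a - 1) \<le> \<bar>h u\<bar> * \<bar>r\<bar>" unfolding a_def using norm_cis_minus_1[of r "- h u"] by simp
        then show "norm ((a - 1) * b) \<le> \<bar>h u\<bar> * \<bar>r\<bar> * B0"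
          unfolding norm_mult using B0[of "u - t - \<psi> r"] by (intro mult_mono) (auto simp: b_def)
      qed
      finally have "norm (\<xi> u) * norm (a * b - b') \<le> norm (\<xi> u) * (\<bar>h u\<bar> * \<bar>r\<bar> * B0 + B1 * \<bar>r\<bar>)"
        by (rule mult_left_mono) simp
      moreover have dK: "K r u - K 0 u = \<xi> u * cnj (char_of c u) * (a * b - b')"
        unfolding K_def a_def b_def b'_def by (simp add: one_paramD(3)[OF \<psi>] algebra_simps)
      ultimately show ?thesis unfolding dK by (simp add: norm_mult) (simp add: algebra_simps)
    qed
    show "integrable \<mu> (\<lambda>u. B0 * norm (of_real (h u) * \<xi> u) + B1 * norm (\<xi> u))"
      by (intro Bochner_Integration.integrable_add integrable_mult_right integrable_norm schwartz_integrable
          schwartz_hom_mult \<xi> h)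
  qed
  moreover have "(LINT u|\<mu>. K r u) = coeff \<xi> \<eta> (g + \<phi> r)" for r
    unfolding coeff_def K_def g \<psi>_def
    by (intro Bochner_Integration.integral_cong refl) (simp add: h diff_diff_eq cis_cnj mult_ac)
  moreover have "(LINT u|\<mu>. K' u) = coeff (\<lambda>s. - \<i> * (of_real (h s) * \<xi> s)) \<eta> g + coeff (\<lambda>s. - 1 * \<xi> s) \<eta>' g"
    unfolding coeff_def
  proof (subst Bochner_Integration.integral_add[symmetric])
    show "integrable \<mu> (\<lambda>u. - \<i> * (complex_of_real (h u) * \<xi> u) * cnj (char_of (fst g) u * \<eta> (u - snd g)))"
      by (intro coeff_integrable schwartz_integrable schwartz_scale schwartz_hom_mult \<xi> h \<eta>)
    show "integrable \<mu> (\<lambda>u. - 1 * \<xi> u * cnj (char_of (fst g) u * \<eta>' (u - snd g)))"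
      by (intro coeff_integrable schwartz_integrable schwartz_scale \<xi> \<eta>')
  qed (intro Bochner_Integration.integral_cong refl, simp add: K'_def g algebra_simps)
  ultimately show ?thesis unfolding \<eta>'_def \<psi>_def by simp
qed

text \<open>Write \<open>t = u - (u - t)\<close> under the integral.\<close>

lemma coeff_mult_G:
  assumes \<xi>: "\<xi> \<in> schwartz" and \<eta>: "\<eta> \<in> schwartz" and h: "h \<in> real_homs"
  shows "of_real (h (snd g)) * coeff \<xi> \<eta> g =
    coeff (\<lambda>s. of_real (h s) * \<xi> s) \<eta> g + coeff (\<lambda>s. - 1 * \<xi> s) (\<lambda>s. of_real (h s) * \<eta> s) g"
proof -
  have "of_real (h (snd g)) * coeff \<xi> \<eta> g =
      (LINT u|\<mu>. of_real (h (snd g)) * (\<xi> u * cnj (char_of (fst g) u * \<eta> (u - snd g))))"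
    unfolding coeff_def by simp
  also have "\<dots> = (LINT u|\<mu>. of_real (h u) * \<xi> u * cnj (char_of (fst g) u * \<eta> (u - snd g)) +
      - 1 * \<xi> u * cnj (char_of (fst g) u * (of_real (h (u - snd g)) * \<eta> (u - snd g))))"
    by (intro Bochner_Integration.integral_cong refl) (simp add: real_homsD(5)[OF h] algebra_simps)
  also have "\<dots> = coeff (\<lambda>s. of_real (h s) * \<xi> s) \<eta> g + coeff (\<lambda>s. - 1 * \<xi> s) (\<lambda>s. of_real (h s) * \<eta> s) g"
    unfolding coeff_def
    by (intro Bochner_Integration.integral_add coeff_integrable schwartz_integrable schwartz_hom_mult
        schwartz_scale schwartz_bounded_smooth \<xi> \<eta> h)
  finally show ?thesis .
qed

text \<open>By invariance of the Haar measure the integral of \<open>f (s + \<phi> r)\<close> is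
  constant in \<open>r\<close>, and differentiating under the integral identifies its derivative.
  The domination uses \<open>hom_weight_translate\<close> together with the bound \<open>L\<close>
  of the weight along the compact arc \<open>\<bar>r\<bar> \<le> 1\<close>.\<close>

lemma integral_dir_deriv_zero:
  fixes f f' :: "'g \<Rightarrow> complex"
  assumes f: "integrable \<mu> f" and f': "f' \<in> borel_measurable borel" and \<phi>: "\<phi> \<in> one_param_subgroups"
    and d: "\<And>s r0. ((\<lambda>r. f (s + \<phi> r)) has_vector_derivative f' (s + \<phi> r0)) (at r0)"
    and C: "\<And>s. norm (f' s) \<le> C / wG s"
  shows "(LINT s|\<mu>. f' s) = 0"
proof -
  have fm: "f \<in> borel_measurable borel" using borel_measurable_integrable[OF f] by (simp only: G)
  have "compact ((\<lambda>r. wG (\<phi> r)) ` {-1..1})"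
    by (intro compact_continuous_image continuous_on_compose2[OF wG_cont]
        continuous_on_subset[OF one_paramD(1)[OF \<phi>]]) auto
  then obtain L where L: "\<And>r. \<bar>r\<bar> \<le> 1 \<Longrightarrow> wG (\<phi> r) \<le> L"
    by (force dest!: compact_imp_bounded simp: bounded_iff abs_le_iff)
  have C0: "0 \<le> C" using C[of 0] hom_weight_pos[of IG hG 0] by (metis norm_ge_zero order_trans zero_le_divide_iff less_imp_le not_less)
  have "((\<lambda>r. LINT s|\<mu>. f (s + \<phi> r)) has_vector_derivative (LINT s|\<mu>. f' s)) (at 0)"
  proof (rule has_vector_derivative_integral[where K = "\<lambda>r s. f (s + \<phi> r)"])
    show "integrable \<mu> (\<lambda>s. f (s + \<phi> 0))" using f by (simp add: one_paramD(3)[OF \<phi>])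
    show "(\<lambda>s. f (s + \<phi> r)) \<in> borel_measurable \<mu>" for r
      unfolding G by (rule measurable_compose[OF _ fm]) (intro borel_measurable_continuous_onI continuous_intros)
    show "f' \<in> borel_measurable \<mu>" using f' by (simp add: G)
    show "((\<lambda>r. f (s + \<phi> r)) has_vector_derivative f' s) (at 0)" for s
      using d[of s 0] by (simp add: one_paramD(3)[OF \<phi>])
    show "integrable \<mu> (\<lambda>s. C * 2 ^ card IG * L * (1 / wG s))" by (intro integrable_mult_right integrable_wG)
    show "norm (f (s + \<phi> r) - f (s + \<phi> 0)) \<le> C * 2 ^ card IG * L * (1 / wG s) * \<bar>r\<bar>" if r: "\<bar>r\<bar> \<le> 1" for r s
    proof (rule vector_derivative_bound[OF d])
      fix r' assume "\<bar>r'\<bar> \<le> \<bar>r\<bar>"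
      then have "wG (\<phi> r') \<le> L" using L r by auto
      then have "wG s \<le> 2 ^ card IG * wG (s + \<phi> r') * L"
        using hom_weight_translate[where h = hG, OF finite_IG hG_hom, of s "\<phi> r'"] hom_weight_pos[of IG hG "s + \<phi> r'"]
        by (smt (verit) mult_left_mono mult_pos_pos zero_less_power)
      then have "1 / wG (s + \<phi> r') \<le> 2 ^ card IG * L * (1 / wG s)"
        using hom_weight_pos[of IG hG "s + \<phi> r'"] hom_weight_pos[of IG hG s] by (simp add: field_simps)
      from mult_left_mono[OF this C0] C[of "s + \<phi> r'"]
      show "norm (f' (s + \<phi> r')) \<le> C * 2 ^ card IG * L * (1 / wG s)" by (simp add: mult.assoc)
    qed
  qed
  moreover have "(LINT s|\<mu>. f (s + \<phi> r)) = (LINT s|\<mu>. f s)" for r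
    by (rule haar_integral_translate(1)[OF haar_G fm])
  ultimately have "((\<lambda>r::real. LINT s|\<mu>. f s) has_vector_derivative (LINT s|\<mu>. f' s)) (at 0)" by simp
  from vector_derivative_unique_at[OF this has_vector_derivative_const] show ?thesis .
qed

text \<open>The derivative of the integrand of \<open>coeff \<xi> \<eta> g\<close> along \<open>\<phi>\<close> has integral zero.\<close>

lemma coeff_mult_D:
  assumes \<xi>: "\<xi> \<in> schwartz" and \<eta>: "\<eta> \<in> bounded_smooth" and \<phi>: "\<phi> \<in> one_param_subgroups"
    and H: "\<And>c r. char_of c (\<phi> r) = cis (r * H c)"
  shows "of_real (H (fst g)) * coeff \<xi> \<eta> g =
    coeff (\<lambda>s. - \<i> * dir_deriv \<phi> \<xi> s) \<eta> g + coeff (\<lambda>s. - \<i> * \<xi> s) (dir_deriv \<phi> \<eta>) g"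
proof -
  define \<xi>' where "\<xi>' = dir_deriv \<phi> \<xi>"
  define \<eta>' where "\<eta>' = dir_deriv \<phi> \<eta>"
  have \<xi>': "\<xi>' \<in> schwartz" and \<eta>': "\<eta>' \<in> bounded_smooth"
    unfolding \<xi>'_def \<eta>'_def by (rule schwartz_dir_deriv[OF \<xi> \<phi>] bounded_smooth_dir_deriv[OF \<eta> \<phi>])+
  obtain c t where g: "g = (c, t)" by (cases g)
  define f where "f u = \<xi> u * cnj (char_of c u * \<eta> (u - t))" for u
  define f1 where "f1 u = \<xi>' u * cnj (char_of c u * \<eta> (u - t))" for u
  define f2 where "f2 u = \<xi> u * cnj (char_of c u * \<eta>' (u - t))" for u
  \<comment> \<open>The last term comes from the conjugated character, whose exponent along
    \<open>\<phi>\<close> is \<open>- H c\<close>. Vanishing of the integral of \<open>f'\<close>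
    can then be solved for \<open>H c\<close> times the coefficient.\<close>
  define f' where "f' u = f1 u + f2 u - \<i> * of_real (H c) * f u" for u
  have i: "integrable \<mu> f" "integrable \<mu> f1" "integrable \<mu> f2"
    unfolding f_def f1_def f2_def by (intro coeff_integrable schwartz_integrable \<xi> \<xi>' \<eta> \<eta>')+
  then have m: "f \<in> borel_measurable borel" "f1 \<in> borel_measurable borel" "f2 \<in> borel_measurable borel"
    using borel_measurable_integrable unfolding G(3)[symmetric] by blast+
  obtain B0 where B0: "\<And>s. norm (\<eta> s) \<le> B0" using bounded_smoothD(2)[OF \<eta>] by blast
  obtain B1 where B1: "\<And>s. norm (\<eta>' s) \<le> B1" using bounded_smoothD(2)[OF \<eta>'] by blast
  obtain C0 where C0: "\<And>s. norm (\<xi> s) \<le> C0 / wG s" using schwartz_decay_G[OF \<xi>] by blast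
  obtain C1 where C1: "\<And>s. norm (\<xi>' s) \<le> C1 / wG s" using schwartz_decay_G[OF \<xi>'] by blast
  have pb: "norm (X * cnj (char_of c u * Y)) \<le> C / wG u * B" if "norm X \<le> C / wG u" "norm Y \<le> B" for X Y C B u
    unfolding norm_mult using mult_mono[OF that] that order_trans[OF norm_ge_zero that(1)] by (simp add: norm_mult)
  have "(LINT u|\<mu>. f' u) = 0"
  proof (rule integral_dir_deriv_zero[OF i(1) _ \<phi>])
    show "f' \<in> borel_measurable borel" unfolding f'_def using m by measurable
    show "norm (f' s) \<le> (C1 * B0 + C0 * B1 + \<bar>H c\<bar> * (C0 * B0)) / wG s" for s
    proof -
      have "norm (f' s) \<le> norm (f1 s) + norm (f2 s) + \<bar>H c\<bar> * norm (f s)"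
        unfolding f'_def by (rule order_trans[OF norm_triangle_ineq4]) (simp add: norm_mult norm_triangle_ineq)
      also have "\<dots> \<le> C1 / wG s * B0 + C0 / wG s * B1 + \<bar>H c\<bar> * (C0 / wG s * B0)"
        unfolding f_def f1_def f2_def by (intro add_mono mult_left_mono pb C0 C1 B0 B1) auto
      finally show ?thesis by (simp add: add_divide_distrib)
    qed
    show "((\<lambda>r. f (s + \<phi> r)) has_vector_derivative f' (s + \<phi> r0)) (at r0)" for s r0
    proof -
      have "((\<lambda>r. \<eta> (s - t + \<phi> r)) has_vector_derivative \<eta>' (s - t + \<phi> r0)) (at r0)"
        unfolding \<eta>'_def by (rule has_dir_deriv[OF \<eta> \<phi>])
      then have "((\<lambda>r. \<xi> (s + \<phi> r) * (cnj (char_of c s) * (cis (r * - H c) * cnj (\<eta> (s - t + \<phi> r))))) has_vector_derivative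
          \<xi> (s + \<phi> r0) * (cnj (char_of c s) * (cis (r0 * - H c) * cnj (\<eta>' (s - t + \<phi> r0)) +
            \<i> * of_real (- H c) * cis (r0 * - H c) * cnj (\<eta> (s - t + \<phi> r0)))) +
          \<xi>' (s + \<phi> r0) * (cnj (char_of c s) * (cis (r0 * - H c) * cnj (\<eta> (s - t + \<phi> r0))))) (at r0)"
        unfolding \<xi>'_def
        by (intro has_vector_derivative_mult has_vector_derivative_mult_right has_vector_derivative_cis
            has_vector_derivative_cnj has_dir_deriv schwartz_bounded_smooth \<xi> \<phi>)
      then show ?thesis
        unfolding f'_def f_def f1_def f2_def char_of_add H
        by (simp add: cis_cnj algebra_simps)
    qed
  qed
  moreover have "(LINT u|\<mu>. f' u) = (LINT u|\<mu>. f1 u) + (LINT u|\<mu>. f2 u) - \<i> * of_real (H c) * (LINT u|\<mu>. f u)"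
    unfolding f'_def using i by simp
  moreover have "(LINT u|\<mu>. f u) = coeff \<xi> \<eta> g" "(LINT u|\<mu>. f1 u) = coeff \<xi>' \<eta> g" "(LINT u|\<mu>. f2 u) = coeff \<xi> \<eta>' g"
    by (simp_all add: f_def f1_def f2_def coeff_def g)
  ultimately have "\<i> * (of_real (H c) * coeff \<xi> \<eta> g) = coeff \<xi>' \<eta> g + coeff \<xi> \<eta>' g" by simp
  then have "- \<i> * (\<i> * (of_real (H c) * coeff \<xi> \<eta> g)) = - \<i> * (coeff \<xi>' \<eta> g + coeff \<xi> \<eta>' g)" by simp
  then have "of_real (H c) * coeff \<xi> \<eta> g = - \<i> * coeff \<xi>' \<eta> g + - \<i> * coeff \<xi> \<eta>' g"
    by (simp add: algebra_simps flip: mult.assoc)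
  then show ?thesis unfolding coeff_scale_left g \<xi>'_def[symmetric] \<eta>'_def[symmetric] fst_conv .
qed

text \<open>The image of \<open>schwartz\<close> satisfies the closure conditions of
  \<open>schwartz_coinduct\<close>, since a derivative along the dual multiplies \<open>f\<close> by
  a real homomorphism and multiplication by a real homomorphism differentiates
  \<open>f\<close>.\<close>

lemma fourier_schwartz:
  assumes "f \<in> schwartz"
  shows "fourier \<mu> f \<in> schwartz"
proof (rule schwartz_coinduct[where V = "fourier \<mu> ` schwartz"])
  show "fourier \<mu> f \<in> fourier \<mu> ` schwartz" using assms by blast
  note cs = const_bounded_smooth[of 1]
  fix F :: "'g dual \<Rightarrow> complex" assume "F \<in> fourier \<mu> ` schwartz"
  then obtain f where f: "f \<in> schwartz" and F: "F = (\<lambda>c. coeff f (\<lambda>_. 1) (c, 0))"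
    using fourier_eq_coeff by fastforce
  show "continuous_on UNIV F"
    unfolding F by (rule continuous_on_compose2[OF coeff_continuous[OF f cs]]) (auto intro!: continuous_intros)
  show "bounded (range F)"
    unfolding F by (rule bounded_subset[OF coeff_bounded[OF schwartz_integrable[OF f] cs]]) auto
  show "\<exists>g\<in>fourier \<mu> ` schwartz. \<forall>s. ((\<lambda>r. F (s + \<phi> r)) has_vector_derivative g s) (at 0)"
    if \<phi>: "\<phi> \<in> one_param_subgroups" for \<phi>
  proof -
    obtain h where h: "h \<in> real_homs" "\<And>r s. char_of (\<phi> r) s = cis (r * h s)"
      using dual_one_param[OF lc \<phi>] by blast
    \<comment> \<open>With trivial group component \<open>coeff_deriv\<close> applies to the
      constant function 1, and the second term of its derivative vanishes.\<close>
    have \<phi>': "(\<lambda>r. (\<phi> r, 0 :: 'g)) \<in> one_param_subgroups"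
      using \<phi> by (auto simp: one_param_subgroups_def intro!: continuous_intros)
    have "((\<lambda>r. F (s + \<phi> r)) has_vector_derivative fourier \<mu> (\<lambda>s. - \<i> * (of_real (h s) * f s)) s) (at 0)" for s
    proof -
      have "((\<lambda>r. F (s + \<phi> r)) has_vector_derivative coeff (\<lambda>s. - \<i> * (of_real (h s) * f s)) (\<lambda>_. 1) (s, 0) +
          coeff (\<lambda>s. - 1 * f s) (dir_deriv (\<lambda>r. 0) (\<lambda>_. 1)) (s, 0)) (at 0)"
        using coeff_deriv[OF f cs \<phi>' h(1), of "(s, 0)"] h(2) by (simp add: F)
      then show ?thesis by (simp add: fourier_eq_coeff coeff_def)
    qed
    moreover have "fourier \<mu> (\<lambda>s. - \<i> * (of_real (h s) * f s)) \<in> fourier \<mu> ` schwartz"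
      by (intro imageI schwartz_scale schwartz_hom_mult f h)
    ultimately show ?thesis by blast
  qed
  show "(\<lambda>s. of_real (H s) * F s) \<in> fourier \<mu> ` schwartz" if H: "H \<in> real_homs" for H
  proof -
    obtain \<phi> where \<phi>: "\<phi> \<in> one_param_subgroups" "\<And>c r. char_of c (\<phi> r) = cis (r * H c)"
      using real_hom_dual_one_param[OF H] by blast
    have "(\<lambda>s. of_real (H s) * F s) = fourier \<mu> (\<lambda>s. - \<i> * dir_deriv \<phi> f s)"
    proof
      fix s
      have "of_real (H s) * F s = coeff (\<lambda>s. - \<i> * dir_deriv \<phi> f s) (\<lambda>_. 1) (s, 0) +
          coeff (\<lambda>s. - \<i> * f s) (dir_deriv \<phi> (\<lambda>_. 1)) (s, 0)"
        using coeff_mult_D[OF f cs \<phi>, of "(s, 0)"] by (simp add: F)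
      then show "of_real (H s) * F s = fourier \<mu> (\<lambda>s. - \<i> * dir_deriv \<phi> f s) s"
        by (simp add: fourier_eq_coeff coeff_def)
    qed
    then show ?thesis by (simp only:) (intro imageI schwartz_scale schwartz_dir_deriv f \<phi>)
  qed
qed

text \<open>Sums are included because a derivative or a polynomial multiple splits into several
  coefficients; scalars are absorbed into the first argument.\<close>

inductive_set coeffs :: "('g dual \<times> 'g \<Rightarrow> complex) set" where
  base: "\<xi> \<in> schwartz \<Longrightarrow> \<eta> \<in> schwartz \<Longrightarrow> coeff \<xi> \<eta> \<in> coeffs"
| add: "f \<in> coeffs \<Longrightarrow> g \<in> coeffs \<Longrightarrow> (\<lambda>s. f s + g s) \<in> coeffs"

lemma coeffs_deriv:
  assumes "F \<in> coeffs" and \<phi>: "\<phi> \<in> one_param_subgroups"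
  shows "\<exists>g\<in>coeffs. \<forall>s. ((\<lambda>r. F (s + \<phi> r)) has_vector_derivative g s) (at 0)"
  using assms(1)
proof (induction rule: coeffs.induct)
  case (base \<xi> \<eta>)
  obtain h where h: "h \<in> real_homs" "\<And>r s. char_of (fst (\<phi> r)) s = cis (r * h s)"
    using dual_one_param[OF lc one_param_prod(1)[OF \<phi>]] by blast
  have "((\<lambda>r. coeff \<xi> \<eta> (s + \<phi> r)) has_vector_derivative
    (coeff (\<lambda>s. - \<i> * (of_real (h s) * \<xi> s)) \<eta> s + coeff (\<lambda>s. - 1 * \<xi> s) (dir_deriv (\<lambda>r. snd (\<phi> r)) \<eta>) s)) (at 0)" for s
    by (rule coeff_deriv[OF base(1) schwartz_bounded_smooth[OF base(2)] \<phi> h])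
  moreover have "(\<lambda>s. coeff (\<lambda>s. - \<i> * (of_real (h s) * \<xi> s)) \<eta> s +
      coeff (\<lambda>s. - 1 * \<xi> s) (dir_deriv (\<lambda>r. snd (\<phi> r)) \<eta>) s) \<in> coeffs"
    by (intro coeffs.add coeffs.base schwartz_scale schwartz_hom_mult schwartz_dir_deriv base h one_param_prod(2)[OF \<phi>])
  ultimately show ?case by (rule_tac bexI) auto
next
  case (add f g)
  then obtain f' g' where "f' \<in> coeffs" "g' \<in> coeffs"
    "\<And>s. ((\<lambda>r. f (s + \<phi> r)) has_vector_derivative f' s) (at 0)"
    "\<And>s. ((\<lambda>r. g (s + \<phi> r)) has_vector_derivative g' s) (at 0)" by auto
  then show ?case
    by (intro bexI[of _ "\<lambda>s. f' s + g' s"]) (auto intro!: has_vector_derivative_add coeffs.add)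
qed

text \<open>On the product group \<open>H (c, s)\<close> splits as
  \<open>H (c, 0) + H (0, s)\<close>; \<open>coeff_mult_D\<close> treats the first summand and
  \<open>coeff_mult_G\<close> the second.\<close>

lemma coeffs_mult:
  assumes "F \<in> coeffs" and H: "H \<in> real_homs"
  shows "(\<lambda>s. of_real (H s) * F s) \<in> coeffs"
  using assms(1)
proof (induction rule: coeffs.induct)
  case (base \<xi> \<eta>)
  have H1: "(\<lambda>c. H (c, 0)) \<in> real_homs" and H2: "(\<lambda>s. H (0, s)) \<in> real_homs"
    using real_homsD(2)[OF H, of "(_, 0)" "(_, 0)"] real_homsD(2)[OF H, of "(0, _)" "(0, _)"]
    by (auto simp: real_homs_def intro!: continuous_on_compose2[OF real_homsD(1)[OF H]] continuous_intros)
  obtain \<phi> where \<phi>: "\<phi> \<in> one_param_subgroups" "\<And>c r. char_of c (\<phi> r) = cis (r * H (c, 0))"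
    using real_hom_dual_one_param[OF H1] by blast
  have "(\<lambda>g. (coeff (\<lambda>s. - \<i> * dir_deriv \<phi> \<xi> s) \<eta> g + coeff (\<lambda>s. - \<i> * \<xi> s) (dir_deriv \<phi> \<eta>) g) +
    (coeff (\<lambda>s. of_real (H (0, s)) * \<xi> s) \<eta> g + coeff (\<lambda>s. - 1 * \<xi> s) (\<lambda>s. of_real (H (0, s)) * \<eta> s) g)) \<in> coeffs" (is "?F \<in> _")
    by (intro coeffs.add coeffs.base schwartz_scale schwartz_hom_mult[where h = "\<lambda>s. H (0, s)"] schwartz_dir_deriv base H2 \<phi>)
  also have "?F = (\<lambda>g. of_real (H g) * coeff \<xi> \<eta> g)"
  proof
    fix g
    have "H g = H (fst g, 0) + H (0, snd g)" using real_homsD(2)[OF H, of "(fst g, 0)" "(0, snd g)"] by simp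
    then show "?F g = of_real (H g) * coeff \<xi> \<eta> g"
      unfolding coeff_mult_D[OF base(1) schwartz_bounded_smooth[OF base(2)] \<phi>(1), of "\<lambda>c. H (c, 0)", OF \<phi>(2), symmetric]
        coeff_mult_G[OF base H2, symmetric] by (simp add: distrib_right)
  qed
  finally show ?case .
next
  case (add f g)
  then show ?case using coeffs.add by (fastforce simp: distrib_left)
qed

lemma coeff_schwartz:
  assumes "\<xi> \<in> schwartz" "\<eta> \<in> schwartz"
  shows "coeff \<xi> \<eta> \<in> schwartz"
proof (rule schwartz_coinduct[where V = coeffs])
  show "coeff \<xi> \<eta> \<in> coeffs" using assms by (rule coeffs.base)
  show "continuous_on UNIV F" if "F \<in> coeffs" for F
    using that by induction (auto intro!: continuous_intros coeff_continuous schwartz_bounded_smooth)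
  show "bounded (range F)" if "F \<in> coeffs" for F
    using that by induction (auto intro!: bounded_range_add coeff_bounded schwartz_integrable schwartz_bounded_smooth)
qed (rule coeffs_deriv coeffs_mult; assumption)+

end

section \<open>Square-integrable functions\<close>

lemma L2D:
  assumes "f \<in> L2 M"
  shows "f \<in> borel_measurable M" "integrable M (\<lambda>x. (norm (f x))\<^sup>2)"
  using assms by (auto simp: L2_def)

lemma L2_mult_integrable:
  assumes f: "f \<in> L2 M" and g: "g \<in> L2 M"
  shows "integrable M (\<lambda>x. f x * cnj (g x))"
proof (rule Bochner_Integration.integrable_bound)
  show "integrable M (\<lambda>x. (norm (f x))\<^sup>2 + (norm (g x))\<^sup>2)"
    using L2D[OF f] L2D[OF g] by auto
  show "(\<lambda>x. f x * cnj (g x)) \<in> borel_measurable M" using L2D(1)[OF f] L2D(1)[OF g] by measurable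
  show "AE x in M. norm (f x * cnj (g x)) \<le> norm ((norm (f x))\<^sup>2 + (norm (g x))\<^sup>2)"
  proof (intro AE_I2)
    fix x
    have "norm (f x) * norm (g x) \<le> 2 * norm (f x) * norm (g x)" by simp
    also have "\<dots> \<le> (norm (f x))\<^sup>2 + (norm (g x))\<^sup>2" by (rule sum_squares_bound)
    finally show "norm (f x * cnj (g x)) \<le> norm ((norm (f x))\<^sup>2 + (norm (g x))\<^sup>2)"
      by (simp add: norm_mult)
  qed
qed

lemma norm_add_square: "(norm (a + b :: complex))\<^sup>2 = (norm a)\<^sup>2 + (norm b)\<^sup>2 + 2 * Re (a * cnj b)"
  unfolding cmod_power2 by (simp add: power2_eq_square algebra_simps)

lemma L2_add:
  assumes f: "f \<in> L2 M" and g: "g \<in> L2 M"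
  shows "(\<lambda>x. f x + g x) \<in> L2 M"
proof -
  have "integrable M (\<lambda>x. Re (f x * cnj (g x)))" by (rule integrable_Re[OF L2_mult_integrable[OF f g]])
  then have "integrable M (\<lambda>x. (norm (f x + g x))\<^sup>2)"
    unfolding norm_add_square
    by (intro Bochner_Integration.integrable_add integrable_mult_right L2D(2)[OF f] L2D(2)[OF g])
  moreover have "(\<lambda>x. f x + g x) \<in> borel_measurable M" using L2D(1)[OF f] L2D(1)[OF g] by measurable
  ultimately show ?thesis by (simp add: L2_def)
qed

lemma L2_scale:
  assumes f: "f \<in> L2 M"
  shows "(\<lambda>x. c * f x) \<in> L2 M"
  using L2D[OF f] by (auto simp: L2_def norm_mult power_mult_distrib)

lemma L2_norm_add:
  assumes f: "f \<in> L2 M" and g: "g \<in> L2 M"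
  shows "(LINT x|M. (norm (f x + g x))\<^sup>2) =
    (LINT x|M. (norm (f x))\<^sup>2) + (LINT x|M. (norm (g x))\<^sup>2) + 2 * Re (l2_inner M f g)"
proof -
  have i: "integrable M (\<lambda>x. Re (f x * cnj (g x)))" by (rule integrable_Re[OF L2_mult_integrable[OF f g]])
  show ?thesis
    unfolding l2_inner_def norm_add_square integral_Re[OF L2_mult_integrable[OF f g], symmetric]
    using L2D(2)[OF f] L2D(2)[OF g] i
    by (simp only: Bochner_Integration.integral_add Bochner_Integration.integrable_add integrable_mult_right
        integral_mult_right_zero)
qed

lemma l2_inner_scale_right: "l2_inner M f (\<lambda>x. c * g x) = cnj c * l2_inner M f g"
proof -
  have "l2_inner M f (\<lambda>x. c * g x) = (LINT x|M. cnj c * (f x * cnj (g x)))"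
    unfolding l2_inner_def by (intro Bochner_Integration.integral_cong) auto
  then show ?thesis by (simp add: l2_inner_def)
qed

lemma l2_inner_scale_left: "l2_inner M (\<lambda>x. c * f x) g = c * l2_inner M f g"
  by (simp add: l2_inner_def mult.assoc)

lemma l2_inner_cong_AE:
  assumes "f \<in> borel_measurable M" "f' \<in> borel_measurable M" "g \<in> borel_measurable M"
    and "AE x in M. f x = f' x"
  shows "l2_inner M f g = l2_inner M f' g"
proof -
  have "(\<lambda>x. f x * cnj (g x)) \<in> borel_measurable M" "(\<lambda>x. f' x * cnj (g x)) \<in> borel_measurable M"
    by (intro borel_measurable_times borel_measurable_cnj assms)+
  then show ?thesis unfolding l2_inner_def using assms(4) by (intro integral_cong_AE) auto
qed

lemma bounded_integrable_L2:
  fixes f :: "'a \<Rightarrow> complex"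
  assumes "integrable M f" and B: "\<And>x. norm (f x) \<le> B"
  shows "f \<in> L2 M"
  unfolding L2_def
proof (intro CollectI conjI)
  show fm: "f \<in> borel_measurable M" using assms(1) by auto
  show "integrable M (\<lambda>x. (norm (f x))\<^sup>2)"
  proof (rule Bochner_Integration.integrable_bound)
    show "integrable M (\<lambda>x. B * norm (f x))" using assms(1) by auto
    show "AE x in M. norm ((norm (f x))\<^sup>2) \<le> norm (B * norm (f x))"
    proof (intro AE_I2)
      fix x
      have "norm (f x) * norm (f x) \<le> \<bar>B * norm (f x)\<bar>"
        using mult_right_mono[OF B[of x], of "norm (f x)"] by simp
      then show "norm ((norm (f x))\<^sup>2) \<le> norm (B * norm (f x))" by (simp add: power2_eq_square)
    qed
  qed (use fm in measurable)
qed

lemma (in pair_sigma_finite) integrable_prod_mult: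
  fixes f :: "'a \<Rightarrow> real" and g :: "'b \<Rightarrow> real"
  assumes f: "integrable M1 f" and g: "integrable M2 g"
  shows "integrable (M1 \<Otimes>\<^sub>M M2) (\<lambda>p. f (fst p) * g (snd p))"
proof (rule Fubini_integrable)
  show "(\<lambda>p. f (fst p) * g (snd p)) \<in> borel_measurable (M1 \<Otimes>\<^sub>M M2)"
    using f g by measurable
  show "integrable M1 (\<lambda>x. LINT y|M2. norm (f (fst (x, y)) * g (snd (x, y))))"
    using f by (simp add: abs_mult)
  show "AE x in M1. integrable M2 (\<lambda>y. f (fst (x, y)) * g (snd (x, y)))"
    using g by simp
qed

section \<open>The Fourier transform intertwines the two representations\<close>

context elementary_dual_pair
begin

lemma planchD:
  assumes "integrable \<mu> f" "f \<in> L2 \<mu>"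
  shows "fourier \<mu> f \<in> L2 \<nu>" "(LINT c|\<nu>. (norm (fourier \<mu> f c))\<^sup>2) = (LINT s|\<mu>. (norm (f s))\<^sup>2)"
  using planch assms unfolding plancherel_def by blast+

lemma fourier_integrable:
  assumes "integrable \<mu> f"
  shows "integrable \<mu> (\<lambda>s. f s * cnj (char_of c s))"
  using coeff_integrable[OF assms const_bounded_smooth[of 1]] by simp

lemma fourier_add:
  assumes "integrable \<mu> f" "integrable \<mu> g"
  shows "fourier \<mu> (\<lambda>s. f s + g s) c = fourier \<mu> f c + fourier \<mu> g c"
  unfolding fourier_def distrib_right
  by (intro Bochner_Integration.integral_add fourier_integrable assms)

lemma fourier_scale: "fourier \<mu> (\<lambda>s. a * f s) c = a * fourier \<mu> f c"
  unfolding fourier_def by (simp add: mult.assoc)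

text \<open>Polarisation: comparing the squared norms of sums yields equal real parts.\<close>

lemma parseval:
  assumes f: "integrable \<mu> f" "f \<in> L2 \<mu>" and g: "integrable \<mu> g" "g \<in> L2 \<mu>"
  shows "l2_inner \<nu> (fourier \<mu> f) (fourier \<mu> g) = l2_inner \<mu> f g"
proof -
  have Re: "Re (l2_inner \<nu> (fourier \<mu> f) (fourier \<mu> g)) = Re (l2_inner \<mu> f g)"
    if g: "integrable \<mu> g" "g \<in> L2 \<mu>" for g
  proof -
    have "(LINT c|\<nu>. (norm (fourier \<mu> f c + fourier \<mu> g c))\<^sup>2) = (LINT s|\<mu>. (norm (f s + g s))\<^sup>2)"
      using planchD(2)[of "\<lambda>s. f s + g s"] f g by (simp add: L2_add fourier_add)
    then show ?thesis
      unfolding L2_norm_add[OF f(2) g(2)] L2_norm_add[OF planchD(1)[OF f] planchD(1)[OF g]]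
        planchD(2)[OF f] planchD(2)[OF g] by simp
  qed
  \<comment> \<open>Replacing \<open>g\<close> by \<open>\<i> * g\<close> multiplies both products
    by \<open>- \<i>\<close>, whose real part is the former imaginary part.\<close>
  have "Re (- \<i> * l2_inner \<nu> (fourier \<mu> f) (fourier \<mu> g)) = Re (- \<i> * l2_inner \<mu> f g)"
    using Re[of "\<lambda>s. \<i> * g s"] g
    by (simp add: L2_scale fourier_scale[abs_def] l2_inner_scale_right)
  then have "Im (l2_inner \<nu> (fourier \<mu> f) (fourier \<mu> g)) = Im (l2_inner \<mu> f g)" by simp
  with Re[OF g] show ?thesis by (rule complex_eqI)
qed

lemma schwartz_L2: "f \<in> schwartz \<Longrightarrow> f \<in> L2 \<mu>"
  using bounded_integrable_L2[OF schwartz_integrable] schwartzD(2) by metis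

text \<open>Substituting \<open>s + t\<close> for \<open>s\<close> moves the values of the
  characters at \<open>t\<close> out as a phase, and the remaining integral is the transform at
  \<open>\<delta> - c\<close>.\<close>

lemma fourier_heis_rep:
  assumes "\<eta> \<in> borel_measurable borel"
  shows "fourier \<mu> (heis_rep g \<eta>) = heis_rep_op g (fourier \<mu> \<eta>)"
proof
  fix \<delta>
  obtain c t where g: "g = (c, t)" by (cases g)
  have [measurable]: "(\<lambda>s. \<eta> (s - t)) \<in> borel_measurable borel"
    by (intro measurable_compose[OF _ assms] borel_measurable_continuous_onI continuous_intros)
  have m: "(\<lambda>s. char_of c s * \<eta> (s - t) * cnj (char_of \<delta> s)) \<in> borel_measurable borel"
    by measurable
  have "fourier \<mu> (heis_rep g \<eta>) \<delta> = (LINT s|\<mu>. char_of c s * \<eta> (s - t) * cnj (char_of \<delta> s))"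
    by (simp add: fourier_def heis_rep_def g)
  also have "\<dots> = (LINT s|\<mu>. char_of c (s + t) * \<eta> (s + t - t) * cnj (char_of \<delta> (s + t)))"
    by (rule haar_integral_translate(1)[OF haar_G m, symmetric])
  also have "\<dots> = (LINT s|\<mu>. (char_of c t * cnj (char_of \<delta> t)) * (\<eta> s * cnj (char_of (\<delta> - c) s)))"
    by (intro Bochner_Integration.integral_cong refl) (simp add: char_of_add mult_ac)
  also have "\<dots> = (char_of c t * cnj (char_of \<delta> t)) * (LINT s|\<mu>. \<eta> s * cnj (char_of (\<delta> - c) s))"
    by (rule integral_mult_right_zero)
  also have "\<dots> = heis_rep_op g (fourier \<mu> \<eta>) \<delta>"
    by (simp add: heis_rep_op_def g fourier_def mult_ac)
  finally show "fourier \<mu> (heis_rep g \<eta>) \<delta> = heis_rep_op g (fourier \<mu> \<eta>) \<delta>" .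
qed

lemma heis_rep_integrable:
  assumes "integrable \<mu> \<eta>"
  shows "integrable \<mu> (heis_rep g \<eta>)"
proof -
  have m: "\<eta> \<in> borel_measurable borel" using borel_measurable_integrable[OF assms] by (simp only: G)
  have i: "integrable \<mu> (\<lambda>s. \<eta> (s + - snd g))" using haar_integral_translate(2)[OF haar_G m] assms by blast
  show ?thesis
  proof (rule Bochner_Integration.integrable_bound[OF i])
    show "heis_rep g \<eta> \<in> borel_measurable \<mu>"
      using borel_measurable_integrable[OF i] unfolding heis_rep_def[abs_def] G by simp
  qed (simp add: heis_rep_def norm_mult)
qed

text \<open>The Fourier transform is isometric and intertwines the representations, so both
  hermitian products are integrated from one and the same function on the product group.\<close>

lemma coeff_dual:
  assumes "\<xi> \<in> schwartz" "\<eta> \<in> schwartz"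
  shows "l2_inner \<nu> (fourier \<mu> \<xi>) (heis_rep_op g (fourier \<mu> \<eta>)) = coeff \<xi> \<eta> g"
proof -
  obtain B where B: "\<And>s. norm (\<eta> s) \<le> B" using schwartzD(2)[OF assms(2)] by blast
  have i: "integrable \<mu> (heis_rep g \<eta>)" by (intro heis_rep_integrable schwartz_integrable assms)
  have "heis_rep g \<eta> \<in> L2 \<mu>"
    by (rule bounded_integrable_L2[OF i, of B]) (simp add: heis_rep_def norm_mult B)
  with parseval[OF schwartz_integrable[OF assms(1)] schwartz_L2[OF assms(1)] i] show ?thesis
    by (simp add: fourier_heis_rep[OF schwartzD(3)[OF assms(2)]] coeff_eq)
qed

lemma herm_eq: "left_herm \<rho> \<mu> heis_rep \<xi> \<eta> = integrated \<rho> \<mu> heis_rep (coeff \<xi> \<eta>)"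
  by (simp add: left_herm_def coeff_eq)

lemma herm_op_eq:
  assumes "\<xi> \<in> schwartz" "\<eta> \<in> schwartz"
  shows "left_herm \<rho> \<nu> heis_rep_op (fourier \<mu> \<xi>) (fourier \<mu> \<eta>) =
    integrated \<rho> \<nu> heis_rep_op (coeff \<xi> \<eta>)"
  by (simp add: left_herm_def coeff_dual[OF assms])

section \<open>Imprimitivity\<close>

text \<open>The dual weight is multiplied onto the coefficient, which stays Schwartz--Bruhat, and
  the group weight is then taken from its decay.\<close>

lemma coeff_decay:
  assumes "\<xi> \<in> schwartz" "\<eta> \<in> schwartz"
  shows "\<exists>C. \<forall>g. norm (coeff \<xi> \<eta> g) \<le> C * (1 / wD (fst g) * (1 / wG (snd g)))"
proof -
  have homD: "(\<lambda>g. hD i (fst g)) \<in> real_homs" if "i \<in> ID" for i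
    using real_homsD(2)[OF hD_hom[OF that]]
    by (auto simp: real_homs_def intro!: continuous_on_compose2[OF real_homsD(1)[OF hD_hom[OF that]]] continuous_intros)
  have homG: "(\<lambda>g. hG i (snd g)) \<in> real_homs" if "i \<in> IG" for i
    using real_homsD(2)[OF hG_hom[OF that]]
    by (auto simp: real_homs_def intro!: continuous_on_compose2[OF real_homsD(1)[OF hG_hom[OF that]]] continuous_intros)
  have "(\<lambda>g. of_real (hom_weight ID (\<lambda>i g. hD i (fst g)) g) * coeff \<xi> \<eta> g) \<in> schwartz"
    by (rule schwartz_weight_mult[OF finite_ID homD coeff_schwartz[OF assms]])
  from schwartz_decay[where h = "\<lambda>i g. hG i (snd g)", OF finite_IG homG this]
  obtain C where C: "\<And>g. norm (of_real (hom_weight ID (\<lambda>i g. hD i (fst g)) g) * coeff \<xi> \<eta> g)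
      \<le> C / hom_weight IG (\<lambda>i g. hG i (snd g)) g" by blast
  have "norm (coeff \<xi> \<eta> g) \<le> C * (1 / wD (fst g) * (1 / wG (snd g)))" for g
  proof -
    have "hom_weight ID (\<lambda>i g. hD i (fst g)) g = wD (fst g)" "hom_weight IG (\<lambda>i g. hG i (snd g)) g = wG (snd g)"
      by (simp_all add: hom_weight_def)
    with C[of g] have "wD (fst g) * norm (coeff \<xi> \<eta> g) \<le> C / wG (snd g)"
      using hom_weight_pos[of ID hD "fst g"] by (simp add: norm_mult)
    then have "norm (coeff \<xi> \<eta> g) \<le> (C / wG (snd g)) / wD (fst g)"
      using hom_weight_pos[of ID hD "fst g"] by (simp only: pos_le_divide_eq mult.commute)
    then show ?thesis by (simp add: mult.commute)
  qed
  then show ?thesis by blast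
qed

lemma sets_DG: "sets \<rho> = sets (borel \<Otimes>\<^sub>M borel)" and sets_GG: "sets (\<mu> \<Otimes>\<^sub>M \<mu>) = sets (borel \<Otimes>\<^sub>M borel)"
  by (intro sets_pair_measure_cong G N)+

lemma meas_DG: "measurable \<rho> K = measurable (borel \<Otimes>\<^sub>M borel) K"
  and meas_GG: "measurable (\<mu> \<Otimes>\<^sub>M \<mu>) K = measurable (borel \<Otimes>\<^sub>M borel) K"
  by (intro measurable_cong_sets sets_DG sets_GG refl)+

lemma coeff_meas:
  assumes "\<xi> \<in> schwartz" "\<eta> \<in> schwartz"
  shows "coeff \<xi> \<eta> \<in> borel_measurable (borel \<Otimes>\<^sub>M borel)"
  by (rule borel_measurable_pair_continuous_sc[OF coeff_continuous[OF assms(1) schwartz_bounded_smooth[OF assms(2)]]])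

lemma coeff_integrable_DG:
  assumes "\<xi> \<in> schwartz" "\<eta> \<in> schwartz"
  shows "integrable \<rho> (coeff \<xi> \<eta>)"
proof -
  obtain C where C: "\<And>g. norm (coeff \<xi> \<eta> g) \<le> C * (1 / wD (fst g) * (1 / wG (snd g)))"
    using coeff_decay[OF assms] by blast
  show ?thesis
  proof (rule Bochner_Integration.integrable_bound)
    show "integrable \<rho> (\<lambda>g. C * (1 / wD (fst g) * (1 / wG (snd g))))"
      by (intro integrable_mult_right DG.integrable_prod_mult integrable_wD integrable_wG)
    show "coeff \<xi> \<eta> \<in> borel_measurable \<rho>" unfolding meas_DG by (rule coeff_meas[OF assms])
    show "AE g in \<rho>. norm (coeff \<xi> \<eta> g) \<le> norm (C * (1 / wD (fst g) * (1 / wG (snd g))))"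
    proof (intro AE_I2)
      show "norm (coeff \<xi> \<eta> g) \<le> norm (C * (1 / wD (fst g) * (1 / wG (snd g))))" for g
        using C[of g] by (rule order_trans) (simp only: real_norm_def abs_ge_self)
    qed
  qed
qed

text \<open>The representation on the dual evaluates at \<open>\<delta> - c\<close>, so a reflection
  is needed besides translations. It comes from \<open>haar_nn_integral_uminus\<close> with the
  reciprocal weight as test function.\<close>

lemma haar_D_reflect: "distr \<nu> borel (\<lambda>c. \<delta> - c) = \<nu>"
proof (rule measure_eqI)
  obtain B :: "'g dual set set" where B: "countable B" "topological_basis B"
    using dual_countable_basis[OF lc] by blast
  have diff: "(\<lambda>(x, y). x - y :: 'g dual) \<in> borel_measurable (borel \<Otimes>\<^sub>M borel)"
    by (rule borel_measurable_pair_continuous[OF B]) (auto simp: case_prod_unfold intro!: continuous_intros)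
  \<comment> \<open>Were this integral zero, the strictly positive integrand would make the whole
    dual a null set, although it is open and nonempty.\<close>
  have pos: "0 < (\<integral>\<^sup>+c. ennreal (1 / wD c) \<partial>\<nu>)"
  proof (rule ccontr)
    assume "\<not> 0 < (\<integral>\<^sup>+c. ennreal (1 / wD c) \<partial>\<nu>)"
    then have "AE c in \<nu>. ennreal (1 / wD c) = 0"
      by (subst nn_integral_0_iff_AE[symmetric]) (auto simp: N)
    then have "AE c in \<nu>. False"
      by (rule AE_mp) (intro AE_I2, use hom_weight_pos[of ID hD] in \<open>auto simp: ennreal_eq_0_iff not_le\<close>)
    then obtain A where "UNIV \<subseteq> A" "emeasure \<nu> A = 0" by (rule AE_E) (auto simp: N(2))
    then have "emeasure \<nu> UNIV = 0" by (simp add: top.extremum_unique)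
    with N(7)[of UNIV] show False by simp
  qed
  have m: "(\<lambda>c. \<delta> - c) \<in> borel_measurable borel" by (intro borel_measurable_continuous_onI continuous_intros)
  show "sets (distr \<nu> borel (\<lambda>c. \<delta> - c)) = sets \<nu>" by (simp add: N)
  fix A assume "A \<in> sets (distr \<nu> borel (\<lambda>c. \<delta> - c))"
  then have A: "A \<in> sets borel" by simp
  have "emeasure (distr \<nu> borel (\<lambda>c. \<delta> - c)) A = (\<integral>\<^sup>+c. indicator A c \<partial>distr \<nu> borel (\<lambda>c. \<delta> - c))"
    using A by simp
  also have "\<dots> = (\<integral>\<^sup>+c. indicator A (\<delta> - c) \<partial>\<nu>)"
    using A m by (intro nn_integral_distr) (auto simp: N)
  also have "\<dots> = (\<integral>\<^sup>+c. indicator A (\<delta> + c) \<partial>\<nu>)"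
  proof -
    have "(\<lambda>c. indicator A (\<delta> + c) :: ennreal) \<in> borel_measurable borel"
      using A by (intro measurable_compose[OF measurable_translate] borel_measurable_indicator)
    from haar_nn_integral_uminus[OF haar_D sigma_finite_D diff _ pos integrable_weight_D[OF haar_G haar_D planch] this]
    show ?thesis by simp
  qed
  also have "\<dots> = (\<integral>\<^sup>+c. indicator A c \<partial>\<nu>)"
    using haar_nn_integral_translate[OF haar_D, of "indicator A" \<delta>] A by (simp add: add.commute)
  also have "\<dots> = emeasure \<nu> A" using A by (simp add: N)
  finally show "emeasure (distr \<nu> borel (\<lambda>c. \<delta> - c)) A = emeasure \<nu> A" .
qed

lemma integral_D_reflect:
  fixes f :: "'g dual \<Rightarrow> 'b::{banach, second_countable_topology}"
  assumes "f \<in> borel_measurable borel"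
  shows "(LINT c|\<nu>. f (\<delta> - c)) = (LINT c|\<nu>. f c)" "integrable \<nu> (\<lambda>c. f (\<delta> - c)) \<longleftrightarrow> integrable \<nu> f"
proof -
  have m: "(\<lambda>c. \<delta> - c) \<in> measurable \<nu> borel"
    unfolding N by (intro borel_measurable_continuous_onI continuous_intros)
  show "(LINT c|\<nu>. f (\<delta> - c)) = (LINT c|\<nu>. f c)"
    using integral_distr[OF m assms] by (simp add: haar_D_reflect)
  show "integrable \<nu> (\<lambda>c. f (\<delta> - c)) \<longleftrightarrow> integrable \<nu> f"
    using integrable_distr_eq[OF m assms] by (simp add: haar_D_reflect)
qed

text \<open>After the shift by \<open>t\<close> the integrand is \<open>X (t + u) * Y u\<close>, so
  exchanging the integrals and translating by \<open>u\<close> separates the two transforms.\<close>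

lemma fourier_coeff:
  assumes \<xi>: "\<xi> \<in> schwartz" and \<eta>: "\<eta> \<in> schwartz"
  shows "(LINT t|\<mu>. coeff \<xi> \<eta> (c, t) * cnj (char_of \<kappa> t)) = fourier \<mu> \<xi> (c + \<kappa>) * cnj (fourier \<mu> \<eta> \<kappa>)"
proof -
  note [measurable] = schwartzD(3)[OF \<xi>] schwartzD(3)[OF \<eta>]
  define X where "X v = \<xi> v * cnj (char_of (c + \<kappa>) v)" for v
  have Xi: "integrable \<mu> X" unfolding X_def by (rule fourier_integrable[OF schwartz_integrable[OF \<xi>]])
  have Xm [measurable]: "X \<in> borel_measurable borel" unfolding X_def by measurable
  define Y where "Y u = cnj (\<eta> u * cnj (char_of \<kappa> u))" for u
  have Yi: "integrable \<mu> Y" unfolding Y_def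
    by (intro integrable_cnj fourier_integrable[OF schwartz_integrable[OF \<eta>]])
  have Ym [measurable]: "Y \<in> borel_measurable borel" unfolding Y_def by measurable
  have kernel: "coeff \<xi> \<eta> (c, t) * cnj (char_of \<kappa> t) = (LINT u|\<mu>. X (t + u) * Y u)" for t
  proof -
    have "(\<lambda>u. \<eta> (u - t)) \<in> borel_measurable borel"
      by (intro measurable_compose[OF _ schwartzD(3)[OF \<eta>]] borel_measurable_continuous_onI continuous_intros)
    then have m: "(\<lambda>u. \<xi> u * cnj (char_of c u * \<eta> (u - t))) \<in> borel_measurable borel" by measurable
    have "coeff \<xi> \<eta> (c, t) * cnj (char_of \<kappa> t) =
        (LINT u|\<mu>. \<xi> (u + t) * cnj (char_of c (u + t) * \<eta> (u + t - t))) * cnj (char_of \<kappa> t)"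
      unfolding coeff_def fst_conv snd_conv haar_integral_translate(1)[OF haar_G m] ..
    also have "\<dots> = (LINT u|\<mu>. \<xi> (u + t) * cnj (char_of c (u + t) * \<eta> (u + t - t)) * cnj (char_of \<kappa> t))"
      by simp
    also have "\<dots> = (LINT u|\<mu>. X (t + u) * Y u)"
    proof (intro Bochner_Integration.integral_cong refl)
      fix u
      \<comment> \<open>This factor 1 is inserted so that \<open>X\<close> can carry the character
        \<open>\<kappa>\<close> at \<open>t + u\<close>, with the compensating value at
        \<open>u\<close> left in \<open>Y\<close>.\<close>
      have "char_of \<kappa> u * cnj (char_of \<kappa> u) = 1" by simp
      then show "\<xi> (u + t) * cnj (char_of c (u + t) * \<eta> (u + t - t)) * cnj (char_of \<kappa> t) = X (t + u) * Y u"
        by (simp add: X_def Y_def char_of_add add.commute mult_ac)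
    qed
    finally show ?thesis .
  qed
  have int: "integrable (\<mu> \<Otimes>\<^sub>M \<mu>) (\<lambda>(u, t). X (t + u) * Y u)"
  proof (rule GG.Fubini_integrable)
    have "(\<lambda>p. X (snd p + fst p)) \<in> borel_measurable (borel \<Otimes>\<^sub>M borel)"
      by (rule measurable_compose[OF _ Xm]) measurable
    then show "(\<lambda>(u, t). X (t + u) * Y u) \<in> borel_measurable (\<mu> \<Otimes>\<^sub>M \<mu>)"
      unfolding meas_GG case_prod_unfold by measurable
    have tr: "integrable \<mu> (\<lambda>t. X (t + u))" for u using haar_integral_translate(2)[OF haar_G Xm] Xi by blast
    have "(LINT t|\<mu>. norm (X (t + u))) = (LINT t|\<mu>. norm (X t))" for u
    proof -
      have "(LINT t|\<mu>. complex_of_real (norm (X (t + u)))) = (LINT t|\<mu>. complex_of_real (norm (X t)))"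
        by (rule haar_integral_translate(1)[OF haar_G]) measurable
      then show ?thesis unfolding integral_complex_of_real by simp
    qed
    then show "integrable \<mu> (\<lambda>u. LINT t|\<mu>. norm (case (u, t) of (u, t) \<Rightarrow> X (t + u) * Y u))"
      using Yi by (simp add: norm_mult)
    show "AE u in \<mu>. integrable \<mu> (\<lambda>t. case (u, t) of (u, t) \<Rightarrow> X (t + u) * Y u)"
      using tr by auto
  qed
  have "(LINT t|\<mu>. coeff \<xi> \<eta> (c, t) * cnj (char_of \<kappa> t)) = (LINT t|\<mu>. LINT u|\<mu>. X (t + u) * Y u)"
    unfolding kernel ..
  also have "\<dots> = (LINT u|\<mu>. LINT t|\<mu>. X (t + u) * Y u)"
    by (rule GG.Fubini_integral[OF int])
  also have "\<dots> = (LINT u|\<mu>. (LINT t|\<mu>. X t) * Y u)"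
    by (simp add: haar_integral_translate(1)[OF haar_G Xm])
  also have "\<dots> = fourier \<mu> \<xi> (c + \<kappa>) * cnj (fourier \<mu> \<eta> \<kappa>)"
    by (simp add: X_def Y_def fourier_def del: complex_cnj_mult char_of_plus_dual)
  finally show ?thesis .
qed

text \<open>Integrate over the group variable first and use \<open>fourier_coeff\<close> with
  \<open>\<kappa> = \<delta> - c\<close>: then \<open>c + \<kappa> = \<delta>\<close>, so
  \<open>fourier \<mu> \<xi> \<delta>\<close> leaves the integral, and reflecting \<open>c\<close>
  turns the rest into a scalar product.\<close>

lemma herm_op_apply:
  assumes \<xi>: "\<xi> \<in> schwartz" and \<eta>: "\<eta> \<in> schwartz" and \<zeta>: "\<zeta> \<in> L2 \<nu>"
  shows "(LINT g|\<rho>. coeff \<xi> \<eta> g * heis_rep_op g \<zeta> \<delta>) =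
    l2_inner \<nu> \<zeta> (fourier \<mu> \<eta>) * fourier \<mu> \<xi> \<delta>"
proof -
  have \<zeta>m: "\<zeta> \<in> borel_measurable borel" using L2D(1)[OF \<zeta>] by (simp add: N)
  have \<eta>L: "fourier \<mu> \<eta> \<in> L2 \<nu>" by (intro planchD schwartz_integrable schwartz_L2 \<eta>)
  have \<eta>m: "fourier \<mu> \<eta> \<in> borel_measurable borel" using L2D(1)[OF \<eta>L] by (simp add: N)
  define Z where "Z c = \<zeta> (\<delta> - c)" for c
  have Zm: "Z \<in> borel_measurable borel" unfolding Z_def
    by (intro measurable_compose[OF _ \<zeta>m] borel_measurable_continuous_onI continuous_intros)
  have ZL: "Z \<in> L2 \<nu>"
    using integral_D_reflect(2)[of "\<lambda>c. (norm (\<zeta> c))\<^sup>2" \<delta>] L2D[OF \<zeta>] Zm \<zeta>m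
    by (auto simp: L2_def N Z_def)
  define K where "K g = coeff \<xi> \<eta> g * (cnj (char_of (\<delta> - fst g) (snd g)) * Z (fst g))" for g
  obtain C where C: "\<And>g. norm (coeff \<xi> \<eta> g) \<le> C * (1 / wD (fst g) * (1 / wG (snd g)))"
    using coeff_decay[OF \<xi> \<eta>] by blast
  \<comment> \<open>\<open>\<zeta>\<close> is merely square-integrable; the reciprocal weight is
    bounded and integrable, hence also in \<open>L2 \<nu>\<close>, and the product of the two is
    integrable.\<close>
  have wDL: "integrable \<nu> (\<lambda>c. 1 / wD c * norm (Z c))"
  proof -
    have "(\<lambda>c. complex_of_real (1 / wD c)) \<in> L2 \<nu>"
    proof (rule bounded_integrable_L2[of _ _ 1])
      show "integrable \<nu> (\<lambda>c. complex_of_real (1 / wD c))" by (intro integrable_of_real integrable_wD)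
      show "norm (complex_of_real (1 / wD c)) \<le> 1" for c
        using hom_weight_ge_1[of ID hD c] by (simp add: norm_divide)
    qed
    from integrable_norm[OF L2_mult_integrable[OF this ZL]] show ?thesis
      using hom_weight_pos[of ID hD] by (simp add: norm_mult norm_divide abs_of_pos)
  qed
  have Ki: "integrable \<rho> K"
  proof (rule Bochner_Integration.integrable_bound)
    show "integrable \<rho> (\<lambda>g. C * ((1 / wD (fst g) * norm (Z (fst g))) * (1 / wG (snd g))))"
      by (intro integrable_mult_right DG.integrable_prod_mult[where f = "\<lambda>c. 1 / wD c * norm (Z c)"] wDL integrable_wG)
    have "(\<lambda>g. cnj (char_of (\<delta> - fst g) (snd g :: 'g))) \<in> borel_measurable (borel \<Otimes>\<^sub>M borel)"
      by (intro borel_measurable_pair_continuous_sc continuous_intros continuous_on_char_of_compose[OF lc])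
    moreover have "(\<lambda>g. Z (fst g)) \<in> borel_measurable (borel \<Otimes>\<^sub>M borel)"
      by (rule measurable_compose[OF measurable_fst Zm])
    ultimately show "K \<in> borel_measurable \<rho>"
      unfolding meas_DG K_def using coeff_meas[OF \<xi> \<eta>] by (intro borel_measurable_times)
    show "AE g in \<rho>. norm (K g) \<le> norm (C * ((1 / wD (fst g) * norm (Z (fst g))) * (1 / wG (snd g))))"
    proof (intro AE_I2)
      fix g
      have "norm (K g) = norm (coeff \<xi> \<eta> g) * norm (Z (fst g))" by (simp add: K_def norm_mult)
      also have "\<dots> \<le> C * (1 / wD (fst g) * (1 / wG (snd g))) * norm (Z (fst g))"
        by (intro mult_right_mono C) simp
      also have "\<dots> = C * ((1 / wD (fst g) * norm (Z (fst g))) * (1 / wG (snd g)))" by simp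
      also have "\<dots> \<le> norm \<dots>" by (simp only: real_norm_def abs_ge_self)
      finally show "norm (K g) \<le> \<dots>" .
    qed
  qed
  have "(LINT g|\<rho>. coeff \<xi> \<eta> g * heis_rep_op g \<zeta> \<delta>) = (LINT g|\<rho>. K g)"
    by (simp add: K_def heis_rep_op_def Z_def)
  also have "\<dots> = (LINT c|\<nu>. LINT t|\<mu>. K (c, t))" by (rule DG.integral_fst'[OF Ki, symmetric])
  also have "\<dots> = (LINT c|\<nu>. fourier \<mu> \<xi> \<delta> * (\<zeta> (\<delta> - c) * cnj (fourier \<mu> \<eta> (\<delta> - c))))"
  proof (intro Bochner_Integration.integral_cong refl)
    fix c
    have "(LINT t|\<mu>. K (c, t)) = (LINT t|\<mu>. coeff \<xi> \<eta> (c, t) * cnj (char_of (\<delta> - c) t)) * Z c"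
      unfolding K_def fst_conv snd_conv mult.assoc[symmetric] by simp
    also have "\<dots> = fourier \<mu> \<xi> \<delta> * (\<zeta> (\<delta> - c) * cnj (fourier \<mu> \<eta> (\<delta> - c)))"
      unfolding fourier_coeff[OF \<xi> \<eta>] Z_def by simp
    finally show "(LINT t|\<mu>. K (c, t)) = fourier \<mu> \<xi> \<delta> * (\<zeta> (\<delta> - c) * cnj (fourier \<mu> \<eta> (\<delta> - c)))" .
  qed
  also have "\<dots> = fourier \<mu> \<xi> \<delta> * (LINT c|\<nu>. \<zeta> (\<delta> - c) * cnj (fourier \<mu> \<eta> (\<delta> - c)))" by simp
  also have "(LINT c|\<nu>. \<zeta> (\<delta> - c) * cnj (fourier \<mu> \<eta> (\<delta> - c))) = l2_inner \<nu> \<zeta> (fourier \<mu> \<eta>)"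
    unfolding l2_inner_def using \<zeta>m \<eta>m 
    by (intro integral_D_reflect(1)[of "\<lambda>c. \<zeta> c * cnj (fourier \<mu> \<eta> c)"] borel_measurable_times borel_measurable_cnj)
  finally show ?thesis by simp
qed

text \<open>The Fourier transform of \<open>T\<close> is computed by Fubini's theorem and the dual
  formula \<open>herm_op_apply\<close>, and it equals that of the claimed multiple of
  \<open>\<xi>\<close>. Taking \<open>\<zeta>\<close> integrable and bounded keeps \<open>T\<close>
  in the domain where Plancherel's theorem applies.\<close>

lemma herm_apply:
  assumes \<xi>: "\<xi> \<in> schwartz" and \<eta>: "\<eta> \<in> schwartz" and \<zeta>: "integrable \<mu> \<zeta>" and B: "\<And>s. norm (\<zeta> s) \<le> B"
  defines "T \<equiv> \<lambda>s. LINT g|\<rho>. coeff \<xi> \<eta> g * heis_rep g \<zeta> s"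
  shows "integrable \<mu> T" "\<exists>B'. \<forall>s. norm (T s) \<le> B'" "AE s in \<mu>. T s = l2_inner \<mu> \<zeta> \<eta> * \<xi> s"
proof -
  have \<zeta>m: "\<zeta> \<in> borel_measurable borel" using borel_measurable_integrable[OF \<zeta>] by (simp only: G)
  have \<zeta>L: "\<zeta> \<in> L2 \<mu>" by (rule bounded_integrable_L2[OF \<zeta> B])
  interpret Q: pair_sigma_finite "\<rho>" \<mu>
    using DG.sigma_finite_measure_axioms sigma_finite_G by (simp add: pair_sigma_finite_def)
  have sQ: "measurable (\<rho> \<Otimes>\<^sub>M \<mu>) K' = measurable ((borel \<Otimes>\<^sub>M borel) \<Otimes>\<^sub>M borel) K'" for K'
    by (intro measurable_cong_sets sets_pair_measure_cong sets_DG G refl)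
  define K where "K p = coeff \<xi> \<eta> (fst p) * heis_rep (fst p) \<zeta> (snd p)" for p
  have ci: "integrable \<rho> (coeff \<xi> \<eta>)" by (rule coeff_integrable_DG[OF \<xi> \<eta>])
  have Km: "K \<in> borel_measurable ((borel \<Otimes>\<^sub>M borel) \<Otimes>\<^sub>M borel)"
  proof -
    have 1: "(\<lambda>p. coeff \<xi> \<eta> (fst p)) \<in> borel_measurable ((borel \<Otimes>\<^sub>M borel) \<Otimes>\<^sub>M (borel :: 'g measure))"
      by (rule measurable_compose[OF measurable_fst coeff_meas[OF \<xi> \<eta>]])
    have ev: "(\<lambda>q. char_of (fst q) (snd q :: 'g)) \<in> borel_measurable (borel \<Otimes>\<^sub>M borel)"
      by (intro borel_measurable_pair_continuous_sc continuous_intros continuous_on_char_of_compose[OF lc])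
    have "(\<lambda>p. (fst (fst p), snd p)) \<in> measurable (((borel :: 'g dual measure) \<Otimes>\<^sub>M (borel :: 'g measure)) \<Otimes>\<^sub>M borel) (borel \<Otimes>\<^sub>M (borel :: 'g measure))"
      by measurable
    from measurable_compose[OF this ev]
    have 2: "(\<lambda>p. char_of (fst (fst p)) (snd p)) \<in> borel_measurable (((borel :: 'g dual measure) \<Otimes>\<^sub>M (borel :: 'g measure)) \<Otimes>\<^sub>M (borel :: 'g measure))"
      by simp
    have "(\<lambda>p. snd p - snd (fst p)) \<in> borel_measurable (((borel :: 'g dual measure) \<Otimes>\<^sub>M borel) \<Otimes>\<^sub>M (borel :: 'g measure))"
      by (rule borel_measurable_continuous_Pair[where H = "\<lambda>x y. x - y"]) (measurable, intro continuous_intros)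
    from measurable_compose[OF this \<zeta>m]
    have 3: "(\<lambda>p. \<zeta> (snd p - snd (fst p))) \<in> borel_measurable (((borel :: 'g dual measure) \<Otimes>\<^sub>M borel) \<Otimes>\<^sub>M (borel :: 'g measure))" .
    show ?thesis unfolding K_def heis_rep_def using 1 2 3 by (intro borel_measurable_times)
  qed
  have nh: "norm (heis_rep g \<zeta> s) = norm (\<zeta> (s + - snd g))" for g s by (simp add: heis_rep_def norm_mult)
  have tr: "(LINT s|\<mu>. norm (\<zeta> (s + a))) = (LINT s|\<mu>. norm (\<zeta> s))" for a
  proof -
    have "(LINT t|\<mu>. complex_of_real (norm (\<zeta> (t + a)))) = (LINT t|\<mu>. complex_of_real (norm (\<zeta> t)))"
      by (rule haar_integral_translate(1)[OF haar_G]) (use \<zeta>m in measurable)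
    then show ?thesis unfolding integral_complex_of_real by simp
  qed
  have Ki: "integrable (\<rho> \<Otimes>\<^sub>M \<mu>) K"
  proof (rule Q.Fubini_integrable)
    show "K \<in> borel_measurable (\<rho> \<Otimes>\<^sub>M \<mu>)" unfolding sQ by (rule Km)
    show "integrable \<rho> (\<lambda>g. LINT s|\<mu>. norm (K (g, s)))"
      using ci tr[of "- _"] by (simp add: K_def norm_mult nh)
    show "AE g in \<rho>. integrable \<mu> (\<lambda>s. K (g, s))"
      unfolding K_def by (auto intro!: integrable_mult_right heis_rep_integrable[OF \<zeta>])
  qed
  have Ki': "integrable (\<rho> \<Otimes>\<^sub>M \<mu>) (\<lambda>(g, s). K (g, s) * cnj (char_of \<delta> s))" for \<delta>
  proof (rule Bochner_Integration.integrable_bound[OF Ki])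
    show "(\<lambda>(g, s). K (g, s) * cnj (char_of \<delta> s)) \<in> borel_measurable (\<rho> \<Otimes>\<^sub>M \<mu>)"
      unfolding sQ case_prod_unfold using Km by simp measurable
  qed (auto simp: norm_mult)
  have T: "T s = (LINT g|\<rho>. K (g, s))" for s by (simp add: T_def K_def)
  have "integrable (\<rho> \<Otimes>\<^sub>M \<mu>) (\<lambda>(g, s). K (g, s))" using Ki by simp
  from Q.integrable_snd[OF this] show Ti: "integrable \<mu> T" unfolding T[abs_def] .
  have "norm (T s) \<le> (LINT g|\<rho>. norm (coeff \<xi> \<eta> g) * B)" for s
  proof -
    have "norm (T s) \<le> (LINT g|\<rho>. norm (K (g, s)))" unfolding T by (rule integral_norm_bound)
    also have "\<dots> \<le> (LINT g|\<rho>. norm (coeff \<xi> \<eta> g) * B)"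
    proof (rule integral_mono')
      show "integrable \<rho> (\<lambda>g. norm (coeff \<xi> \<eta> g) * B)" using ci by auto
      show "norm (K (g, s)) \<le> norm (coeff \<xi> \<eta> g) * B" for g
        unfolding K_def by (simp add: norm_mult nh mult_left_mono B)
      show "0 \<le> norm (coeff \<xi> \<eta> g) * B" for g using order_trans[OF norm_ge_zero B] by simp
    qed
    finally show ?thesis .
  qed
  then show Tb: "\<exists>B'. \<forall>s. norm (T s) \<le> B'" by blast
  then have TL: "T \<in> L2 \<mu>" using bounded_integrable_L2[OF Ti] by blast
  have FT: "fourier \<mu> T \<delta> = l2_inner \<mu> \<zeta> \<eta> * fourier \<mu> \<xi> \<delta>" for \<delta>
  proof -
    have "fourier \<mu> T \<delta> = (LINT s|\<mu>. LINT g|\<rho>. K (g, s) * cnj (char_of \<delta> s))"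
      unfolding fourier_def T by simp
    also have "\<dots> = (LINT g|\<rho>. LINT s|\<mu>. K (g, s) * cnj (char_of \<delta> s))"
      by (rule Q.Fubini_integral[OF Ki'])
    also have "\<dots> = (LINT g|\<rho>. coeff \<xi> \<eta> g * fourier \<mu> (heis_rep g \<zeta>) \<delta>)"
      by (simp add: K_def fourier_def mult.assoc)
    also have "\<dots> = (LINT g|\<rho>. coeff \<xi> \<eta> g * heis_rep_op g (fourier \<mu> \<zeta>) \<delta>)"
      by (simp add: fourier_heis_rep[OF \<zeta>m])
    also have "\<dots> = l2_inner \<nu> (fourier \<mu> \<zeta>) (fourier \<mu> \<eta>) * fourier \<mu> \<xi> \<delta>"
      by (rule herm_op_apply[OF \<xi> \<eta> planchD(1)[OF \<zeta> \<zeta>L]])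
    also have "l2_inner \<nu> (fourier \<mu> \<zeta>) (fourier \<mu> \<eta>) = l2_inner \<mu> \<zeta> \<eta>"
      by (rule parseval[OF \<zeta> \<zeta>L schwartz_integrable[OF \<eta>] schwartz_L2[OF \<eta>]])
    finally show ?thesis .
  qed
  \<comment> \<open>The transform of this difference vanishes identically, so Plancherel's theorem
    makes \<open>u\<close> a null function.\<close>
  define u where "u s = T s + - l2_inner \<mu> \<zeta> \<eta> * \<xi> s" for s
  have ui: "integrable \<mu> u" unfolding u_def
    by (intro Bochner_Integration.integrable_add Ti integrable_mult_right schwartz_integrable \<xi>)
  have uL: "u \<in> L2 \<mu>" unfolding u_def by (intro L2_add TL L2_scale schwartz_L2 \<xi>)
  have "integrable \<mu> (\<lambda>s. - l2_inner \<mu> \<zeta> \<eta> * \<xi> s)"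
    by (intro integrable_mult_right schwartz_integrable \<xi>)
  then have "fourier \<mu> u c = 0" for c
    unfolding u_def fourier_add[OF Ti \<open>integrable \<mu> (\<lambda>s. - l2_inner \<mu> \<zeta> \<eta> * \<xi> s)\<close>] fourier_scale FT by simp
  then have "(LINT s|\<mu>. (norm (u s))\<^sup>2) = 0" using planchD(2)[OF ui uL] by simp
  then have "AE s in \<mu>. (norm (u s))\<^sup>2 = 0"
    using L2D(2)[OF uL] by (subst (asm) integral_nonneg_eq_0_iff_AE) auto
  then show "AE s in \<mu>. T s = l2_inner \<mu> \<zeta> \<eta> * \<xi> s" by (auto simp: u_def)
qed

text \<open>Integrability and boundedness are recorded along with the formula so that the lemma
  applies to its own output, as the product of two operators requires.\<close>

lemma herm_AE:
  assumes "\<xi> \<in> schwartz" "\<eta> \<in> schwartz" and \<zeta>: "integrable \<mu> \<zeta>" and B: "\<exists>B. \<forall>s. norm (\<zeta> s) \<le> B"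
  shows "integrable \<mu> (herm \<mu> \<nu> \<xi> \<eta> \<zeta>)" "\<exists>B. \<forall>s. norm (herm \<mu> \<nu> \<xi> \<eta> \<zeta> s) \<le> B"
    "AE s in \<mu>. herm \<mu> \<nu> \<xi> \<eta> \<zeta> s = l2_inner \<mu> \<zeta> \<eta> * \<xi> s"
proof -
  obtain B where B: "\<And>s. norm (\<zeta> s) \<le> B" using B by blast
  have "herm \<mu> \<nu> \<xi> \<eta> \<zeta> = (\<lambda>s. LINT g|(\<nu> \<Otimes>\<^sub>M \<mu>). coeff \<xi> \<eta> g * heis_rep g \<zeta> s)"
    using bounded_integrable_L2[OF \<zeta> B] by (simp add: herm_eq integrated_def)
  with herm_apply[OF assms(1,2) \<zeta> B] show "integrable \<mu> (herm \<mu> \<nu> \<xi> \<eta> \<zeta>)"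
    "\<exists>B. \<forall>s. norm (herm \<mu> \<nu> \<xi> \<eta> \<zeta> s) \<le> B"
    "AE s in \<mu>. herm \<mu> \<nu> \<xi> \<eta> \<zeta> s = l2_inner \<mu> \<zeta> \<eta> * \<xi> s" by simp_all
qed

lemma herm_op_rank_one:
  assumes "\<xi> \<in> schwartz" "\<eta> \<in> schwartz" "\<zeta> \<in> L2 \<nu>"
  shows "herm_op \<mu> \<nu> (fourier \<mu> \<xi>) (fourier \<mu> \<eta>) \<zeta> = (\<lambda>\<delta>. l2_inner \<nu> \<zeta> (fourier \<mu> \<eta>) * fourier \<mu> \<xi> \<delta>)"
  using assms(3) by (auto simp: herm_op_eq[OF assms(1,2)] integrated_def herm_op_apply[OF assms])

lemma herm_op_in_alg:
  assumes "\<xi> \<in> schwartz" "\<eta> \<in> schwartz"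
  shows "herm_op \<mu> \<nu> (fourier \<mu> \<xi>) (fourier \<mu> \<eta>) \<in> alg_op \<mu> \<nu>"
  unfolding herm_op_eq[OF assms] schwartz_algebra_def using coeff_schwartz[OF assms] by blast

end

theorem proposition3p3:
  fixes \<mu> :: "'g::{topological_ab_group_add, t2_space, second_countable_topology} measure"
    and \<nu> :: "'g dual measure"
    and D :: "nat \<Rightarrow> 'g operator \<Rightarrow> 'g operator"
    and D' :: "nat \<Rightarrow> 'g dual operator \<Rightarrow> 'g dual operator"
    and cov :: "nat \<Rightarrow> ('g \<Rightarrow> complex) \<Rightarrow> 'g \<Rightarrow> complex"
    and cov' :: "nat \<Rightarrow> ('g dual \<Rightarrow> complex) \<Rightarrow> 'g dual \<Rightarrow> complex"
    and \<psi> :: "'g \<Rightarrow> complex"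
  assumes "locally compact (UNIV :: 'g set)"
    and "elementary_group TYPE('g)"
    and "haar_measure \<mu>" and "haar_measure \<nu>" and "plancherel \<mu> \<nu>"
    and "infinitesimal_torus_action \<mu> (alg \<mu> \<nu>) D"
    and "infinitesimal_torus_action \<nu> (alg_op \<mu> \<nu>) D'"
    and "\<forall>j\<in>{1, 2}. trace_invariant (\<nu> \<Otimes>\<^sub>M \<mu>) \<mu> heis_rep (D j)"
    and "\<forall>j\<in>{1, 2}. trace_invariant (\<nu> \<Otimes>\<^sub>M \<mu>) \<nu> heis_rep_op (D' j)"
    and "\<forall>j\<in>{1, 2}. covariant_derivative (\<nu> \<Otimes>\<^sub>M \<mu>) \<mu> heis_rep (D j) (cov j)"
    and "\<forall>j\<in>{1, 2}. covariant_derivative (\<nu> \<Otimes>\<^sub>M \<mu>) \<nu> heis_rep_op (D' j) (cov' j)"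
    and "\<forall>\<xi>\<in>schwartz. fourier \<mu> (cov 1 \<xi>) = cov' 2 (fourier \<mu> \<xi>)"
    and "\<forall>\<xi>\<in>schwartz. fourier \<mu> (cov 2 \<xi>) = cov' 1 (fourier \<mu> \<xi>)"
    and "\<psi> \<in> schwartz"
    and "(LINT s|\<mu>. (norm (\<psi> s))\<^sup>2) = 1"
    and "herm \<mu> \<nu> \<psi> \<psi> \<in> alg \<mu> \<nu>"
    and "op_mult \<mu> (antiholo_deriv \<mu> D (herm \<mu> \<nu> \<psi> \<psi>)) (herm \<mu> \<nu> \<psi> \<psi>) = op_zero \<mu>"
  shows "herm_op \<mu> \<nu> (fourier \<mu> \<psi>) (fourier \<mu> \<psi>) \<in> alg_op \<mu> \<nu> \<and>
    op_mult \<nu> (holo_deriv \<nu> D' (herm_op \<mu> \<nu> (fourier \<mu> \<psi>) (fourier \<mu> \<psi>)))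
      (herm_op \<mu> \<nu> (fourier \<mu> \<psi>) (fourier \<mu> \<psi>)) = op_zero \<nu>"
proof -
  obtain n p q x e z \<tau> k \<iota> and pf :: "'g \<Rightarrow> 'g" where "elementary_coords n p q x e z \<tau> k \<iota> pf"
    using elementary_group_coords[OF assms(2)] by blast
  then interpret elementary_dual_pair n p q x e z \<tau> k \<iota> pf \<mu> \<nu>
    using assms(1,3-5)
    by (intro elementary_dual_pair.intro elementary_lc_coords.intro
        elementary_lc_coords_axioms.intro elementary_dual_pair_axioms.intro)
  have cd: "covariant_derivative (\<nu> \<Otimes>\<^sub>M \<mu>) \<mu> heis_rep (D j) (cov j)"
    and cd': "covariant_derivative (\<nu> \<Otimes>\<^sub>M \<mu>) \<nu> heis_rep_op (D' j) (cov' j)" if "j \<in> {1, 2}" for j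
    using assms(10,11) that by blast+
  have \<psi>: "\<psi> \<in> schwartz" by fact
  define Z where "Z j = cov j \<psi>" for j
  have Z: "Z j \<in> schwartz" if "j \<in> {1, 2}" for j
    using cd[OF that] \<psi> unfolding covariant_derivative_def Z_def by blast
  have Z12: "Z 1 \<in> schwartz" "Z 2 \<in> schwartz" by (simp_all add: Z)
  define P where "P = herm \<mu> \<nu> \<psi> \<psi>"
  have DP: "D j P = op_add \<mu> (herm \<mu> \<nu> (Z j) \<psi>) (herm \<mu> \<nu> \<psi> (Z j))" if "j \<in> {1, 2}" for j
    using cd[OF that] \<psi> unfolding covariant_derivative_def P_def Z_def by blast
  have \<psi>1: "l2_inner \<mu> \<psi> \<psi> = 1"
  proof -
    have "l2_inner \<mu> \<psi> \<psi> = (LINT s|\<mu>. complex_of_real ((norm (\<psi> s))\<^sup>2))"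
      unfolding l2_inner_def complex_norm_square ..
    then show ?thesis using assms(15) by (simp only: integral_complex_of_real of_real_1)
  qed
  have \<psi>i: "integrable \<mu> \<psi>" and \<psi>b: "\<exists>B. \<forall>s. norm (\<psi> s) \<le> B" and \<psi>L: "\<psi> \<in> L2 \<mu>"
    using \<psi> by (rule schwartz_integrable schwartzD(2) schwartz_L2)+
  define b where "b j = l2_inner \<mu> \<psi> (Z j)" for j
  \<comment> \<open>\<open>Q\<close> agrees with \<open>\<psi>\<close> almost everywhere, not
    literally, and need not be known to be Schwartz--Bruhat. Scalar products do not see the
    difference, which suffices for the rank-one formulas.\<close>
  define Q where "Q = P \<psi>"
  have Qi: "integrable \<mu> Q" and Qb: "\<exists>B. \<forall>s. norm (Q s) \<le> B" and Qae: "AE s in \<mu>. Q s = \<psi> s"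
    using herm_AE[OF \<psi> \<psi> \<psi>i \<psi>b] unfolding Q_def P_def \<psi>1 by simp_all
  have QL: "Q \<in> L2 \<mu>" using bounded_integrable_L2[OF Qi] Qb by blast
  have Qg: "l2_inner \<mu> Q g = l2_inner \<mu> \<psi> g" if "g \<in> schwartz" for g
    using Qi \<psi>i schwartz_integrable[OF that] Qae by (intro l2_inner_cong_AE) auto
  have sd: "D 1 P Q s + \<i> * D 2 P Q s = 0" for s
    using fun_cong[OF fun_cong[OF assms(17)], of \<psi> s] \<psi>L QL
    by (simp add: op_mult_def compose_def op_zero_def antiholo_deriv_def op_add_def op_scale_def
        P_def[symmetric] Q_def[symmetric])
  \<comment> \<open>The product rule for the hermitian product gives two rank-one terms, with
    coefficients \<open>l2_inner \<mu> \<psi> \<psi> = 1\<close> and \<open>b j\<close>.\<close>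
  have DQ: "AE s in \<mu>. D j P Q s = Z j s + b j * \<psi> s" if "j \<in> {1, 2}" for j
    using herm_AE(3)[OF Z[OF that] \<psi> Qi Qb] herm_AE(3)[OF \<psi> Z[OF that] Qi Qb] QL
    by (auto simp: DP[OF that] op_add_def Qg[OF \<psi>] Qg[OF Z[OF that]] \<psi>1 b_def)
  have ae: "AE s in \<mu>. (Z 1 s + b 1 * \<psi> s) + \<i> * (Z 2 s + b 2 * \<psi> s) = 0"
    using DQ[OF insertI1] DQ[OF insertI2[OF singletonI]]
  proof eventually_elim
    case (elim s)
    show ?case using sd[of s] unfolding elim .
  qed
  define F where "F = fourier \<mu>"
  have key: "(F (Z 1) c + b 1 * F \<psi> c) + \<i> * (F (Z 2) c + b 2 * F \<psi> c) = 0" for c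
  proof -
    \<comment> \<open>A null function has Fourier integral zero at every character, so the
      exceptional set disappears here.\<close>
    define u where "u s = (Z 1 s + b 1 * \<psi> s) + \<i> * (Z 2 s + b 2 * \<psi> s)" for s
    have "F u c = 0"
      unfolding F_def fourier_def using ae by (intro integral_eq_zero_AE) (auto simp: u_def)
    moreover have "F u c = (F (Z 1) c + b 1 * F \<psi> c) + \<i> * (F (Z 2) c + b 2 * F \<psi> c)"
      unfolding F_def u_def using Z12 \<psi>
      by (simp add: fourier_add fourier_scale schwartz_integrable schwartz_add schwartz_scale)
    ultimately show ?thesis by simp
  qed
  have FS: "F f \<in> schwartz" if "f \<in> schwartz" for f unfolding F_def by (rule fourier_schwartz[OF that])
  have FL: "F f \<in> L2 \<nu>" if "f \<in> schwartz" for f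
    unfolding F_def by (intro planchD schwartz_integrable schwartz_L2 that)
  have F\<psi>: "l2_inner \<nu> (F \<psi>) (F g) = l2_inner \<mu> \<psi> g" if "g \<in> schwartz" for g
    unfolding F_def by (intro parseval schwartz_integrable schwartz_L2 that \<psi>)
  \<comment> \<open>The interchange of the indices is what turns self-duality into
    anti-self-duality.\<close>
  have c': "cov' 1 (F \<psi>) = F (Z 2)" "cov' 2 (F \<psi>) = F (Z 1)"
    using assms(12,13) \<psi> unfolding F_def Z_def by auto
  define P' where "P' = herm_op \<mu> \<nu> (F \<psi>) (F \<psi>)"
  have DP': "D' j P' = op_add \<nu> (herm_op \<mu> \<nu> (cov' j (F \<psi>)) (F \<psi>)) (herm_op \<mu> \<nu> (F \<psi>) (cov' j (F \<psi>)))"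
    if "j \<in> {1, 2}" for j
    using cd'[OF that] FS[OF \<psi>] unfolding covariant_derivative_def P'_def by blast
  have r1: "herm_op \<mu> \<nu> (F f) (F g) \<zeta> = (\<lambda>\<delta>. l2_inner \<nu> \<zeta> (F g) * F f \<delta>)"
    if "f \<in> schwartz" "g \<in> schwartz" "\<zeta> \<in> L2 \<nu>" for f g \<zeta>
    unfolding F_def by (rule herm_op_rank_one[OF that])
  have "op_mult \<nu> (holo_deriv \<nu> D' P') P' = op_zero \<nu>"
  proof (intro ext)
    fix \<zeta> \<delta>
    show "op_mult \<nu> (holo_deriv \<nu> D' P') P' \<zeta> \<delta> = op_zero \<nu> \<zeta> \<delta>"
    proof (cases "\<zeta> \<in> L2 \<nu>")
      case False
      then show ?thesis by (simp add: op_mult_def compose_def op_zero_def)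
    next
      case True
      define a where "a = l2_inner \<nu> \<zeta> (F \<psi>)"
      have P'\<zeta>: "P' \<zeta> = (\<lambda>\<delta>. a * F \<psi> \<delta>)" unfolding P'_def a_def by (rule r1[OF \<psi> \<psi> True])
      have L: "(\<lambda>\<delta>. a * F \<psi> \<delta>) \<in> L2 \<nu>" by (intro L2_scale FL \<psi>)
      have i: "l2_inner \<nu> (\<lambda>\<delta>. a * F \<psi> \<delta>) (F \<psi>) = a" "l2_inner \<nu> (\<lambda>\<delta>. a * F \<psi> \<delta>) (F (Z 1)) = a * b 1"
        "l2_inner \<nu> (\<lambda>\<delta>. a * F \<psi> \<delta>) (F (Z 2)) = a * b 2"
        using Z12 \<psi> by (simp_all add: l2_inner_scale_left F\<psi> \<psi>1 b_def)
      have "op_mult \<nu> (holo_deriv \<nu> D' P') P' \<zeta> \<delta> =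
          D' 1 P' (\<lambda>\<delta>. a * F \<psi> \<delta>) \<delta> - \<i> * D' 2 P' (\<lambda>\<delta>. a * F \<psi> \<delta>) \<delta>"
        using True L by (simp add: op_mult_def compose_def holo_deriv_def op_add_def op_scale_def P'\<zeta>)
      also have "\<dots> = (a * F (Z 2) \<delta> + a * b 2 * F \<psi> \<delta>) - \<i> * (a * F (Z 1) \<delta> + a * b 1 * F \<psi> \<delta>)"
        using L Z12 \<psi> by (simp add: DP' c' op_add_def r1 i del: One_nat_def)
      \<comment> \<open>With the indices exchanged,
        \<open>X 2 - \<i> * X 1 = - \<i> * (X 1 + \<i> * X 2)\<close>, where \<open>X j\<close>
        stands for \<open>F (Z j) \<delta> + b j * F \<psi> \<delta>\<close>.\<close>
      also have "\<dots> = - \<i> * a * ((F (Z 1) \<delta> + b 1 * F \<psi> \<delta>) + \<i> * (F (Z 2) \<delta> + b 2 * F \<psi> \<delta>))"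
        using i_squared by algebra
      also have "\<dots> = 0" unfolding key by simp
      finally show ?thesis using True by (simp add: op_zero_def)
    qed
  qed
  with herm_op_in_alg[OF \<psi> \<psi>] show ?thesis by (simp add: P'_def F_def)
qed

end
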